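(* Let $r,s\ge2$. Every local proper holomorphic map from $\mathbb B^{r,s,t}$ to $\mathbb B^{r,s',t'}$ is quasi-standard (standard when $t'=0$).
   Context: Let $r,s,t\ge 0$ be integers with $n=r+s+t>0$. $\mathbb C^{r,s,t}$ denotes $\mathbb C^n$ equipped with the (possibly degenerate, indefinite) Hermitian form $\langle z,w\rangle_{r,s,t}=\sum_{j=1}^{r}z_j\bar w_j-\sum_{j=r+1}^{r+s}z_j\bar w_j$, and $\mathbb P^{r,s,t}$ is its projectivization. A point $[z]$ is positive or null according as $\langle z,z\rangle_{r,s,t}>0$ or $=0$. The generalized ball $\mathbb B^{r,s,t}$ is the set of positive points and $\partial\mathbb B^{r,s,t}$ the set of null points. A local proper holomorphic map from $\mathbb B^{r,s,t}$ to $\mathbb B^{r',s',t'}$ is a holomorphic map $f:U\to\mathbb P^{r',s',t'}$ on a connected open set $U\subset\mathbb P^{r,s,t}$ with $U\cap\partial\mathbb B^{r,s,t}\ne\varnothing$, $f(U\cap\mathbb B^{r,s,t})\subset\mathbb B^{r',s',t'}$ and $f(U\cap\partial\mathbb B^{r,s,t})\subset\partial\mathbb B^{r',s',t'}$. A complex linear subspace $H$ (or $\mathbb PH$) is a null space if the form vanishes identically on $H$. $f$ is standard if it is induced by a linear isometry $\mathbb C^{r,s,t}\to\mathbb C^{r',s',t'}$ (a linear map $L$ with $\langle Lu,Lv\rangle_{r',s',t'}=\langle u,v\rangle_{r,s,t}$); null if $f(U)$ is contained in a null space. $f$ is quasi-standard if either $f$ is standard, or there is a decomposition $\mathbb C^{r',s',t'}=A\oplus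 B$ into nonzero subspaces with $\langle a,b\rangle_{r',s',t'}=0$ for all $a\in A,b\in B$ such that $\pi_A\circ f$ is standard and $\pi_B\circ f$ is null, where $\pi_A:\mathbb P^{r',s',t'}\dashrightarrow\mathbb PA$, $\pi_B:\mathbb P^{r',s',t'}\dashrightarrow\mathbb PB$ are induced by the linear projections, and $\mathbb PA,\mathbb PB$ carry the restricted forms. *)

theory Defs
  imports "HOL-Analysis.Analysis"
begin

text \<open>Coordinates of C^n are indexed by a finite linearly ordered type 'n;
  idx i is the 0-based position of i in that order.  C^{r,s,t}: the first r
  coordinates are positive, the next s negative, the remaining t = CARD('n)-r-s null.\<close>

definition idx :: "'n::{finite,linorder} \<Rightarrow> nat" where
  "idx i = card {j. j < i}"

definition hform :: "nat \<Rightarrow> nat \<Rightarrow> complex^'n::{finite,linorder} \<Rightarrow> complex^'n::{finite,linorder} \<Rightarrow> complex" where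
  "hform r s z w =
     (\<Sum>i\<in>{i. idx i < r}. z$i * cnj (w$i))
   - (\<Sum>i\<in>{i. r \<le> idx i \<and> idx i < r + s}. z$i * cnj (w$i))"

text \<open>A projective point [z] is represented by any nonzero representative z.\<close>

definition positive_pt :: "nat \<Rightarrow> nat \<Rightarrow> complex^'n::{finite,linorder} \<Rightarrow> bool" where
  "positive_pt r s z \<longleftrightarrow> z \<noteq> 0 \<and> Re (hform r s z z) > 0"

definition null_pt :: "nat \<Rightarrow> nat \<Rightarrow> complex^'n::{finite,linorder} \<Rightarrow> bool" where
  "null_pt r s z \<longleftrightarrow> z \<noteq> 0 \<and> hform r s z z = 0"

definition csubspace :: "(complex^'n::{finite,linorder}) set \<Rightarrow> bool" where
  "csubspace H \<longleftrightarrow> 0 \<in> H \<and> (\<forall>x\<in>H. \<forall>y\<in>H. x + y \<in> H) \<and> (\<forall>c. \<forall>x\<in>H. c *s x \<in> H)"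

definition clinear_map :: "(complex^'n::{finite,linorder} \<Rightarrow> complex^'m::{finite,linorder}) \<Rightarrow> bool" where
  "clinear_map L \<longleftrightarrow> (\<forall>x y. L (x + y) = L x + L y) \<and> (\<forall>c x. L (c *s x) = c *s L x)"

definition holo_on :: "(complex^'n::{finite,linorder}) set \<Rightarrow> (complex^'n::{finite,linorder} \<Rightarrow> complex^'m::{finite,linorder}) \<Rightarrow> bool" where
  "holo_on W G \<longleftrightarrow> (\<forall>z\<in>W. \<exists>D. (G has_derivative D) (at z) \<and> (\<forall>c v. D (c *s v) = c *s D v))"

text \<open>An open subset U of P^{n-1} is represented by its cone (preimage in C^n - 0).\<close>

definition proj_open_cone :: "(complex^'n::{finite,linorder}) set \<Rightarrow> bool" where
  "proj_open_cone U \<longleftrightarrow> open U \<and> 0 \<notin> U \<and> (\<forall>z\<in>U. \<forall>c. c \<noteq> 0 \<longrightarrow> c *s z \<in> U)"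

text \<open>A map f : U -> P^{m-1} is represented by F on the cone with F z a
  representative of f([z]).  It is well defined on projective points and
  holomorphic (locally admits holomorphic nowhere-zero lifts).\<close>

definition holo_proj_map :: "(complex^'n::{finite,linorder}) set \<Rightarrow> (complex^'n::{finite,linorder} \<Rightarrow> complex^'m::{finite,linorder}) \<Rightarrow> bool" where
  "holo_proj_map U F \<longleftrightarrow>
     (\<forall>z\<in>U. F z \<noteq> 0)
   \<and> (\<forall>z\<in>U. \<forall>c. c \<noteq> 0 \<longrightarrow> (\<exists>\<mu>. \<mu> \<noteq> 0 \<and> F (c *s z) = \<mu> *s F z))
   \<and> (\<forall>z0\<in>U. \<exists>W G. open W \<and> z0 \<in> W \<and> W \<subseteq> U \<and> holo_on W G \<and>
        (\<forall>z\<in>W. G z \<noteq> 0 \<and> (\<exists>c. c \<noteq> 0 \<and> F z = c *s G z)))"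

definition local_proper_map ::
  "nat \<Rightarrow> nat \<Rightarrow> nat \<Rightarrow> nat \<Rightarrow> (complex^'n::{finite,linorder}) set
     \<Rightarrow> (complex^'n::{finite,linorder} \<Rightarrow> complex^'m::{finite,linorder}) \<Rightarrow> bool" where
  "local_proper_map r s r' s' U F \<longleftrightarrow>
     proj_open_cone U \<and> connected U \<and> (\<exists>z\<in>U. null_pt r s z) \<and> holo_proj_map U F
   \<and> (\<forall>z\<in>U. positive_pt r s z \<longrightarrow> positive_pt r' s' (F z))
   \<and> (\<forall>z\<in>U. null_pt r s z \<longrightarrow> null_pt r' s' (F z))"

definition isometry_map ::
  "nat \<Rightarrow> nat \<Rightarrow> nat \<Rightarrow> nat \<Rightarrow> (complex^'n::{finite,linorder} \<Rightarrow> complex^'m::{finite,linorder}) \<Rightarrow> bool" where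
  "isometry_map r s r' s' L \<longleftrightarrow> clinear_map L \<and> (\<forall>u v. hform r' s' (L u) (L v) = hform r s u v)"

definition standard_map ::
  "nat \<Rightarrow> nat \<Rightarrow> nat \<Rightarrow> nat \<Rightarrow> (complex^'n::{finite,linorder}) set
     \<Rightarrow> (complex^'n::{finite,linorder} \<Rightarrow> complex^'m::{finite,linorder}) \<Rightarrow> bool" where
  "standard_map r s r' s' U F \<longleftrightarrow>
     (\<exists>L. isometry_map r s r' s' L \<and> (\<forall>z\<in>U. L z \<noteq> 0 \<and> (\<exists>c. c \<noteq> 0 \<and> F z = c *s L z)))"

definition null_space :: "nat \<Rightarrow> nat \<Rightarrow> (complex^'m::{finite,linorder}) set \<Rightarrow> bool" where
  "null_space r s H \<longleftrightarrow> csubspace H \<and> (\<forall>a\<in>H. \<forall>b\<in>H. hform r s a b = 0)"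

definition null_map :: "nat \<Rightarrow> nat \<Rightarrow> (complex^'n::{finite,linorder}) set \<Rightarrow> (complex^'n::{finite,linorder} \<Rightarrow> complex^'m::{finite,linorder}) \<Rightarrow> bool" where
  "null_map r' s' U F \<longleftrightarrow> (\<exists>H. null_space r' s' H \<and> (\<forall>z\<in>U. F z \<in> H))"

definition proj_along :: "(complex^'m::{finite,linorder}) set \<Rightarrow> (complex^'m::{finite,linorder}) set \<Rightarrow> complex^'m::{finite,linorder} \<Rightarrow> complex^'m::{finite,linorder}" where
  "proj_along A B x = (THE a. a \<in> A \<and> (\<exists>b\<in>B. x = a + b))"

definition quasi_standard ::
  "nat \<Rightarrow> nat \<Rightarrow> nat \<Rightarrow> nat \<Rightarrow> (complex^'n::{finite,linorder}) set
     \<Rightarrow> (complex^'n::{finite,linorder} \<Rightarrow> complex^'m::{finite,linorder}) \<Rightarrow> bool" where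
  "quasi_standard r s r' s' U F \<longleftrightarrow>
     standard_map r s r' s' U F \<or>
     (\<exists>A B. csubspace A \<and> csubspace B \<and> A \<noteq> {0} \<and> B \<noteq> {0}
        \<and> (\<forall>x. \<exists>a\<in>A. \<exists>b\<in>B. x = a + b) \<and> A \<inter> B = {0}
        \<and> (\<forall>a\<in>A. \<forall>b\<in>B. hform r' s' a b = 0)
        \<comment> \<open>pi_A o f is standard: induced by a linear isometry into A (restricted form),
            on the set where pi_A o f is defined\<close>
        \<and> (\<exists>L. isometry_map r s r' s' L \<and> range L \<subseteq> A
               \<and> (\<exists>z\<in>U. proj_along A B (F z) \<noteq> 0)
               \<and> (\<forall>z\<in>U. proj_along A B (F z) \<noteq> 0 \<longrightarrow>
                    L z \<noteq> 0 \<and> (\<exists>c. c \<noteq> 0 \<and> proj_along A B (F z) = c *s L z)))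
        \<comment> \<open>pi_B o f is null: its image lies in a null subspace of B\<close>
        \<and> (\<exists>H. null_space r' s' H \<and> H \<subseteq> B \<and> (\<forall>z\<in>U. proj_along B A (F z) \<in> H)))"

end

theory Submission
  imports Defs "HOL-Complex_Analysis.Conformal_Mappings"
begin

text \<open>A local holomorphic lift \<open>G\<close> of the map sends null points to null points, and polarization turns
  this into preservation of orthogonality. Hence \<open>\<langle>G z, G w\<rangle> = h(z, w) \<langle>z, w\<rangle>\<close>, and the theorem
  says that \<open>h\<close> has rank one. Since the target has only \<open>r\<close> positive squares, Hopf's lemma gives a
  null point \<open>b\<close> with \<open>h(b, b) > 0\<close>. At a null point \<open>p\<close> near \<open>b\<close> the vector \<open>G(p)\<close> and the derivatives
  of \<open>G\<close> along \<open>p\<^sup>\<bottom>\<close> use up all positive directions, so the remainder of \<open>G\<close> on \<open>p\<^sup>\<bottom>\<close>, which is null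
  at null points, takes values in a negative semidefinite space; Cauchy-Schwarz and the identity
  theorem (here \<open>r, s \<ge> 2\<close> make the null cone of \<open>p\<^sup>\<bottom>\<close> large) force
  \<open>h(z, w) h(p, p) = h(z, p) h(p, w)\<close> for \<open>z, w \<in> p\<^sup>\<bottom>\<close>. Polarizing in \<open>p\<close> along a null plane yields rank one
  on an open set. There a multiple of \<open>G\<close> preserves the form, so it is a linear isometry plus a map
  into a null space orthogonal to it, and the identity theorem extends this to \<open>U\<close>.\<close>

section \<open>Hermitian linear algebra\<close>

text \<open>Nothing controls the images of negative points, so the sign of \<open>h\<close> on the
  null cone is not given in advance and has to be produced at one point. The sign matters because
  the complement of a null \<open>p\<close> outside the radical has \<open>r - 1\<close> positive
  directions: a positive \<open>h\<close> keeps them positive in the target, and the null vector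
  \<open>G p\<close>, paired nontrivially with \<open>cderiv G p v\<close>, accounts for the last
  one. The quotient \<open>h(z, w)\<close> has no direct meaning where \<open>z\<close> and
  \<open>w\<close> are orthogonal, which is exactly where it is needed; there it is read off from a
  first derivative of \<open>G\<close>. All polarizations share one device: the second slot of the
  form carries the conjugate parameter, so an identity known at real parameters continues to
  \<open>\<i>\<close>, where the two slots separate into \<open>\<i>\<close> and
  \<open>- \<i>\<close>. The rank one factor comes from choices that are not holomorphic in the
  point, so the form-preserving multiple of \<open>G\<close> is not known to be holomorphic. The
  global step therefore continues only conditions on \<open>F\<close> that are linear in
  \<open>F z\<close> and insensitive to its scale.\<close>

lemma idx_strict_mono: "i < j \<Longrightarrow> idx i < idx (j::'n::{finite,linorder})"
  unfolding idx_def by (rule psubset_card_mono) auto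

lemma inj_idx: "inj (idx :: 'n::{finite,linorder} \<Rightarrow> nat)"
  by (rule injI) (metis idx_strict_mono linorder_neqE less_irrefl)

lemma idx_image: "range (idx :: 'n::{finite,linorder} \<Rightarrow> nat) = {..<CARD('n)}"
proof (rule card_subset_eq)
  have "{j. j < i} \<subset> UNIV" for i :: 'n by auto
  then show "range (idx :: 'n \<Rightarrow> nat) \<subseteq> {..<CARD('n)}"
    unfolding idx_def by (auto intro!: psubset_card_mono)
qed (auto simp: card_image inj_idx)

lemma card_idx_range:
  assumes "b \<le> CARD('n::{finite,linorder})"
  shows "card {i::'n. a \<le> idx i \<and> idx i < b} = b - a"
proof -
  have "idx ` {i::'n. a \<le> idx i \<and> idx i < b} = {a..<b}"
  proof
    show "{a..<b} \<subseteq> idx ` {i::'n. a \<le> idx i \<and> idx i < b}"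
    proof
      fix k assume k: "k \<in> {a..<b}"
      with assms have "k \<in> range (idx :: 'n \<Rightarrow> nat)" unfolding idx_image by auto
      then show "k \<in> idx ` {i::'n. a \<le> idx i \<and> idx i < b}" using k by auto
    qed
  qed auto
  moreover have "card (idx ` {i::'n. a \<le> idx i \<and> idx i < b}) = card {i::'n. a \<le> idx i \<and> idx i < b}"
    by (rule card_image) (metis inj_idx inj_on_subset subset_UNIV)
  ultimately show ?thesis by simp
qed

lemma card_idx_less_le: "card {i::'n::{finite,linorder}. idx i < r} \<le> r"
proof -
  have "card {i::'n. idx i < r} = card (idx ` {i::'n. idx i < r})"
    by (rule card_image[symmetric]) (metis inj_idx inj_on_subset subset_UNIV)
  also have "\<dots> \<le> card {..<r}" by (rule card_mono) auto
  finally show ?thesis by simp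
qed

definition sgnc :: "nat \<Rightarrow> nat \<Rightarrow> 'n::{finite,linorder} \<Rightarrow> complex" where
  "sgnc r s i = (if idx i < r then 1 else if idx i < r + s then -1 else 0)"

lemma hform_sgnc:
  fixes z w :: "complex^'n::{finite,linorder}"
  shows "hform r s z w = (\<Sum>i\<in>UNIV. sgnc r s i * z$i * cnj (w$i))"
proof -
  have "(\<Sum>i\<in>UNIV. sgnc r s i * z$i * cnj (w$i))
     = (\<Sum>i\<in>UNIV. (if idx i < r then z$i * cnj (w$i) else 0)
        - (if r \<le> idx i \<and> idx i < r + s then z$i * cnj (w$i) else 0))"
    by (rule sum.cong) (auto simp: sgnc_def)
  then show ?thesis unfolding hform_def
    by (simp add: sum_subtractf sum.If_cases)
qed

lemma hform_add_left: "hform r s (x + y) z = hform r s x z + hform r s y z"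
  by (simp add: hform_sgnc sum.distrib algebra_simps)
lemma hform_add_right: "hform r s z (x + y) = hform r s z x + hform r s z y"
  by (simp add: hform_sgnc sum.distrib algebra_simps)
lemma hform_diff_left: "hform r s (x - y) z = hform r s x z - hform r s y z"
  by (simp add: hform_sgnc sum_subtractf algebra_simps)
lemma hform_diff_right: "hform r s z (x - y) = hform r s z x - hform r s z y"
  by (simp add: hform_sgnc sum_subtractf algebra_simps)
lemma hform_scale_left: "hform r s (c *s x) z = c * hform r s x z"
  by (simp add: hform_sgnc sum_distrib_left mult_ac)
lemma hform_scale_right: "hform r s z (c *s x) = cnj c * hform r s z x"
  by (simp add: hform_sgnc sum_distrib_left mult_ac)
lemma hform_zero_left [simp]: "hform r s 0 z = 0"
  by (simp add: hform_sgnc)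
lemma hform_zero_right [simp]: "hform r s z 0 = 0"
  by (simp add: hform_sgnc)
lemma cnj_sgnc [simp]: "cnj (sgnc r s i) = sgnc r s i"
  by (simp add: sgnc_def)
lemma hform_cnj: "cnj (hform r s z w) = hform r s w z"
  by (simp add: hform_sgnc mult_ac)

lemmas hform_linear = hform_add_left hform_add_right hform_diff_left hform_diff_right
  hform_scale_left hform_scale_right

lemma hform_sum_left: "hform r s (\<Sum>i\<in>I. x i) z = (\<Sum>i\<in>I. hform r s (x i) z)"
  by (induction I rule: infinite_finite_induct) (auto simp: hform_add_left)
lemma hform_sum_right: "hform r s z (\<Sum>i\<in>I. x i) = (\<Sum>i\<in>I. hform r s z (x i))"
  by (induction I rule: infinite_finite_induct) (auto simp: hform_add_right)

lemma hform_swap_zero: "hform r s z w = 0 \<longleftrightarrow> hform r s w z = 0"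
  by (metis complex_cnj_zero_iff hform_cnj)

lemma Im_hform_self [simp]: "Im (hform r s z z) = 0"
  using arg_cong[OF hform_cnj[of r s z z], of Im] by simp

lemma hform_self_eq_0_iff: "hform r s z z = 0 \<longleftrightarrow> Re (hform r s z z) = 0"
  by (simp add: complex_eq_iff)

lemma norm_hform_le: "norm (hform r s z w) \<le> norm z * norm w"
proof -
  have "norm (hform r s z w) \<le> (\<Sum>i\<in>UNIV. norm (sgnc r s i * z$i * cnj (w$i)))"
    unfolding hform_sgnc by (rule norm_sum)
  also have "\<dots> \<le> (\<Sum>i\<in>UNIV. \<bar>norm (z$i)\<bar> * \<bar>norm (w$i)\<bar>)"
    by (rule sum_mono) (auto simp: sgnc_def norm_mult)
  also have "\<dots> \<le> L2_set (\<lambda>i. norm (z$i)) UNIV * L2_set (\<lambda>i. norm (w$i)) UNIV"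
    by (rule L2_set_mult_ineq)
  finally show ?thesis by (simp add: norm_vec_def)
qed

lemma norm_smult: "norm (c *s (z::complex^'n::{finite,linorder})) = norm c * norm z"
  by (simp add: norm_vec_def vector_scalar_mult_def L2_set_def norm_mult power_mult_distrib
      sum_distrib_left [symmetric] real_sqrt_mult)

section \<open>Linear systems and the number of positive directions\<close>

lemma homogeneous_solution:
  fixes A :: "'i \<Rightarrow> 'j \<Rightarrow> complex"
  assumes "finite I" "finite J" "card I < card J"
  shows "\<exists>c. (\<exists>j\<in>J. c j \<noteq> 0) \<and> (\<forall>i\<in>I. (\<Sum>j\<in>J. A i j * c j) = 0)"
  using assms
proof (induction I arbitrary: J A rule: finite_induct)
  case empty
  then obtain j where "j \<in> J" by fastforce
  then show ?case by (intro exI[of _ "\<lambda>_. 1"]) auto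
next
  case (insert i0 I)
  show ?case
  proof (cases "\<forall>j\<in>J. A i0 j = 0")
    case True
    have "card I < card J" using insert by simp
    from insert.IH[OF insert.prems(1) this, of A] True show ?thesis by auto
  next
    case False
    then obtain j0 where j0: "j0 \<in> J" "A i0 j0 \<noteq> 0" by auto
    define J' where "J' = J - {j0}"
    have J': "finite J'" "card I < card J'" "J = insert j0 J'" "j0 \<notin> J'"
      using insert j0 by (auto simp: J'_def)
    \<comment> \<open>Row elimination with pivot \<open>A i0 j0\<close>: column \<open>j0\<close>
      disappears from the other rows, and \<open>c'\<close> below recovers the unknown
      \<open>j0\<close> from row \<open>i0\<close>.\<close>
    define A' where "A' i j = A i j - A i j0 * A i0 j / A i0 j0" for i j
    from insert.IH[OF J'(1,2), of A'] obtain c where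
      c: "\<exists>j\<in>J'. c j \<noteq> 0" "\<And>i. i \<in> I \<Longrightarrow> (\<Sum>j\<in>J'. A' i j * c j) = 0" by auto
    define S where "S i = (\<Sum>j\<in>J'. A i j * c j)" for i
    define c' where "c' j = (if j = j0 then - S i0 / A i0 j0 else c j)" for j
    have sum': "(\<Sum>j\<in>J. A i j * c' j) = A i j0 * c' j0 + S i" for i
    proof -
      have "(\<Sum>j\<in>J'. A i j * c' j) = S i" unfolding S_def
        by (rule sum.cong) (use J' in \<open>auto simp: c'_def\<close>)
      then show ?thesis using J' by simp
    qed
    have "(\<Sum>j\<in>J. A i j * c' j) = 0" if "i \<in> insert i0 I" for i
    proof (cases "i = i0")
      case True
      then show ?thesis using j0 unfolding sum' by (simp add: c'_def)
    next
      case False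
      then have "(\<Sum>j\<in>J'. A' i j * c j) = 0" using c that by auto
      then have "S i - A i j0 / A i0 j0 * S i0 = 0"
        by (simp add: A'_def S_def algebra_simps sum_subtractf sum_distrib_left)
      then show ?thesis unfolding sum' by (simp add: c'_def algebra_simps)
    qed
    moreover have "\<exists>j\<in>J. c' j \<noteq> 0" using c(1) J'(3,4) by (auto simp: c'_def)
    ultimately show ?thesis by (intro exI[of _ c']) auto
  qed
qed

lemma hform_pos_part:
  fixes z w :: "complex^'n::{finite,linorder}"
  assumes "\<And>i. \<not> idx i < r \<Longrightarrow> z$i = 0"
  shows "hform r s z w = (\<Sum>i\<in>{i. idx i < r}. z$i * cnj (w$i))"
proof -
  have "(\<Sum>i\<in>{i. r \<le> idx i \<and> idx i < r + s}. z$i * cnj (w$i)) = 0"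
    by (rule sum.neutral) (use assms in auto)
  then show ?thesis by (simp add: hform_def)
qed

lemma hform_neg_part:
  fixes z w :: "complex^'n::{finite,linorder}"
  assumes "\<And>i. idx i < r \<Longrightarrow> z$i = 0"
  shows "hform r s z w = - (\<Sum>i\<in>{i. r \<le> idx i \<and> idx i < r + s}. z$i * cnj (w$i))"
proof -
  have "(\<Sum>i\<in>{i. idx i < r}. z$i * cnj (w$i)) = 0"
    by (rule sum.neutral) (use assms in auto)
  then show ?thesis by (simp add: hform_def)
qed

lemma Re_hform_neg_part:
  fixes z :: "complex^'n::{finite,linorder}"
  assumes "\<And>i. idx i < r \<Longrightarrow> z$i = 0"
  shows "Re (hform r s z z) = - (\<Sum>i\<in>{i. r \<le> idx i \<and> idx i < r + s}. (norm (z$i))\<^sup>2)"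
proof -
  have "hform r s z z = - (\<Sum>i\<in>{i. r \<le> idx i \<and> idx i < r + s}. z$i * cnj (z$i))"
    by (rule hform_neg_part) (use assms in auto)
  also have "\<dots> = - (\<Sum>i\<in>{i. r \<le> idx i \<and> idx i < r + s}. of_real ((norm (z$i))\<^sup>2))"
    by (simp only: complex_norm_square)
  finally show ?thesis by simp
qed

text \<open>Without positive coordinates the square of \<open>z\<close> is minus a sum of squares.
  If it is nonnegative, all coordinates that the form sees must vanish.\<close>

lemma radical_of_nonneg:
  fixes z :: "complex^'n::{finite,linorder}"
  assumes "\<And>i. idx i < r \<Longrightarrow> z$i = 0" "0 \<le> Re (hform r s z z)"
  shows "hform r s z z = 0" "\<And>i. idx i < r + s \<Longrightarrow> z$i = 0" "\<And>y. hform r s z y = 0"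
proof -
  have le: "0 \<le> (\<Sum>i\<in>{i. r \<le> idx i \<and> idx i < r + s}. (norm (z$i))\<^sup>2)"
    by (rule sum_nonneg) auto
  with assms(2) Re_hform_neg_part[of r z s] assms(1)
  have 0: "(\<Sum>i\<in>{i. r \<le> idx i \<and> idx i < r + s}. (norm (z$i))\<^sup>2) = 0" by simp
  then have "\<forall>i\<in>{i. r \<le> idx i \<and> idx i < r + s}. (norm (z$i))\<^sup>2 = 0"
    by (subst (asm) sum_nonneg_eq_0_iff) auto
  then show z: "z$i = 0" if "idx i < r + s" for i using that assms(1)[of i] by (cases "idx i < r") auto
  have rad: "hform r s z y = 0" for y
    unfolding hform_sgnc by (rule sum.neutral) (use z in \<open>auto simp: sgnc_def\<close>)
  show "hform r s z z = 0" by (rule rad)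
  show "hform r s z y = 0" for y by (rule rad)
qed

lemma orthogonal_nonneg_family:
  fixes f :: "nat \<Rightarrow> complex^'m::{finite,linorder}"
  assumes orth: "\<And>i j. i \<le> r \<Longrightarrow> j \<le> r \<Longrightarrow> i \<noteq> j \<Longrightarrow> hform r s (f i) (f j) = 0"
    and nonneg: "\<And>j. j \<le> r \<Longrightarrow> 0 \<le> Re (hform r s (f j) (f j))"
  shows "\<exists>c. (\<exists>j\<le>r. c j \<noteq> 0) \<and> (\<forall>j\<le>r. c j \<noteq> 0 \<longrightarrow> hform r s (f j) (f j) = 0)
    \<and> (\<forall>y. hform r s (\<Sum>j\<le>r. c j *s f j) y = 0)
    \<and> (\<forall>i. idx i < r + s \<longrightarrow> (\<Sum>j\<le>r. c j *s f j) $ i = 0)"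
proof -
  \<comment> \<open>There are \<open>r + 1\<close> unknown coefficients and at most \<open>r\<close>
    positive coordinates to cancel.\<close>
  have "card {i::'m. idx i < r} < card {..r}" using card_idx_less_le[of r] by (simp add: less_Suc_eq_le)
  from homogeneous_solution[OF _ _ this, of "\<lambda>i j. f j $ i"]
  obtain c where c: "\<exists>j\<le>r. c j \<noteq> 0" "\<And>i::'m. idx i < r \<Longrightarrow> (\<Sum>j\<le>r. f j $ i * c j) = 0"
    by auto
  define x where "x = (\<Sum>j\<le>r. c j *s f j)"
  have x0: "x $ i = 0" if "idx i < r" for i
    using c(2)[OF that] by (simp add: x_def mult.commute)
  have "hform r s x x = (\<Sum>i\<le>r. \<Sum>j\<le>r. c i * (cnj (c j) * hform r s (f i) (f j)))"
  proof -
    have "hform r s (f i) x = (\<Sum>j\<le>r. cnj (c j) * hform r s (f i) (f j))" for i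
      by (simp add: x_def hform_sum_right hform_scale_right)
    moreover have "hform r s x x = (\<Sum>i\<le>r. c i * hform r s (f i) x)"
      by (subst x_def) (simp add: hform_sum_left hform_scale_left)
    ultimately show ?thesis by (simp add: sum_distrib_left)
  qed
  also have "\<dots> = (\<Sum>i\<le>r. \<Sum>j\<le>r. if i = j then c i * (cnj (c j) * hform r s (f i) (f j)) else 0)"
    by (intro sum.cong) (auto simp: orth)
  also have "\<dots> = (\<Sum>i\<le>r. c i * cnj (c i) * hform r s (f i) (f i))"
    by (simp add: mult.assoc)
  also have "\<dots> = (\<Sum>i\<le>r. of_real ((norm (c i))\<^sup>2) * hform r s (f i) (f i))"
    by (simp only: complex_norm_square)
  finally have eq: "Re (hform r s x x) = (\<Sum>i\<le>r. (norm (c i))\<^sup>2 * Re (hform r s (f i) (f i)))"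
    by simp
  have "0 \<le> Re (hform r s x x)" unfolding eq using nonneg by (intro sum_nonneg) auto
  note rad = radical_of_nonneg[of r x, OF x0 this]
  have "(norm (c j))\<^sup>2 * Re (hform r s (f j) (f j)) = 0" if "j \<le> r" for j
  proof -
    have "(\<Sum>i\<le>r. (norm (c i))\<^sup>2 * Re (hform r s (f i) (f i))) = 0"
      using eq rad(1) by simp
    then show ?thesis using that nonneg by (subst (asm) sum_nonneg_eq_0_iff) auto
  qed
  then have "hform r s (f j) (f j) = 0" if "j \<le> r" "c j \<noteq> 0" for j
    using that by (auto simp: hform_self_eq_0_iff)
  with c(1) rad show ?thesis unfolding x_def by blast
qed

text \<open>If \<open>y\<close> had nonnegative square, it would be the extra vector in
  \<open>orthogonal_nonneg_family\<close>. The positive \<open>e j\<close> cannot carry coefficients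
  there, so a nonzero multiple of \<open>y\<close> alone lies in the radical.\<close>

lemma orthogonal_complement_nonpos:
  fixes e :: "nat \<Rightarrow> complex^'m::{finite,linorder}"
  assumes orth: "\<And>i j. i < r \<Longrightarrow> j < r \<Longrightarrow> i \<noteq> j \<Longrightarrow> hform r s (e i) (e j) = 0"
    and pos: "\<And>j. j < r \<Longrightarrow> 0 < Re (hform r s (e j) (e j))"
    and y: "\<And>j. j < r \<Longrightarrow> hform r s y (e j) = 0"
  shows "Re (hform r s y y) \<le> 0"
    and "Re (hform r s y y) = 0 \<Longrightarrow> idx i < r + s \<Longrightarrow> y $ i = 0"
proof -
  have main: "Re (hform r s y y) = 0 \<and> (\<forall>i. idx i < r + s \<longrightarrow> y $ i = 0)" if nn: "0 \<le> Re (hform r s y y)"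
  proof -
    define f where "f j = (if j < r then e j else y)" for j
    have f1: "hform r s (f i) (f j) = 0" if "i \<le> r" "j \<le> r" "i \<noteq> j" for i j
      using that orth y hform_swap_zero[of r s y] by (auto simp: f_def)
    have f2: "0 \<le> Re (hform r s (f j) (f j))" if "j \<le> r" for j
      using that nn pos[of j] by (auto simp: f_def)
    have "\<exists>c. (\<exists>j\<le>r. c j \<noteq> 0) \<and> (\<forall>j\<le>r. c j \<noteq> 0 \<longrightarrow> hform r s (f j) (f j) = 0)
        \<and> (\<forall>y. hform r s (\<Sum>j\<le>r. c j *s f j) y = 0)
        \<and> (\<forall>i. idx i < r + s \<longrightarrow> (\<Sum>j\<le>r. c j *s f j) $ i = 0)"
      by (rule orthogonal_nonneg_family[of r s f, OF f1 f2])
    then obtain c where c: "\<exists>j\<le>r. c j \<noteq> 0"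
      "\<And>j. j \<le> r \<Longrightarrow> c j \<noteq> 0 \<Longrightarrow> hform r s (f j) (f j) = 0"
      "\<And>i. idx i < r + s \<Longrightarrow> (\<Sum>j\<le>r. c j *s f j) $ i = 0"
      by blast
    have c0: "c j = 0" if "j < r" for j
    proof (rule ccontr)
      assume "c j \<noteq> 0"
      with c(2)[of j] that have "hform r s (e j) (e j) = 0" by (simp add: f_def)
      with pos[OF that] show False by simp
    qed
    with c(1) have cr: "c r \<noteq> 0" using le_neq_implies_less by blast
    have "(\<Sum>j\<le>r. c j *s f j) = c r *s y"
      by (simp add: lessThan_Suc_atMost[symmetric] c0 f_def)
    then have "y $ i = 0" if "idx i < r + s" for i
      using c(3)[OF that] cr by simp
    moreover have "hform r s y y = 0" using c(2)[of r] cr by (simp add: f_def)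
    ultimately show ?thesis by simp
  qed
  show "Re (hform r s y y) \<le> 0" using main by (cases "0 \<le> Re (hform r s y y)") auto
  show "y $ i = 0" if "Re (hform r s y y) = 0" "idx i < r + s"
    using main that by auto
qed

section \<open>Vectors with prescribed orthogonality, and null duals\<close>

lemma ex_unit_orthogonal:
  fixes Y :: "(complex^'n::{finite,linorder}) set" and J :: "'n set"
  assumes "finite Y" "card Y < card J"
  obtains x :: "complex^'n::{finite,linorder}" where "\<And>i. i \<notin> J \<Longrightarrow> x$i = 0" "(\<Sum>i\<in>J. x$i * cnj (x$i)) = 1"
    "\<And>y. y \<in> Y \<Longrightarrow> (\<Sum>i\<in>J. x$i * cnj (y$i)) = 0"
proof -
  from homogeneous_solution[OF assms(1) _ assms(2), of "\<lambda>(y :: complex^'n::{finite,linorder}) i. cnj (y $ i)"]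
  obtain c where c: "\<exists>j\<in>J. c j \<noteq> 0" "\<And>y. y \<in> Y \<Longrightarrow> (\<Sum>j\<in>J. cnj (y $ j) * c j) = 0"
    by auto
  define N where "N = (\<Sum>i\<in>J. (norm (c i))\<^sup>2)"
  have "N \<noteq> 0" using c(1) unfolding N_def by (subst sum_nonneg_eq_0_iff) auto
  moreover have "0 \<le> N" unfolding N_def by (rule sum_nonneg) auto
  ultimately have N: "0 < N" by simp
  define x :: "complex^'n::{finite,linorder}" where "x = (\<chi> i. if i \<in> J then c i / sqrt N else 0)"
  show ?thesis
  proof
    show "x $ i = 0" if "i \<notin> J" for i using that by (simp add: x_def)
    have sq: "complex_of_real (sqrt N) * complex_of_real (sqrt N) = of_real N"
      using N by (simp flip: of_real_mult)
    have "(\<Sum>i\<in>J. x$i * cnj (x$i)) = (\<Sum>i\<in>J. of_real ((norm (c i))\<^sup>2) / of_real N)"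
      by (rule sum.cong) (auto simp: x_def complex_norm_square sq simp del: of_real_power)
    also have "\<dots> = of_real (N / N)" unfolding N_def by (simp only: sum_divide_distrib of_real_sum of_real_divide)
    also have "\<dots> = 1" using N by simp
    finally show "(\<Sum>i\<in>J. x$i * cnj (x$i)) = 1" .
    show "(\<Sum>i\<in>J. x$i * cnj (y$i)) = 0" if "y \<in> Y" for y
    proof -
      have "(\<Sum>i\<in>J. x$i * cnj (y$i)) = (\<Sum>i\<in>J. cnj (y $ i) * c i) / sqrt N"
        unfolding sum_divide_distrib by (rule sum.cong) (auto simp: x_def)
      then show ?thesis using c(2)[OF that] by simp
    qed
  qed
qed

lemma ex_pos_orthogonal:
  fixes Y :: "(complex^'n::{finite,linorder}) set"
  assumes "finite Y" "card Y < r" "r \<le> CARD('n)"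
  obtains x :: "complex^'n::{finite,linorder}" where "\<And>i. \<not> idx i < r \<Longrightarrow> x$i = 0" "hform r s x x = 1"
    "\<And>y. y \<in> Y \<Longrightarrow> hform r s x y = 0"
proof -
  have "card Y < card {i::'n. idx i < r}" using card_idx_range[where 'n='n, of r 0] assms by simp
  from ex_unit_orthogonal[OF assms(1) this] obtain x :: "complex^'n::{finite,linorder}" where
    x: "\<And>i. \<not> idx i < r \<Longrightarrow> x$i = 0" "(\<Sum>i\<in>{i. idx i < r}. x$i * cnj (x$i)) = 1"
    "\<And>y. y \<in> Y \<Longrightarrow> (\<Sum>i\<in>{i. idx i < r}. x$i * cnj (y$i)) = 0" by auto
  show ?thesis by (rule that[of x]) (use x hform_pos_part[of r x s] in auto)
qed

lemma ex_neg_orthogonal: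
  fixes Y :: "(complex^'n::{finite,linorder}) set"
  assumes "finite Y" "card Y < s" "r + s \<le> CARD('n)"
  obtains x :: "complex^'n::{finite,linorder}" where "\<And>i. \<not> (r \<le> idx i \<and> idx i < r + s) \<Longrightarrow> x$i = 0"
    "hform r s x x = - 1" "\<And>y. y \<in> Y \<Longrightarrow> hform r s x y = 0"
proof -
  have "card Y < card {i::'n. r \<le> idx i \<and> idx i < r + s}" using card_idx_range[where 'n='n, of "r+s" r] assms by simp
  from ex_unit_orthogonal[OF assms(1) this] obtain x :: "complex^'n::{finite,linorder}" where
    x: "\<And>i. i \<notin> {i. r \<le> idx i \<and> idx i < r + s} \<Longrightarrow> x$i = 0"
    "(\<Sum>i\<in>{i. r \<le> idx i \<and> idx i < r + s}. x$i * cnj (x$i)) = 1"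
    "\<And>y. y \<in> Y \<Longrightarrow> (\<Sum>i\<in>{i. r \<le> idx i \<and> idx i < r + s}. x$i * cnj (y$i)) = 0" by blast
  show ?thesis by (rule that[of x]) (use x hform_neg_part[of r x s] in auto)
qed

text \<open>A new vector has to be orthogonal to \<open>p\<close> and to the earlier ones, which
  stays below \<open>r\<close> conditions as long as \<open>k < r\<close>. In the applications
  \<open>k = r - 1\<close>.\<close>

lemma ex_pos_orthonormal_family:
  fixes p :: "complex^'n::{finite,linorder}"
  assumes "k < r" "r \<le> CARD('n)"
  shows "\<exists>x::nat \<Rightarrow> complex^'n::{finite,linorder}. (\<forall>j<k. (\<forall>i. \<not> idx i < r \<longrightarrow> x j $ i = 0) \<and> hform r s (x j) (x j) = 1 \<and> hform r s (x j) p = 0)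
     \<and> (\<forall>i<k. \<forall>j<k. i \<noteq> j \<longrightarrow> hform r s (x i) (x j) = 0)"
  using assms(1)
proof (induction k)
  case 0
  then show ?case by simp
next
  case (Suc k)
  from Suc.IH[OF Suc_lessD[OF Suc.prems]] obtain x :: "nat \<Rightarrow> complex^'n::{finite,linorder}" where
    x: "\<And>j. j < k \<Longrightarrow> (\<forall>i. \<not> idx i < r \<longrightarrow> x j $ i = 0) \<and> hform r s (x j) (x j) = 1 \<and> hform r s (x j) p = 0"
      "\<And>i j. i < k \<Longrightarrow> j < k \<Longrightarrow> i \<noteq> j \<Longrightarrow> hform r s (x i) (x j) = 0"
    by blast
  have "card (insert p (x ` {..<k})) \<le> Suc (card (x ` {..<k}))" by (rule card_insert_le_m1) auto
  also have "\<dots> \<le> Suc k" using card_image_le[of "{..<k}" x] by simp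
  also have "\<dots> < r" using Suc by simp
  finally obtain y :: "complex^'n::{finite,linorder}" where
    y: "\<And>i. \<not> idx i < r \<Longrightarrow> y $ i = 0" "hform r s y y = 1"
      "\<And>w. w \<in> insert p (x ` {..<k}) \<Longrightarrow> hform r s y w = 0"
    using ex_pos_orthogonal[of "insert p (x ` {..<k})" r s] assms(2) by auto
  have xy: "hform r s (x j) y = 0" if "j < k" for j
    using y(3)[of "x j"] that hform_swap_zero[of r s y] by auto
  show ?case
    by (rule exI[of _ "x(k := y)"]) (use x y xy in \<open>auto simp: less_Suc_eq\<close>)
qed

text \<open>Reversing the signs of all but the positive coordinates of \<open>p\<close> makes its
  pairing with \<open>p\<close> a sum of squares, nonzero because \<open>p\<close> is outside the
  radical. Against a vector from a single sign block the reversal changes the pairing only by a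
  sign, which gives the last property.\<close>

lemma null_point_dual:
  fixes p :: "complex^'n::{finite,linorder}"
  assumes null: "hform r s p p = 0" and nonrad: "hform r s p y \<noteq> 0"
  obtains v where "hform r s v p = 1" "hform r s v v = 0"
    "\<And>x. (\<forall>i. \<not> idx i < r \<longrightarrow> x$i = 0) \<or> (\<forall>i. idx i < r \<longrightarrow> x$i = 0) \<Longrightarrow> hform r s x p = 0 \<Longrightarrow> hform r s x v = 0"
proof -
  define q' :: "complex^'n::{finite,linorder}" where "q' = (\<chi> i. if idx i < r then p $ i else - p $ i)"
  have hq: "hform r s q' x = (\<Sum>i\<in>UNIV. (if idx i < r + s then p$i * cnj (x$i) else 0))" for x
    unfolding hform_sgnc by (rule sum.cong) (auto simp: q'_def sgnc_def)
  have "hform r s q' p = (\<Sum>i\<in>UNIV. (if idx i < r + s then p$i * cnj (p$i) else 0))" by (rule hq)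
  also have "\<dots> = of_real (\<Sum>i\<in>UNIV. if idx i < r + s then (norm (p$i))\<^sup>2 else 0)"
    unfolding of_real_sum by (rule sum.cong) (auto simp: complex_norm_square simp del: of_real_power)
  finally have qp: "hform r s q' p = of_real (\<Sum>i\<in>UNIV. if idx i < r + s then (norm (p$i))\<^sup>2 else 0)"
    .
  define N where "N = (\<Sum>i\<in>UNIV. if idx i < r + s then (norm (p$i))\<^sup>2 else 0)"
  have "N \<noteq> 0"
  proof
    assume "N = 0"
    then have "\<forall>i\<in>UNIV. (if idx i < r + s then (norm (p$i))\<^sup>2 else 0) = 0"
      unfolding N_def by (subst (asm) sum_nonneg_eq_0_iff) auto
    then have "p $ i = 0" if "idx i < r + s" for i
      using that by (auto dest!: spec[of _ i])
    then have "hform r s p y = 0" unfolding hform_sgnc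
      by (intro sum.neutral) (auto simp: sgnc_def)
    with nonrad show False by simp
  qed
  define v where "v = (1 / of_real N) *s q'"
  have vp: "hform r s v p = 1" using qp \<open>N \<noteq> 0\<close> unfolding N_def[symmetric] by (simp add: v_def hform_scale_left)
  have qq: "hform r s q' q' = hform r s p p"
    unfolding hform_sgnc by (rule sum.cong) (auto simp: q'_def)
  have vv: "hform r s v v = 0" using qq null by (simp add: v_def hform_scale_left hform_scale_right)
  have "hform r s x q' = 0"
    if "(\<forall>i. \<not> idx i < r \<longrightarrow> x$i = 0) \<or> (\<forall>i. idx i < r \<longrightarrow> x$i = 0)" "hform r s x p = 0" for x
    using that(1)
  proof
    assume "\<forall>i. \<not> idx i < r \<longrightarrow> x$i = 0"
    then have "hform r s x q' = hform r s x p"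
      unfolding hform_sgnc by (intro sum.cong) (auto simp: q'_def)
    then show ?thesis using that by simp
  next
    assume "\<forall>i. idx i < r \<longrightarrow> x$i = 0"
    then have "hform r s x q' = - hform r s x p"
      unfolding hform_sgnc by (subst sum_negf[symmetric], intro sum.cong) (auto simp: q'_def)
    then show ?thesis using that by simp
  qed
  then show ?thesis using vp vv by (intro that[of v]) (auto simp: v_def hform_scale_right)
qed

section \<open>Holomorphic curves\<close>

definition vhol :: "complex set \<Rightarrow> (complex \<Rightarrow> complex^'n::{finite,linorder}) \<Rightarrow> bool" where
  "vhol S Z \<longleftrightarrow> (\<forall>i. (\<lambda>l. Z l $ i) holomorphic_on S)"

lemma vhol_const: "vhol S (\<lambda>l. c)"
  by (simp add: vhol_def)
lemma vhol_add: "vhol S X \<Longrightarrow> vhol S Y \<Longrightarrow> vhol S (\<lambda>l. X l + Y l)"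
  by (simp add: vhol_def holomorphic_on_add)
lemma vhol_diff: "vhol S X \<Longrightarrow> vhol S Y \<Longrightarrow> vhol S (\<lambda>l. X l - Y l)"
  by (simp add: vhol_def holomorphic_on_diff)
lemma vhol_scale: "f holomorphic_on S \<Longrightarrow> vhol S X \<Longrightarrow> vhol S (\<lambda>l. f l *s X l)"
  by (simp add: vhol_def holomorphic_on_mult)
lemma vhol_subset: "vhol S X \<Longrightarrow> T \<subseteq> S \<Longrightarrow> vhol T X"
  unfolding vhol_def by (blast intro: holomorphic_on_subset)

lemmas vhol_intros = vhol_const vhol_add vhol_diff vhol_scale

lemma holomorphic_cnj_cnj:
  assumes "f holomorphic_on S" "open S" "\<And>l. l \<in> S \<Longrightarrow> cnj l \<in> S"
  shows "(\<lambda>l. cnj (f (cnj l))) holomorphic_on S"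
proof -
  have "cnj ` S = S" using assms(3) by (force simp: image_iff intro: bexI[of _ "cnj _"])
  then show ?thesis using holomorphic_on_compose_cnj_cnj[of f S] assms by (simp add: o_def)
qed

lemma holomorphic_hform_left:
  assumes "vhol S Z"
  shows "(\<lambda>l. hform r s (Z l) u) holomorphic_on S"
  unfolding hform_sgnc by (intro holomorphic_intros) (use assms in \<open>auto simp: vhol_def\<close>)

lemma holomorphic_hform_right:
  assumes "vhol S Z" "open S" "\<And>l. l \<in> S \<Longrightarrow> cnj l \<in> S"
  shows "(\<lambda>l. hform r s u (Z (cnj l))) holomorphic_on S"
proof -
  have "(\<lambda>l. cnj (hform r s (Z (cnj l)) u)) holomorphic_on S"
    by (rule holomorphic_cnj_cnj[of "\<lambda>l. hform r s (Z l) u"]) (auto intro: holomorphic_hform_left assms)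
  then show ?thesis by (simp add: hform_cnj)
qed

text \<open>The second slot is conjugate linear, so conjugating its parameter restores holomorphy.
  At real \<open>l\<close> both slots see the same parameter; this is the polarization
  device.\<close>

lemma holomorphic_hform:
  assumes "vhol S Z" "vhol S W" "open S" "\<And>l. l \<in> S \<Longrightarrow> cnj l \<in> S"
  shows "(\<lambda>l. hform r s (Z l) (W (cnj l))) holomorphic_on S"
  unfolding hform_sgnc
proof (intro holomorphic_intros)
  fix i
  show "(\<lambda>l. Z l $ i) holomorphic_on S" using assms by (auto simp: vhol_def)
  show "(\<lambda>l. cnj (W (cnj l) $ i)) holomorphic_on S"
    by (rule holomorphic_cnj_cnj[of "\<lambda>l. W l $ i"]) (use assms in \<open>auto simp: vhol_def\<close>)
qed

lemma has_derivative_curve: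
  fixes Z :: "complex \<Rightarrow> complex^'n::{finite,linorder}"
  assumes "\<And>i. ((\<lambda>l. Z l $ i) has_field_derivative z' $ i) (at l)"
  shows "(Z has_derivative (\<lambda>h. h *s z')) (at l)"
  unfolding has_derivative_componentwise_within[of Z]
proof
  fix b :: "complex^'n::{finite,linorder}" assume "b \<in> Basis"
  then obtain i c where b: "b = axis i c" by (auto simp: Basis_vec_def)
  have "((\<lambda>l. Z l $ i) has_derivative (\<lambda>h. z' $ i * h)) (at l)"
    using assms[of i] by (simp add: has_field_derivative_def)
  then have "((\<lambda>l. (Z l $ i) \<bullet> c) has_derivative (\<lambda>h. (z' $ i * h) \<bullet> c)) (at l)"
    by (rule has_derivative_inner_left)
  then show "((\<lambda>x. Z x \<bullet> b) has_derivative (\<lambda>x. (x *s z') \<bullet> b)) (at l)"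
    by (simp add: b inner_axis mult.commute)
qed

lemma vhol_has_derivative:
  assumes "vhol S Z" "open S" "l \<in> S"
  shows "(Z has_derivative (\<lambda>h. h *s (\<chi> i. deriv (\<lambda>l. Z l $ i) l))) (at l)"
  by (rule has_derivative_curve) (use assms in \<open>auto simp: vhol_def intro: holomorphic_derivI\<close>)

lemma vhol_continuous_on: "vhol S Z \<Longrightarrow> open S \<Longrightarrow> continuous_on S Z"
  by (meson vhol_has_derivative continuous_at_imp_continuous_on has_derivative_continuous)

section \<open>Complex derivatives in a fixed direction\<close>

definition cderiv :: "(complex^'n::{finite,linorder} \<Rightarrow> complex^'m::{finite,linorder}) \<Rightarrow> complex^'n::{finite,linorder} \<Rightarrow> complex^'n::{finite,linorder} \<Rightarrow> complex^'m::{finite,linorder}" where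
  "cderiv G z = frechet_derivative G (at z)"

lemma holo_on_cderiv:
  assumes "holo_on W G" "z \<in> W"
  shows "(G has_derivative cderiv G z) (at z)" "cderiv G z (c *s v) = c *s cderiv G z v"
    "cderiv G z (u + v) = cderiv G z u + cderiv G z v"
proof -
  from assms obtain D where D: "(G has_derivative D) (at z)" "\<And>c v. D (c *s v) = c *s D v"
    unfolding holo_on_def by blast
  have eq: "cderiv G z = D" unfolding cderiv_def using frechet_derivative_at[OF D(1)] by simp
  show "(G has_derivative cderiv G z) (at z)" "cderiv G z (c *s v) = c *s cderiv G z v"
    using D eq by auto
  then show "cderiv G z (u + v) = cderiv G z u + cderiv G z v"
    by (metis D(1) eq has_derivative_linear linear_add)
qed

lemma cderiv_diff:
  assumes "holo_on W G" "z \<in> W"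
  shows "cderiv G z (u - v) = cderiv G z u - cderiv G z v"
  by (metis assms diff_add_cancel add_diff_cancel holo_on_cderiv(3))

lemma holo_on_continuous_on: "holo_on W G \<Longrightarrow> continuous_on W G"
  by (meson continuous_at_imp_continuous_on has_derivative_continuous holo_on_cderiv(1))

lemma has_field_derivative_comp:
  assumes "holo_on W G" "Z l \<in> W" and Z: "(Z has_derivative (\<lambda>h. h *s z')) (at l)"
  shows "((\<lambda>l. G (Z l) $ i) has_field_derivative cderiv G (Z l) z' $ i) (at l)"
proof -
  have "((\<lambda>l. G (Z l)) has_derivative (\<lambda>h. cderiv G (Z l) (h *s z'))) (at l)"
    by (rule has_derivative_compose[OF Z holo_on_cderiv(1)[OF assms(1,2)]])
  then have "((\<lambda>l. G (Z l)) has_derivative (\<lambda>h. h *s cderiv G (Z l) z')) (at l)"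
    by (simp add: holo_on_cderiv(2)[OF assms(1,2)])
  then have "((\<lambda>l. G (Z l) $ i) has_derivative (\<lambda>h. (h *s cderiv G (Z l) z') $ i)) (at l)"
    by (rule bounded_linear.has_derivative[OF bounded_linear_vec_nth])
  then show ?thesis by (simp add: has_field_derivative_def mult.commute[of _ "cderiv _ _ _ $ _"])
qed

lemma vhol_comp:
  assumes "holo_on W G" "vhol S Z" "open S" "\<And>l. l \<in> S \<Longrightarrow> Z l \<in> W"
  shows "vhol S (\<lambda>l. G (Z l))"
  unfolding vhol_def
proof
  fix i
  show "(\<lambda>l. G (Z l) $ i) holomorphic_on S"
    unfolding holomorphic_on_open[OF assms(3)]
    using has_field_derivative_comp[OF assms(1) _ vhol_has_derivative[OF assms(2,3)]] assms(4) by blast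
qed

lemma has_derivative_line:
  fixes a d :: "complex^'n::{finite,linorder}"
  shows "((\<lambda>l. a + l *s d) has_derivative (\<lambda>h. h *s d)) (at l)"
  by (rule has_derivative_curve) (auto intro!: derivative_eq_intros)

lemma vhol_line: "vhol S (\<lambda>l. a + l *s d)"
  by (intro vhol_intros holomorphic_intros)

lemma hform_line_derivative:
  assumes "holo_on W G" "a + l *s d \<in> W"
  shows "((\<lambda>l. hform r s (G (a + l *s d)) u) has_field_derivative hform r s (cderiv G (a + l *s d) d) u) (at l)"
  unfolding hform_sgnc
  by (intro derivative_eq_intros has_field_derivative_comp[OF assms has_derivative_line])
     (auto intro!: has_field_derivative_comp[OF assms has_derivative_line] simp: mult_ac)

lemma open_line_preimage:
  fixes W :: "(complex^'n::{finite,linorder}) set"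
  assumes "open W"
  shows "open {l. a + l *s d \<in> W}"
proof -
  have "continuous_on UNIV (\<lambda>l. a + l *s d)"
    by (rule vhol_continuous_on[OF vhol_line]) auto
  then have "open ((\<lambda>l. a + l *s d) -` W)" using assms by (metis open_vimage)
  then show ?thesis by (simp add: vimage_def)
qed

lemma convex_line_preimage:
  fixes W :: "(complex^'n::{finite,linorder}) set"
  assumes "convex W"
  shows "convex {l. a + l *s d \<in> W}"
proof (rule convexI, clarify)
  fix x y and u v :: real assume *: "a + x *s d \<in> W" "a + y *s d \<in> W" "0 \<le> u" "0 \<le> v" "u + v = 1"
  have "u *\<^sub>R (a + x *s d) + v *\<^sub>R (a + y *s d) \<in> W"
    using assms * by (meson convexD)
  moreover have "u *\<^sub>R (a + x *s d) + v *\<^sub>R (a + y *s d) = a + (u *\<^sub>R x + v *\<^sub>R y) *s d"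
  proof (rule vec_eq_iff[THEN iffD2], rule)
    fix i
    have "complex_of_real u + complex_of_real v = 1" using *(5) by (metis of_real_1 of_real_add)
    then have "a $ i = (of_real u + of_real v) * a $ i" by simp
    then show "(u *\<^sub>R (a + x *s d) + v *\<^sub>R (a + y *s d)) $ i = (a + (u *\<^sub>R x + v *\<^sub>R y) *s d) $ i"
      by (simp add: scaleR_conv_of_real[where 'a=complex] algebra_simps)
  qed
  ultimately show "a + (u *\<^sub>R x + v *\<^sub>R y) *s d \<in> W" by simp
qed

lemma difference_quotient_bound:
  assumes g: "g holomorphic_on ball 0 R" and R: "0 < R" and B: "\<And>x. x \<in> ball 0 R \<Longrightarrow> cmod (g x) \<le> B"
    and t: "0 < t" "t < R / 2"
  shows "cmod ((g (of_real t) - g 0) / of_real t - deriv g 0) \<le> (32 * B / R\<^sup>2) * t"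
proof -
  \<comment> \<open>Circles of radius \<open>R / 4\<close> around points of the half-size ball stay
    inside the ball, so Cauchy's inequality yields \<open>2 * B / (R / 4)^2\<close>, the origin of
    the constant 32.\<close>
  have "cmod ((deriv ^^ 2) g x) \<le> 32 * B / R\<^sup>2" if "x \<in> ball 0 (R/2)" for x
  proof -
    have sub: "cball x (R/4) \<subseteq> ball 0 R"
    proof
      fix y assume "y \<in> cball x (R/4)"
      then have "norm y \<le> norm x + R/4" using norm_triangle_ineq[of x "y - x"] by (simp add: dist_norm norm_minus_commute)
      with that R show "y \<in> ball 0 R" by simp
    qed
    have "norm ((deriv ^^ 2) g x) \<le> (fact 2) * B / (R/4)^2"
    proof (rule Cauchy_inequality)
      show "g holomorphic_on ball x (R/4)" using g sub by (meson ball_subset_cball holomorphic_on_subset)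
      show "continuous_on (cball x (R/4)) g"
        using g sub by (meson holomorphic_on_imp_continuous_on holomorphic_on_subset)
      show "0 < R/4" using R by simp
      fix y assume "norm (x - y) = R/4"
      then have "y \<in> cball x (R/4)" by (simp add: dist_norm)
      then show "norm (g y) \<le> B" using sub B by blast
    qed
    then show ?thesis by (simp add: power_divide fact_numeral)
  qed
  then have "cmod ((deriv ^^ 0) g t - (\<Sum>i\<le>1. (deriv ^^ i) g 0 * (of_real t - 0) ^ i / fact i))
      \<le> (32 * B / R\<^sup>2) * cmod (of_real t - 0) ^ Suc 1 / fact 1"
  proof (intro complex_Taylor[of "ball 0 (R/2)"])
    fix i and x :: complex assume "x \<in> ball 0 (R/2 :: real)" "i \<le> (1::nat)"
    then have x: "x \<in> ball 0 R" using R by auto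
    have "(deriv ^^ i) g holomorphic_on ball 0 R" using g by (rule holomorphic_higher_deriv) auto
    from holomorphic_derivI[OF this open_ball x, of "ball 0 (R/2)"]
    show "((deriv ^^ i) g has_field_derivative (deriv ^^ Suc i) g x) (at x within ball 0 (R/2))"
      by simp
  qed (use t R in \<open>auto simp: numeral_2_eq_2\<close>)
  then have "cmod (g t - g 0 - deriv g 0 * t) \<le> (32 * B / R\<^sup>2) * t * t"
    using t by (simp add: power2_eq_square algebra_simps)
  moreover have "(g t - g 0) / t - deriv g 0 = (g t - g 0 - deriv g 0 * t) / t"
    using t by (simp add: field_simps)
  ultimately show ?thesis using t by (simp add: norm_divide divide_le_eq)
qed

text \<open>\<open>holo_on\<close> asks only for pointwise differentiability. Exhibiting the
  derivative as a uniform limit of difference quotients is what makes it holomorphic along curves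
  and continuous in the base point.\<close>

lemma cderiv_uniform_limit:
  fixes G :: "complex^'n::{finite,linorder} \<Rightarrow> complex^'m::{finite,linorder}"
  assumes G: "holo_on (ball b \<rho>) G" and \<rho>': "0 < \<rho>'" "\<rho>' < \<rho>"
  obtains t :: "nat \<Rightarrow> real" where "\<And>n z. z \<in> cball b \<rho>' \<Longrightarrow> z + of_real (t n) *s v \<in> ball b \<rho>"
    "\<And>i. uniform_limit (cball b \<rho>') (\<lambda>n z. (G (z + of_real (t n) *s v) $ i - G z $ i) / of_real (t n))
       (\<lambda>z. cderiv G z v $ i) sequentially"
proof -
  define \<rho>2 where "\<rho>2 = (\<rho>' + \<rho>) / 2"
  \<comment> \<open>A shift by \<open>m *s v\<close> with \<open>norm m < R\<close> leads at most to
    radius \<open>\<rho>2\<close>, where \<open>G\<close> is bounded. The summand 1 covers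
    \<open>v = 0\<close>.\<close>
  define R where "R = (\<rho>2 - \<rho>') / (norm v + 1)"
  have nv: "0 < norm v + 1" using norm_ge_zero[of v] by linarith
  have R: "0 < R" using \<rho>' nv by (simp add: R_def \<rho>2_def)
  have in2: "z + m *s v \<in> cball b \<rho>2" if "z \<in> cball b \<rho>'" "norm m < R" for z m
  proof -
    have "norm (m *s v) \<le> R * (norm v + 1)"
      unfolding norm_smult using that R by (intro mult_mono) auto
    also have "\<dots> = \<rho>2 - \<rho>'" using nv by (simp add: R_def)
    finally have "norm (m *s v) \<le> \<rho>2 - \<rho>'" .
    moreover have "dist b (z + m *s v) \<le> dist b z + norm (m *s v)"
      using dist_triangle[of b "z + m *s v" z] by (simp add: dist_norm)
    ultimately show ?thesis using that by simp
  qed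
  have sub: "cball b \<rho>2 \<subseteq> ball b \<rho>" using \<rho>' by (auto simp: \<rho>2_def)
  have "continuous_on (cball b \<rho>2) G"
    using holo_on_continuous_on[OF G] sub by (rule continuous_on_subset)
  then have "bounded (G ` cball b \<rho>2)" by (intro compact_imp_bounded compact_continuous_image) auto
  then obtain B where B: "\<And>z. z \<in> cball b \<rho>2 \<Longrightarrow> norm (G z) \<le> B"
    unfolding bounded_iff by blast
  define t where "t n = (R / 4) / (real n + 1)" for n
  have t: "0 < t n" "t n < R/2" for n
  proof -
    show "0 < t n" using R by (simp add: t_def)
    have "t n \<le> R / 4 / 1" unfolding t_def using R by (intro divide_left_mono) auto
    then show "t n < R / 2" using R by simp
  qed
  show ?thesis
  proof
    show "z + of_real (t n) *s v \<in> ball b \<rho>" if "z \<in> cball b \<rho>'" for n z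
      using in2[OF that, of "of_real (t n)"] sub t[of n] R by auto
    fix i
    define C where "C = 32 * B / R\<^sup>2"
    have bd: "norm ((G (z + of_real (t n) *s v) $ i - G z $ i) / of_real (t n) - cderiv G z v $ i) \<le> C * t n"
      if z: "z \<in> cball b \<rho>'" for z n
    proof -
      define g where "g = (\<lambda>m. G (z + m *s v) $ i)"
      have W: "z + m *s v \<in> ball b \<rho>" if "m \<in> ball 0 R" for m using in2[OF z, of m] that sub by auto
      have "vhol (ball 0 R) (\<lambda>m. G (z + m *s v))"
        by (rule vhol_comp[OF G vhol_line]) (use W in auto)
      then have hol: "g holomorphic_on ball 0 R" by (simp add: vhol_def g_def)
      have Bg: "cmod (g x) \<le> B" if "x \<in> ball 0 R" for x
        using B[OF in2[OF z, of x]] that Finite_Cartesian_Product.norm_nth_le[of "G (z + x *s v)" i]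
        by (simp add: g_def)
      have "deriv g 0 = cderiv G z v $ i"
        using has_field_derivative_comp[OF G _ has_derivative_line, of z 0 v i] W[of 0] R
        by (auto simp: g_def intro!: DERIV_imp_deriv)
      with difference_quotient_bound[OF hol R Bg t[of n]] show ?thesis by (simp add: g_def C_def)
    qed
    have "(\<lambda>n. C * t n) \<longlonglongrightarrow> C * 0"
      unfolding t_def by (intro tendsto_intros) real_asymp
    then have lim: "(\<lambda>n. C * t n) \<longlonglongrightarrow> 0" by simp
    show "uniform_limit (cball b \<rho>') (\<lambda>n z. (G (z + of_real (t n) *s v) $ i - G z $ i) / of_real (t n))
       (\<lambda>z. cderiv G z v $ i) sequentially"
    proof (rule uniform_limitI)
      fix e :: real assume "0 < e"
      from order_tendstoD(2)[OF lim this]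
      show "\<forall>\<^sub>F n in sequentially. \<forall>z\<in>cball b \<rho>'.
        dist ((G (z + of_real (t n) *s v) $ i - G z $ i) / of_real (t n)) (cderiv G z v $ i) < e"
        by (rule eventually_mono) (use bd in \<open>auto simp del: mem_cball simp: dist_norm intro: le_less_trans\<close>)
    qed
  qed
qed

lemma ball_shrink:
  assumes "compact K" "K \<subseteq> ball b \<rho>" "0 < \<rho>"
  obtains \<rho>' where "0 < \<rho>'" "\<rho>' < \<rho>" "K \<subseteq> cball b \<rho>'"
proof (cases "K = {}")
  case True
  then show ?thesis using that[of "\<rho>/2"] assms(3) by auto
next
  case False
  then obtain x where x: "x \<in> K" "\<And>y. y \<in> K \<Longrightarrow> dist b y \<le> dist b x"
    using continuous_attains_sup[OF assms(1) False, of "\<lambda>y. dist b y"]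
      continuous_on_dist[OF continuous_on_const continuous_on_id, of K b] by auto
  have "dist b x < \<rho>" using x assms by auto
  then show ?thesis using x(2) assms(3) by (intro that[of "max (dist b x) (\<rho>/2)"]) (auto simp: le_max_iff_disj)
qed

lemma vhol_cderiv:
  assumes G: "holo_on (ball b \<rho>) G" and \<rho>: "0 < \<rho>" and Z: "vhol S Z" "open S" "\<And>l. l \<in> S \<Longrightarrow> Z l \<in> ball b \<rho>"
  shows "vhol S (\<lambda>l. cderiv G (Z l) v)"
  unfolding vhol_def
proof
  fix i
  have "(\<lambda>l. cderiv G (Z l) v $ i) holomorphic_on ball l0 e" if l0: "cball l0 e \<subseteq> S" for l0 e
  proof -
    have cZ: "continuous_on (cball l0 e) Z" using vhol_continuous_on[OF Z(1,2)] l0 by (rule continuous_on_subset)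
    then have "compact (Z ` cball l0 e)" by (intro compact_continuous_image) auto
    moreover have "Z ` cball l0 e \<subseteq> ball b \<rho>" using Z(3) l0 by blast
    ultimately obtain \<rho>' where \<rho>': "0 < \<rho>'" "\<rho>' < \<rho>" "Z ` cball l0 e \<subseteq> cball b \<rho>'"
      using ball_shrink[OF _ _ \<rho>, of "Z ` cball l0 e" b] by blast
    from cderiv_uniform_limit[OF G \<rho>'(1,2)] obtain t where
      t: "\<And>n z. z \<in> cball b \<rho>' \<Longrightarrow> z + of_real (t n) *s v \<in> ball b \<rho>"
      and ul: "\<And>i. uniform_limit (cball b \<rho>') (\<lambda>n z. (G (z + of_real (t n) *s v) $ i - G z $ i) / of_real (t n))
       (\<lambda>z. cderiv G z v $ i) sequentially" by blast
    show ?thesis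
    proof (rule holomorphic_uniform_sequence)
      fix n
      have sub: "ball l0 e \<subseteq> S" using l0 by (meson ball_subset_cball subset_trans)
      have ZZ: "Z l \<in> cball b \<rho>'" if "l \<in> ball l0 e" for l
        using that \<rho>'(3) ball_subset_cball[of l0 e] by blast
      have "vhol (ball l0 e) (\<lambda>l. G (Z l + of_real (t n) *s v))"
        by (rule vhol_comp[OF G]) (use vhol_subset[OF Z(1) sub] ZZ t in \<open>auto intro!: vhol_intros\<close>)
      moreover have "vhol (ball l0 e) (\<lambda>l. G (Z l))"
        by (rule vhol_comp[OF G]) (use vhol_subset[OF Z(1) sub] Z(3) sub in \<open>auto intro!: vhol_intros\<close>)
      ultimately show "(\<lambda>l. (G (Z l + of_real (t n) *s v) $ i - G (Z l) $ i) / of_real (t n)) holomorphic_on ball l0 e"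
        by (cases "t n = 0") (auto simp: vhol_def intro!: holomorphic_intros)
    next
      fix x assume "x \<in> ball l0 e"
      then obtain d where d: "0 < d" "cball x d \<subseteq> ball l0 e" using open_ball[unfolded open_contains_cball] by blast
      have "uniform_limit (cball x d) (\<lambda>n l. (G (Z l + of_real (t n) *s v) $ i - G (Z l) $ i) / of_real (t n))
        (\<lambda>l. cderiv G (Z l) v $ i) sequentially"
        by (rule uniform_limit_compose'[OF ul]) (use d \<rho>' ball_subset_cball[of l0 e] in blast)
      then show "\<exists>d>0. cball x d \<subseteq> ball l0 e \<and> uniform_limit (cball x d)
          (\<lambda>n l. (G (Z l + of_real (t n) *s v) $ i - G (Z l) $ i) / of_real (t n))
          (\<lambda>l. cderiv G (Z l) v $ i) sequentially"
        using d by blast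
    qed auto
  qed
  note loc = this
  show "(\<lambda>l. cderiv G (Z l) v $ i) holomorphic_on S"
    unfolding holomorphic_on_def
  proof
    fix l0 assume "l0 \<in> S"
    then obtain e where e: "0 < e" "cball l0 e \<subseteq> S" using Z(2) open_contains_cball by blast
    then have "(\<lambda>l. cderiv G (Z l) v $ i) field_differentiable (at l0)"
      using holomorphic_on_imp_differentiable_at[OF loc[OF e(2)]] by simp
    then show "(\<lambda>l. cderiv G (Z l) v $ i) field_differentiable (at l0 within S)"
      by (rule field_differentiable_at_within)
  qed
qed

lemma cderiv_continuous_on:
  assumes G: "holo_on (ball b \<rho>) G" and \<rho>: "0 < \<rho>"
  shows "continuous_on (ball b \<rho>) (\<lambda>z. cderiv G z v)"
proof -
  have "continuous (at z) (\<lambda>z. cderiv G z v $ i)" if "z \<in> ball b \<rho>" for z i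
  proof -
    from that obtain d where d: "0 < d" "cball z d \<subseteq> ball b \<rho>" using open_ball[unfolded open_contains_cball] by blast
    then obtain \<rho>' where \<rho>': "0 < \<rho>'" "\<rho>' < \<rho>" "cball z d \<subseteq> cball b \<rho>'"
      using ball_shrink[OF compact_cball _ \<rho>, of z d b] by blast
    from cderiv_uniform_limit[OF G \<rho>'(1,2)] obtain t where
      t: "\<And>n z. z \<in> cball b \<rho>' \<Longrightarrow> z + of_real (t n) *s v \<in> ball b \<rho>"
      and ul: "\<And>i. uniform_limit (cball b \<rho>') (\<lambda>n z. (G (z + of_real (t n) *s v) $ i - G z $ i) / of_real (t n))
       (\<lambda>z. cderiv G z v $ i) sequentially" by blast
    have "continuous_on (cball b \<rho>') (\<lambda>z. cderiv G z v $ i)"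
    proof (rule uniform_limit_theorem[OF _ ul])
      have c1: "continuous_on (cball b \<rho>') G"
        using holo_on_continuous_on[OF G] by (rule continuous_on_subset) (use \<rho>' in auto)
      have c2: "continuous_on (cball b \<rho>') (\<lambda>z. G (z + of_real (t n) *s v))" for n
        by (rule continuous_on_compose2[OF holo_on_continuous_on[OF G]])
           (use t in \<open>auto intro!: continuous_intros\<close>)
      show "\<forall>\<^sub>F n in sequentially. continuous_on (cball b \<rho>') (\<lambda>z. (G (z + of_real (t n) *s v) $ i - G z $ i) / of_real (t n))"
      proof (intro always_eventually allI)
        fix n
        show "continuous_on (cball b \<rho>') (\<lambda>z. (G (z + of_real (t n) *s v) $ i - G z $ i) / of_real (t n))"
          by (cases "t n = 0") (auto intro!: continuous_intros c1 c2)
      qed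
    qed auto
    then have "continuous_on (ball z d) (\<lambda>z. cderiv G z v $ i)"
      by (rule continuous_on_subset) (use \<rho>'(3) in auto)
    then show ?thesis using d(1) by (simp add: continuous_on_eq_continuous_at)
  qed
  then have "continuous (at z) (\<lambda>z. cderiv G z v)" if "z \<in> ball b \<rho>" for z
    using that unfolding continuous_at by (intro vec_tendstoI) auto
  then show ?thesis by (intro continuous_at_imp_continuous_on) auto
qed

text \<open>The real points of \<open>S\<close> accumulate at \<open>x0\<close>. Every polarization
  below ends with this lemma, applied at a nonreal \<open>w\<close>.\<close>

lemma holomorphic_zero_on_reals:
  assumes "f holomorphic_on S" "open S" "connected S" "of_real x0 \<in> S"
    and "\<And>x::real. of_real x \<in> S \<Longrightarrow> f (of_real x) = 0" "w \<in> S"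
  shows "f w = 0"
proof (rule analytic_continuation[OF assms(1-3)])
  show "S \<inter> \<real> \<subseteq> S" "of_real x0 \<in> S" "w \<in> S" using assms by auto
  show "f z = 0" if "z \<in> S \<inter> \<real>" for z using that assms(5) by (auto elim!: Reals_cases)
  show "complex_of_real x0 islimpt S \<inter> \<real>"
    unfolding islimpt_approachable
  proof (intro allI impI)
    fix e :: real assume "0 < e"
    from assms(2,4) obtain d where d: "0 < d" "ball (of_real x0) d \<subseteq> S" using open_contains_ball by blast
    define y where "y = x0 + min d e / 2"
    have y: "dist (complex_of_real x0) (of_real y) = min d e / 2"
      using d \<open>0 < e\<close> by (simp add: dist_of_real y_def dist_norm)
    then have "of_real y \<in> ball (complex_of_real x0) d" using d \<open>0 < e\<close> by simp
    with d have "of_real y \<in> S \<inter> \<real>" by auto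
    moreover have "complex_of_real y \<noteq> of_real x0" using d \<open>0 < e\<close> by (simp add: y_def)
    moreover have "dist (of_real y) (complex_of_real x0) < e"
      using d \<open>0 < e\<close> y by (simp add: dist_commute)
    ultimately show "\<exists>x'\<in>S \<inter> \<real>. x' \<noteq> complex_of_real x0 \<and> dist x' (complex_of_real x0) < e"
      by blast
  qed
qed

section \<open>Polarization along the null cone\<close>

text \<open>The affine curve through \<open>z\<close> at \<open>\<i>\<close> and \<open>w\<close> at \<open>-\<i>\<close> is corrected in the null direction \<open>v\<close>
  so that it becomes null at real parameters; the correction vanishes at \<open>\<plusminus>\<i>\<close> because
  \<open>\<langle>Z l, Z (cnj l)\<rangle>\<close> is a multiple of \<open>l\<^sup>2 + 1\<close> on the affine curve.\<close>

lemma polar_curve: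
  fixes b v :: "complex^'n::{finite,linorder}"
  assumes vb: "hform r s v b = 1" and vv: "hform r s v v = 0" and bb: "hform r s b b = 0" and \<rho>: "0 < \<rho>"
  obtains \<delta> where "0 < \<delta>" "\<And>z w. z \<in> ball b \<delta> \<Longrightarrow> w \<in> ball b \<delta> \<Longrightarrow> hform r s z w = 0 \<Longrightarrow>
    \<exists>Z. vhol (ball 0 2) Z \<and> (\<forall>l\<in>ball 0 2. Z l \<in> ball b \<rho> \<and> hform r s (Z l) (Z (cnj l)) = 0)
      \<and> Z \<i> = z \<and> Z (- \<i>) = w"
proof -
  \<comment> \<open>\<open>\<delta> * K\<close> will bound the distance of the curve from
    \<open>b\<close>: \<open>3 * \<delta>\<close> for its affine part, the rest for the correction
    along \<open>v\<close>. The bound on \<open>\<delta>\<close> with \<open>norm v + 1\<close>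
    keeps \<open>a l\<close> within 1/2 of \<open>hform r s v b = 1\<close>.\<close>
  define K where "K = 3 + 5 * (2 * norm b + 1) * norm v"
  define \<delta> where "\<delta> = min (min 1 (1 / (6 * (norm v + 1)))) (\<rho> / K)"
  have K: "0 < K" unfolding K_def by (intro add_pos_nonneg mult_nonneg_nonneg add_nonneg_nonneg) auto
  have nv: "0 < norm v + 1" using norm_ge_zero[of v] by linarith
  have \<delta>: "0 < \<delta>" "\<delta> \<le> 1" "\<delta> * norm v * 3 \<le> 1 / 2" "\<delta> * K \<le> \<rho>"
  proof -
    show "0 < \<delta>" using \<rho> K nv by (auto simp: \<delta>_def)
    show "\<delta> \<le> 1" unfolding \<delta>_def by (rule order_trans[OF min.cobounded1 min.cobounded1])
    have "\<delta> \<le> 1 / (6 * (norm v + 1))" by (simp add: \<delta>_def)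
    then have "\<delta> * (6 * (norm v + 1)) \<le> 1" using nv by (simp add: pos_le_divide_eq)
    then have "6 * (\<delta> * norm v) + 6 * \<delta> \<le> 1" by (simp add: algebra_simps)
    with \<open>0 < \<delta>\<close> show "\<delta> * norm v * 3 \<le> 1 / 2" by linarith
    have "\<delta> \<le> \<rho> / K" by (simp add: \<delta>_def)
    then show "\<delta> * K \<le> \<rho>" using K by (simp add: pos_le_divide_eq)
  qed
  show ?thesis
  proof (rule that[OF \<delta>(1)])
    fix z w assume z: "z \<in> ball b \<delta>" and w: "w \<in> ball b \<delta>" and zw: "hform r s z w = 0"
    define \<alpha> where "\<alpha> = (1/2) *s (z + w)"
    define \<beta> where "\<beta> = (1/(2*\<i>)) *s (z - w)"
    have nz: "norm (z - b) < \<delta>" "norm (w - b) < \<delta>" using z w by (auto simp: dist_norm norm_minus_commute)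
    have "\<alpha> - b = (1/2) *s ((z - b) + (w - b))"
      by (simp add: \<alpha>_def vec_eq_iff field_simps)
    then have "norm (\<alpha> - b) = norm ((z - b) + (w - b)) / 2" by (simp only: norm_smult) simp
    then have n\<alpha>: "norm (\<alpha> - b) < \<delta>" using norm_triangle_ineq[of "z - b" "w - b"] nz by linarith
    have "norm \<beta> = norm (1 / (2*\<i>)) * norm (z - w)" unfolding \<beta>_def by (rule norm_smult)
    then have "norm \<beta> = norm ((z - b) - (w - b)) / 2" by (simp add: norm_divide norm_mult)
    then have n\<beta>: "norm \<beta> < \<delta>" using norm_triangle_ineq4[of "z - b" "w - b"] nz by linarith
    have zab: "\<alpha> + \<i> *s \<beta> = z" "\<alpha> + (- \<i>) *s \<beta> = w"
      by (simp_all add: \<alpha>_def \<beta>_def vec_eq_iff field_simps)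
    define Z0 where "Z0 l = \<alpha> + l *s \<beta>" for l
    define Q where "Q = hform r s \<alpha> \<alpha>"
    have Q_eq: "hform r s (Z0 l) (Z0 (cnj l)) = (l\<^sup>2 + 1) * Q" for l
    proof -
      define X where "X = hform r s \<alpha> \<beta> + hform r s \<beta> \<alpha>"
      have X: "Im X = 0" unfolding X_def using hform_cnj[of r s \<alpha> \<beta>] by (auto simp: complex_eq_iff)
      \<comment> \<open>This is \<open>hform r s z w = 0\<close> expanded at
        \<open>l = \<i>\<close>. As \<open>Q\<close>, \<open>X\<close> and
        \<open>hform r s \<beta> \<beta>\<close> are real, it splits into \<open>X = 0\<close> and
        \<open>hform r s \<beta> \<beta> = Q\<close>.\<close>
      have "0 = Q + \<i> * X - hform r s \<beta> \<beta>"
        using zw unfolding zab[symmetric] by (simp add: Q_def X_def hform_linear algebra_simps)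
      then have "Re Q = Re (hform r s \<beta> \<beta>)" "Re X = 0"
        using X by (auto simp: complex_eq_iff Q_def)
      then have "hform r s \<beta> \<beta> = Q" "X = 0" using X by (auto simp: complex_eq_iff Q_def)
      moreover have "hform r s (Z0 l) (Z0 (cnj l)) = Q + l * X + l\<^sup>2 * hform r s \<beta> \<beta>"
        by (simp add: Z0_def Q_def X_def hform_linear algebra_simps power2_eq_square)
      ultimately show ?thesis by (simp add: algebra_simps)
    qed
    have Z0b: "norm (Z0 l - b) < 3 * \<delta>" if "norm l < 2" for l
    proof -
      have "norm (Z0 l - b) \<le> norm (\<alpha> - b) + norm (l *s \<beta>)"
        using norm_triangle_ineq[of "\<alpha> - b" "l *s \<beta>"] by (simp add: Z0_def algebra_simps)
      also have "norm (l *s \<beta>) \<le> 2 * \<delta>" unfolding norm_smult using that n\<beta> by (intro mult_mono) auto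
      finally show ?thesis using n\<alpha> by linarith
    qed
    define a where "a l = hform r s v (Z0 (cnj l))" for l
    have a: "1/2 \<le> norm (a l)" if "norm l < 2" for l
    proof -
      have "a l - 1 = hform r s v (Z0 (cnj l) - b)" using vb by (simp add: a_def hform_diff_right)
      then have "norm (a l - 1) \<le> norm v * norm (Z0 (cnj l) - b)" by (simp add: norm_hform_le)
      also have "\<dots> \<le> norm v * (3 * \<delta>)" using Z0b[of "cnj l"] that by (intro mult_left_mono) auto
      also have "\<dots> \<le> 1/2" using \<delta>(3) by (simp add: algebra_simps)
      finally show ?thesis using norm_triangle_ineq2[of 1 "1 - a l"] by (simp add: norm_minus_commute)
    qed
    then have a0: "a l \<noteq> 0" if "norm l < 2" for l using that by force
    \<comment> \<open>Since \<open>v\<close> is null, the correction enters through two linear terms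
      only; each is made to cancel half of \<open>(l\<^sup>2 + 1) * Q\<close>.\<close>
    define \<tau> where "\<tau> l = (l\<^sup>2 + 1) * Q / (2 * a l)" for l
    define Z where "Z l = Z0 l - \<tau> l *s v" for l
    have nQ: "norm Q \<le> \<delta> * (2 * norm b + 1)"
    proof -
      have "Q = hform r s (\<alpha> - b) \<alpha> + hform r s b (\<alpha> - b)"
        by (simp add: Q_def hform_linear bb)
      then have "norm Q \<le> norm (hform r s (\<alpha> - b) \<alpha>) + norm (hform r s b (\<alpha> - b))"
        by (simp add: norm_triangle_ineq)
      also have "\<dots> \<le> norm (\<alpha> - b) * norm \<alpha> + norm b * norm (\<alpha> - b)"
        by (intro add_mono norm_hform_le)
      also have "\<dots> \<le> \<delta> * (norm b + 1) + norm b * \<delta>"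
      proof (intro add_mono mult_mono)
        show "norm \<alpha> \<le> norm b + 1" using norm_triangle_ineq[of b "\<alpha> - b"] n\<alpha> \<delta> by simp
      qed (use n\<alpha> \<delta> in auto)
      finally show ?thesis by (simp add: algebra_simps)
    qed
    have ZW: "Z l \<in> ball b \<rho>" if l: "norm l < 2" for l
    proof -
      have "norm (l\<^sup>2 + 1) \<le> norm l * norm l + 1"
        using norm_triangle_ineq[of "l\<^sup>2" 1] by (simp add: norm_mult power2_eq_square)
      also have "\<dots> \<le> 2 * 2 + 1" using l by (intro add_mono mult_mono) auto
      finally have l2: "norm (l\<^sup>2 + 1) \<le> 5" by simp
      have "norm (\<tau> l) = norm (l\<^sup>2 + 1) * norm Q / (2 * norm (a l))"
        by (simp add: \<tau>_def norm_mult norm_divide)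
      also have "\<dots> \<le> 5 * (\<delta> * (2 * norm b + 1)) / (2 * (1/2))"
        using order_trans[OF norm_ge_zero nQ] l2 nQ a[OF l] by (intro frac_le mult_mono) auto
      finally have t: "norm (\<tau> l) \<le> 5 * (\<delta> * (2 * norm b + 1))" by simp
      have "norm (Z l - b) \<le> norm (Z0 l - b) + norm (\<tau> l *s v)"
        using norm_triangle_ineq4[of "Z0 l - b" "\<tau> l *s v"] by (simp add: Z_def algebra_simps)
      also have "\<dots> < 3 * \<delta> + 5 * (\<delta> * (2 * norm b + 1)) * norm v"
        using Z0b[OF l] t unfolding norm_smult by (intro add_less_le_mono mult_right_mono) auto
      also have "\<dots> = \<delta> * K" by (simp add: K_def algebra_simps)
      finally show ?thesis using \<delta>(4) by (simp add: dist_norm norm_minus_commute)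
    qed
    have holZ: "vhol (ball 0 2) Z"
      unfolding Z_def Z0_def \<tau>_def
    proof (intro vhol_intros holomorphic_intros)
      show "a holomorphic_on ball 0 2" unfolding a_def[abs_def] Z0_def[abs_def]
        by (rule holomorphic_hform_right) (auto intro: vhol_line)
    qed (use a0 in auto)
    have orth: "hform r s (Z l) (Z (cnj l)) = 0" if l: "norm l < 2" for l
    proof -
      have "cnj Q = Q" by (simp add: Q_def hform_cnj)
      then have "cnj (\<tau> (cnj l)) = (l\<^sup>2 + 1) * Q / (2 * hform r s (Z0 l) v)"
        by (simp add: \<tau>_def a_def hform_cnj)
      moreover have "hform r s (Z0 l) v \<noteq> 0" using a0[of "cnj l"] l by (simp add: a_def hform_swap_zero[of r s v])
      ultimately have 1: "cnj (\<tau> (cnj l)) * hform r s (Z0 l) v = (l\<^sup>2 + 1) * Q / 2" by simp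
      have 2: "\<tau> l * hform r s v (Z0 (cnj l)) = (l\<^sup>2 + 1) * Q / 2"
        using a0[OF l] by (simp add: \<tau>_def a_def)
      have "hform r s (Z l) (Z (cnj l)) = hform r s (Z0 l) (Z0 (cnj l))
          - \<tau> l * hform r s v (Z0 (cnj l)) - cnj (\<tau> (cnj l)) * hform r s (Z0 l) v"
        by (simp add: Z_def hform_linear vv algebra_simps)
      then show ?thesis unfolding Q_eq 1 2 by simp
    qed
    have "\<tau> \<i> = 0" "\<tau> (- \<i>) = 0" by (simp_all add: \<tau>_def)
    then have "Z \<i> = z" "Z (- \<i>) = w" unfolding Z_def Z0_def zab by simp_all
    moreover have "\<forall>l\<in>ball 0 2. Z l \<in> ball b \<rho> \<and> hform r s (Z l) (Z (cnj l)) = 0"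
      using ZW orth by simp
    ultimately show "\<exists>Z. vhol (ball 0 2) Z \<and> (\<forall>l\<in>ball 0 2. Z l \<in> ball b \<rho> \<and> hform r s (Z l) (Z (cnj l)) = 0)
      \<and> Z \<i> = z \<and> Z (- \<i>) = w" using holZ by blast
  qed
qed

definition orthogonal_ball ::
  "nat \<Rightarrow> nat \<Rightarrow> nat \<Rightarrow> complex^'n::{finite,linorder} \<Rightarrow> real
     \<Rightarrow> (complex^'n::{finite,linorder} \<Rightarrow> complex^'m::{finite,linorder}) \<Rightarrow> bool" where
  "orthogonal_ball r s s' b \<rho> G \<longleftrightarrow> 0 < \<rho> \<and> holo_on (ball b \<rho>) G
     \<and> (\<forall>z\<in>ball b \<rho>. \<forall>w\<in>ball b \<rho>. hform r s z w = 0 \<longrightarrow> hform r s' (G z) (G w) = 0)"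

lemma orthogonal_ballD:
  assumes "orthogonal_ball r s s' b \<rho> G"
  shows "0 < \<rho>" "holo_on (ball b \<rho>) G"
    "\<And>z w. z \<in> ball b \<rho> \<Longrightarrow> w \<in> ball b \<rho> \<Longrightarrow> hform r s z w = 0 \<Longrightarrow> hform r s' (G z) (G w) = 0"
  using assms by (auto simp: orthogonal_ball_def)

text \<open>Along a curve from \<open>polar_curve\<close>, the pairing of \<open>G (Z l)\<close>
  with \<open>G (Z (cnj l))\<close> is holomorphic in \<open>l\<close> and vanishes at real
  \<open>l\<close>, where \<open>Z l\<close> is null. Its value at \<open>\<i>\<close> is the
  pairing of \<open>G z\<close> with \<open>G w\<close>.\<close>

lemma null_preserving_imp_orthogonal_ball:
  fixes G :: "complex^'n::{finite,linorder} \<Rightarrow> complex^'m::{finite,linorder}"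
  assumes vb: "hform r s v b = 1" and vv: "hform r s v v = 0" and bb: "hform r s b b = 0" and \<rho>: "0 < \<rho>"
    and G: "holo_on (ball b \<rho>) G"
    and null: "\<And>z. z \<in> ball b \<rho> \<Longrightarrow> hform r s z z = 0 \<Longrightarrow> hform r s' (G z) (G z) = 0"
  obtains \<delta> where "\<delta> \<le> \<rho>" "orthogonal_ball r s s' b \<delta> G"
proof -
  obtain \<delta> where \<delta>: "0 < \<delta>" "\<And>z w. z \<in> ball b \<delta> \<Longrightarrow> w \<in> ball b \<delta> \<Longrightarrow> hform r s z w = 0 \<Longrightarrow>
    \<exists>Z. vhol (ball 0 2) Z \<and> (\<forall>l\<in>ball 0 2. Z l \<in> ball b \<rho> \<and> hform r s (Z l) (Z (cnj l)) = 0)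
      \<and> Z \<i> = z \<and> Z (- \<i>) = w"
    using polar_curve[OF vb vv bb \<rho>] by blast
  have "hform r s' (G z) (G w) = 0" if "z \<in> ball b \<delta>" "w \<in> ball b \<delta>" "hform r s z w = 0" for z w
  proof -
    from \<delta>(2)[OF that] obtain Z where Z: "vhol (ball 0 2) Z" "\<And>l. l \<in> ball 0 2 \<Longrightarrow> Z l \<in> ball b \<rho>"
      "\<And>l. l \<in> ball 0 2 \<Longrightarrow> hform r s (Z l) (Z (cnj l)) = 0" "Z \<i> = z" "Z (- \<i>) = w" by blast
    have "hform r s' (G (Z \<i>)) (G (Z (cnj \<i>))) = 0"
    proof (rule holomorphic_zero_on_reals[of "\<lambda>l. hform r s' (G (Z l)) (G (Z (cnj l)))" "ball 0 2" 0])
      show "(\<lambda>l. hform r s' (G (Z l)) (G (Z (cnj l)))) holomorphic_on ball 0 2"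
      proof -
        have "vhol (ball 0 2) (\<lambda>l. G (Z l))" by (rule vhol_comp[OF G Z(1)]) (use Z(2) in auto)
        from holomorphic_hform[OF this this] show ?thesis by simp
      qed
      fix x :: real assume "complex_of_real x \<in> ball 0 2"
      then show "hform r s' (G (Z (of_real x))) (G (Z (cnj (of_real x)))) = 0"
        using null[OF Z(2)] Z(3)[of "of_real x"] by simp
    qed auto
    then show ?thesis using Z by simp
  qed
  then have "orthogonal_ball r s s' b (min \<delta> \<rho>) G"
    using \<delta>(1) \<rho> G by (auto simp: orthogonal_ball_def holo_on_def)
  then show ?thesis by (intro that[of "min \<delta> \<rho>"]) auto
qed

section \<open>Rigidity on the orthogonal complement of a null point\<close>

text \<open>Orthogonality to \<open>p\<close> is one condition, imposed inside a block of at least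
  two coordinates of one sign; this is where \<open>r\<close> and \<open>s\<close> must be at least
  2. Vectors from different blocks are orthogonal anyway.\<close>

lemma null_point_frame:
  fixes p :: "complex^'n::{finite,linorder}"
  assumes "2 \<le> r" "2 \<le> s" "r + s \<le> CARD('n)"
  obtains e f :: "complex^'n::{finite,linorder}" where "hform r s e p = 0" "hform r s f p = 0" "hform r s e e = 1"
    "hform r s f f = - 1" "hform r s e f = 0"
proof -
  obtain e :: "complex^'n::{finite,linorder}" where e: "\<And>i. \<not> idx i < r \<Longrightarrow> e$i = 0" "hform r s e e = 1" "hform r s e p = 0"
    using ex_pos_orthogonal[of "{p}" r s] assms by auto
  obtain f :: "complex^'n::{finite,linorder}" where f: "\<And>i. \<not> (r \<le> idx i \<and> idx i < r + s) \<Longrightarrow> f$i = 0"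
      "hform r s f f = - 1" "hform r s f p = 0"
    using ex_neg_orthogonal[of "{p}" s r] assms by auto
  have "hform r s e f = (\<Sum>i\<in>{i. idx i < r}. e$i * cnj (f$i))"
    by (rule hform_pos_part) (use e(1) in auto)
  also have "\<dots> = 0" by (rule sum.neutral) (use f in auto)
  finally have "hform r s e f = 0" .
  with e f that show ?thesis by auto
qed

text \<open>On a complex line through \<open>y\<close> in a null direction \<open>x\<close>
  orthogonal to \<open>p\<close>, the null points contain a real line, so vanishing there forces
  vanishing at \<open>y\<close>. This requires a nonzero pairing of \<open>y\<close> with
  \<open>x\<close> and a null point inside the ball, both available near the null point
  \<open>z1\<close>. The identity theorem on the complex line from \<open>z1\<close> to
  \<open>z\<close> does the rest.\<close>

lemma null_cone_identity:
  fixes p :: "complex^'n::{finite,linorder}"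
  assumes dims: "2 \<le> r" "2 \<le> s" "r + s \<le> CARD('n)"
    and hol: "\<And>a d. (\<lambda>l. f (a + l *s d)) holomorphic_on {l. a + l *s d \<in> ball b \<rho>}"
    and zero: "\<And>y. y \<in> ball b \<rho> \<Longrightarrow> hform r s y p = 0 \<Longrightarrow> hform r s y y = 0 \<Longrightarrow> f y = 0"
    and p: "p \<in> ball b \<rho>" "hform r s p p = 0" and z: "z \<in> ball b \<rho>" "hform r s z p = 0"
  shows "f z = 0"
proof -
  obtain e e' where e: "hform r s e p = 0" "hform r s e' p = 0" "hform r s e e = 1"
    "hform r s e' e' = - 1" "hform r s e e' = 0" using null_point_frame[OF dims, of p] by metis
  have e': "hform r s e' e = 0" using e(5) hform_swap_zero by blast
  define \<xi> where "\<xi> = e + e'"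
  define x where "x = e - e'"
  have px: "hform r s p x = 0" "hform r s x p = 0" "hform r s p \<xi> = 0" "hform r s \<xi> p = 0"
    using e(1,2) e(1,2)[THEN hform_swap_zero[THEN iffD1]] by (simp_all add: x_def \<xi>_def hform_linear)
  have xx: "hform r s x x = 0" "hform r s \<xi> \<xi> = 0" "hform r s \<xi> x = 2"
    using e e' by (auto simp: x_def \<xi>_def hform_linear)
  have "0 \<in> {l. p + l *s \<xi> \<in> ball b \<rho>}" using p by simp
  then obtain d where d: "0 < d" "ball 0 d \<subseteq> {l. p + l *s \<xi> \<in> ball b \<rho>}"
    using open_line_preimage[OF open_ball, of p \<xi> b \<rho>] open_contains_ball by blast
  \<comment> \<open>\<open>\<xi>\<close> is null, orthogonal to \<open>p\<close>, and pairs to 2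
    with \<open>x\<close>; so \<open>z1\<close> stays null and satisfies
    \<open>hform r s z1 x = d\<close>.\<close>
  define z1 where "z1 = p + of_real (d/2) *s \<xi>"
  have "of_real (d/2) \<in> ball (0::complex) d" using d by simp
  then have z1: "z1 \<in> ball b \<rho>" unfolding z1_def using d by blast
  have z1x: "hform r s z1 x = of_real d" "hform r s z1 p = 0" "hform r s z1 z1 = 0"
    using px xx p by (simp_all add: z1_def hform_linear)
  define Y where "Y l = z1 + l *s (z - z1)" for l
  have Yp: "hform r s (Y l) p = 0" for l using z z1x by (simp add: Y_def hform_linear)
  have key: "f y = 0" if y: "y \<in> ball b \<rho>" "hform r s y p = 0" and a: "hform r s y x \<noteq> 0"
    and y': "y - (hform r s y y / (2 * cnj (hform r s y x))) *s x \<in> ball b \<rho>" for y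
  proof -
    define a where "a = hform r s y x"
    define Q where "Q = hform r s y y"
    \<comment> \<open>Subtracting \<open>\<mu> *s x\<close> makes \<open>y\<close> null, and real
      multiples of \<open>d'\<close> do not change the square. So all real parameters on the line
      give null points, while \<open>y\<close> itself sits at an imaginary parameter.\<close>
    define \<mu> where "\<mu> = Q / (2 * cnj a)"
    define a' where "a' = y - \<mu> *s x"
    define d' where "d' = (\<i> / cnj a) *s x"
    have a0: "a \<noteq> 0" using a by (simp add: a_def)
    define L where "L = {l. a' + l *s d' \<in> ball b \<rho>}"
    have line: "a' + l *s d' = y + (l * \<i> / cnj a - \<mu>) *s x" for l
      by (simp add: a'_def d'_def vec_eq_iff algebra_simps)
    have y_eq: "y = a' + (\<mu> * cnj a / \<i>) *s d'" 
    proof -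
      have "(\<mu> * cnj a / \<i>) * \<i> / cnj a - \<mu> = 0" using a0 by (simp add: divide_simps del: divide_i)
      then show ?thesis unfolding line by simp
    qed
    have "f (a' + (\<mu> * cnj a / \<i>) *s d') = 0"
    proof (rule holomorphic_zero_on_reals[of "\<lambda>l. f (a' + l *s d')" L 0])
      show "(\<lambda>l. f (a' + l *s d')) holomorphic_on L" unfolding L_def by (rule hol)
      show "open L" unfolding L_def by (rule open_line_preimage) simp
      show "connected L" unfolding L_def by (intro convex_connected convex_line_preimage) simp
      show "of_real 0 \<in> L" using y' by (simp add: L_def a'_def \<mu>_def a_def Q_def)
      show "\<mu> * cnj a / \<i> \<in> L" using y(1) y_eq by (simp add: L_def)
      fix t :: real assume t: "of_real t \<in> L"
      define m where "m = of_real t * \<i> / cnj a - \<mu>"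
      have ma: "m * cnj a = of_real t * \<i> - Q / 2" using a0 by (simp add: m_def \<mu>_def algebra_simps)
      have "cnj Q = Q" by (simp add: Q_def hform_cnj)
      then have ma': "cnj m * a = - of_real t * \<i> - Q / 2" using arg_cong[OF ma, of cnj] by simp
      have "hform r s (y + m *s x) (y + m *s x) = Q + cnj m * a + m * cnj a"
        by (simp add: hform_linear Q_def a_def hform_cnj xx algebra_simps)
      then have "hform r s (y + m *s x) (y + m *s x) = 0" unfolding ma ma' by simp
      moreover have "hform r s (y + m *s x) p = 0" using y px by (simp add: hform_linear)
      moreover have "y + m *s x \<in> ball b \<rho>" using t by (simp add: L_def line m_def)
      ultimately show "f (a' + of_real t *s d') = 0" unfolding line m_def[symmetric] by (intro zero)
    qed
    then show ?thesis using y_eq by simp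
  qed
  \<comment> \<open>The null point demanded by \<open>key\<close> for \<open>Y l\<close>. It tends
    to \<open>z1\<close>, because \<open>z1\<close> is already null, so \<open>key\<close> applies
    for small \<open>l\<close>.\<close>
  define V where "V l = Y l - (hform r s (Y l) (Y l) / (2 * cnj (hform r s (Y l) x))) *s x" for l
  have cY: "(Y \<longlongrightarrow> z1) (nhds 0)"
  proof -
    have "isCont Y 0" unfolding Y_def by (rule has_derivative_continuous[OF has_derivative_line])
    then have "(Y \<longlongrightarrow> Y 0) (at 0)" by (simp add: isCont_def)
    then show ?thesis by (simp add: tendsto_nhds_iff Y_def)
  qed
  have cnth: "((\<lambda>l. Y l $ i) \<longlongrightarrow> z1 $ i) (nhds 0)" for i using cY by (rule tendsto_vec_nth)
  have c1: "((\<lambda>l. hform r s (Y l) u) \<longlongrightarrow> hform r s z1 u) (nhds 0)" for u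
    unfolding hform_sgnc by (intro tendsto_intros cnth)
  have c2: "((\<lambda>l. hform r s (Y l) (Y l)) \<longlongrightarrow> hform r s z1 z1) (nhds 0)"
    unfolding hform_sgnc by (intro tendsto_intros cnth)
  have "(V \<longlongrightarrow> z1 - (hform r s z1 z1 / (2 * cnj (hform r s z1 x))) *s x) (nhds 0)"
  proof (rule vec_tendstoI)
    fix i
    have "((\<lambda>l. Y l $ i - (hform r s (Y l) (Y l) / (2 * cnj (hform r s (Y l) x))) * x $ i)
       \<longlongrightarrow> z1 $ i - (hform r s z1 z1 / (2 * cnj (hform r s z1 x))) * x $ i) (nhds 0)"
      by (intro tendsto_intros cnth c1 c2) (use z1x d in auto)
    then show "((\<lambda>l. V l $ i) \<longlongrightarrow> (z1 - (hform r s z1 z1 / (2 * cnj (hform r s z1 x))) *s x) $ i) (nhds 0)"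
      by (simp add: V_def)
  qed
  then have "(V \<longlongrightarrow> z1) (nhds 0)" using z1x by simp
  then have ev1: "\<forall>\<^sub>F l in nhds 0. V l \<in> ball b \<rho>" using z1 by (rule topological_tendstoD[OF _ open_ball])
  have ev2: "\<forall>\<^sub>F l in nhds 0. Y l \<in> ball b \<rho>" using cY z1 by (rule topological_tendstoD[OF _ open_ball])
  have ev3: "\<forall>\<^sub>F l in nhds 0. hform r s (Y l) x \<noteq> 0"
    using topological_tendstoD[OF c1, of "- {0}" x] z1x d by auto
  from ev1 ev2 ev3 have "\<forall>\<^sub>F l in nhds 0. Y l \<in> ball b \<rho> \<and> f (Y l) = 0"
    by eventually_elim (use key Yp in \<open>auto simp: V_def\<close>)
  then obtain S where S: "open S" "0 \<in> S" "\<And>l. l \<in> S \<Longrightarrow> Y l \<in> ball b \<rho> \<and> f (Y l) = 0"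
    unfolding eventually_nhds by blast
  have "f (Y 1) = 0"
  proof (rule analytic_continuation_open[where s = S and s' = "{l. Y l \<in> ball b \<rho>}" and f = "\<lambda>l. f (Y l)" and g = "\<lambda>_. 0" and z = 1])
    show "open {l. Y l \<in> ball b \<rho>}" unfolding Y_def by (rule open_line_preimage) simp
    show "connected {l. Y l \<in> ball b \<rho>}" unfolding Y_def by (intro convex_connected convex_line_preimage) simp
    show "(\<lambda>l. f (Y l)) holomorphic_on {l. Y l \<in> ball b \<rho>}" unfolding Y_def by (rule hol)
  qed (use S z in \<open>auto simp: Y_def\<close>)
  then show ?thesis by (simp add: Y_def)
qed

text \<open>The equality case of Cauchy-Schwarz: for null \<open>y\<close> the square of
  \<open>y' + c *s y\<close> is real affine in \<open>c\<close>, so a nonzero linear part would make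
  it positive somewhere.\<close>

lemma nonpos_form_null_orthogonal:
  assumes "\<And>c. Re (hform r s (y' + c *s y) (y' + c *s y)) \<le> 0" "hform r s y y = 0"
  shows "hform r s y y' = 0"
proof (rule ccontr)
  assume nz: "hform r s y y' \<noteq> 0"
  define a where "a = hform r s y y'"
  define n where "n = Re (hform r s y' y')"
  \<comment> \<open>With \<open>c = of_real t * cnj a\<close> the square of
    \<open>y' + c *s y\<close> becomes 1.\<close>
  define t where "t = (1 - n) / (2 * (norm a)\<^sup>2)"
  have na: "0 < (norm a)\<^sup>2" using nz by (simp add: a_def)
  have "hform r s (y' + c *s y) (y' + c *s y) = hform r s y' y' + (c * a + cnj (c * a))" for c
    using assms(2) by (simp add: hform_linear a_def hform_cnj)
  then have "n + 2 * Re (c * a) \<le> 0" for c using assms(1)[of c] by (simp add: n_def mult.commute)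
  from this[of "of_real t * cnj a"] have "n + 2 * Re (of_real t * (a * cnj a)) \<le> 0" by (simp add: mult_ac)
  then have "n + 2 * (t * (norm a)\<^sup>2) \<le> 0" unfolding complex_norm_square[symmetric] by (simp flip: of_real_mult)
  moreover have "2 * (t * (norm a)\<^sup>2) = 1 - n" using na by (simp add: t_def)
  ultimately show False by simp
qed

section \<open>First derivatives on orthogonal pairs\<close>

lemma cderiv_orthogonal:
  assumes O: "orthogonal_ball r s s' b \<rho> G"
    and "z \<in> ball b \<rho>" "w \<in> ball b \<rho>" "hform r s z w = 0" "hform r s u w = 0"
  shows "hform r s' (cderiv G z u) (G w) = 0"
proof -
  note G = orthogonal_ballD(2)[OF O] and orth = orthogonal_ballD(3)[OF O]
  have "((\<lambda>l. hform r s' (G (z + l *s u)) (G w)) has_field_derivative hform r s' (cderiv G z u) (G w)) (at 0)"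
    using hform_line_derivative[OF G, of z 0 u r s' "G w"] assms(2) by simp
  \<comment> \<open>The whole line stays orthogonal to \<open>w\<close>, so the function is locally
    zero.\<close>
  moreover have "((\<lambda>l. hform r s' (G (z + l *s u)) (G w)) has_field_derivative 0) (at 0)"
  proof (rule has_field_derivative_transform_within_open[of "\<lambda>_. 0" 0 0 "{l. z + l *s u \<in> ball b \<rho>}"])
    show "open {l. z + l *s u \<in> ball b \<rho>}" by (rule open_line_preimage) simp
    show "0 = hform r s' (G (z + l *s u)) (G w)" if "l \<in> {l. z + l *s u \<in> ball b \<rho>}" for l
      using orth[of "z + l *s u" w] that assms by (simp add: hform_linear)
  qed (use assms in auto)
  ultimately show ?thesis by (rule DERIV_unique)
qed

text \<open>\<open>cderiv_orthogonal\<close> kills the combination of \<open>x\<close> and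
  \<open>y\<close> that is orthogonal to \<open>w\<close>. So the pairing with
  \<open>cderiv G z x\<close> is \<open>hform r s x w\<close> times a factor depending only on
  \<open>z\<close> and \<open>w\<close> whenever some vector pairs nontrivially with
  \<open>w\<close>: the value of \<open>h(z, w)\<close>.\<close>

lemma cderiv_proportional:
  assumes O: "orthogonal_ball r s s' b \<rho> G"
    and "z \<in> ball b \<rho>" "w \<in> ball b \<rho>" "hform r s z w = 0"
  shows "hform r s' (cderiv G z x) (G w) * hform r s y w = hform r s' (cderiv G z y) (G w) * hform r s x w"
proof -
  note G = orthogonal_ballD(2)[OF O]
  define u where "u = (hform r s y w) *s x - (hform r s x w) *s y"
  have "hform r s u w = 0" by (simp add: u_def hform_linear)
  from cderiv_orthogonal[OF assms this] show ?thesis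
    by (simp add: u_def cderiv_diff[OF G assms(2)] holo_on_cderiv(2)[OF G assms(2)] hform_linear algebra_simps)
qed

lemma cderiv_proportional':
  assumes O: "orthogonal_ball r s s' b \<rho> G"
    and "z \<in> ball b \<rho>" "w \<in> ball b \<rho>" "hform r s z w = 0"
  shows "hform r s' (G w) (cderiv G z x) * hform r s w y = hform r s' (G w) (cderiv G z y) * hform r s w x"
  using arg_cong[OF cderiv_proportional[OF assms, of x y], of cnj] by (simp add: hform_cnj)

text \<open>Differentiate \<open>cderiv_proportional'\<close> in its point \<open>w\<close> at
  \<open>p\<close> in direction \<open>y\<close>; the other product rule terms vanish, by
  \<open>G0\<close> on the left and because of the factor \<open>l\<close> on the right. Thus
  \<open>cderiv G p\<close> multiplies the form on the complement of \<open>p\<close> by a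
  constant.\<close>

lemma cderiv_cderiv:
  assumes O: "orthogonal_ball r s s' b \<rho> G"
    and p: "p \<in> ball b \<rho>" "hform r s p p = 0" and xy: "hform r s x p = 0" "hform r s y p = 0"
  shows "hform r s' (cderiv G p y) (cderiv G p x) * hform r s p v = hform r s' (G p) (cderiv G p v) * hform r s y x"
proof -
  note G = orthogonal_ballD(2)[OF O]
  have px: "hform r s p x = 0" using xy hform_swap_zero by blast
  have py: "hform r s p y = 0" using xy hform_swap_zero by blast
  define L where "L = {l. p + l *s y \<in> ball b \<rho>}"
  have oL: "open L" unfolding L_def by (rule open_line_preimage) simp
  have eq: "hform r s' (G (p + l *s y)) (cderiv G p x) * hform r s (p + l *s y) v
      = hform r s' (G (p + l *s y)) (cderiv G p v) * (l * hform r s y x)" if "l \<in> L" for l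
    using cderiv_proportional'[OF O p(1), of "p + l *s y" x v] that p py px
    by (simp add: L_def hform_linear)
  have d: "((\<lambda>l. hform r s' (G (p + l *s y)) u) has_field_derivative hform r s' (cderiv G p y) u) (at 0)" for u
    using hform_line_derivative[OF G, of p 0 y r s' u] p by simp
  have G0: "hform r s' (G p) (cderiv G p x) = 0"
    using cderiv_orthogonal[OF O p(1) p(1) p(2) xy(1)] hform_swap_zero by blast
  have "((\<lambda>l. hform r s' (G (p + l *s y)) (cderiv G p x) * hform r s (p + l *s y) v) has_field_derivative
      hform r s' (cderiv G p y) (cderiv G p x) * hform r s p v) (at 0)"
    unfolding hform_add_left hform_scale_left
    by (rule derivative_eq_intros d refl | simp add: G0)+
  moreover have "((\<lambda>l. hform r s' (G (p + l *s y)) (cderiv G p x) * hform r s (p + l *s y) v) has_field_derivative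
      hform r s' (G p) (cderiv G p v) * hform r s y x) (at 0)"
  proof (rule has_field_derivative_transform_within_open[OF _ oL])
    show "((\<lambda>l. hform r s' (G (p + l *s y)) (cderiv G p v) * (l * hform r s y x)) has_field_derivative
      hform r s' (G p) (cderiv G p v) * hform r s y x) (at 0)"
      by (rule derivative_eq_intros d refl | simp)+
  qed (use eq p in \<open>auto simp: L_def\<close>)
  ultimately show ?thesis by (rule DERIV_unique)
qed

text \<open>On orthogonal pairs, \<open>conformal r s s' G v p w\<close> is the value of \<open>\<langle>G z, G w\<rangle> / \<langle>z, w\<rangle>\<close>
  extended to \<open>z = p\<close>.\<close>

definition conformal ::
  "nat \<Rightarrow> nat \<Rightarrow> nat \<Rightarrow> (complex^'n::{finite,linorder} \<Rightarrow> complex^'m::{finite,linorder})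
     \<Rightarrow> complex^'n::{finite,linorder} \<Rightarrow> complex^'n::{finite,linorder} \<Rightarrow> complex^'n::{finite,linorder} \<Rightarrow> complex" where
  "conformal r s s' G v p w = hform r s' (cderiv G p v) (G w) / hform r s v w"

text \<open>Besides orthogonality, these are the open conditions under which
  \<open>conformal\<close> can be divided by freely: its denominators stay away from 0, and
  positivity of its real part gives nonvanishing. They are reached by shrinking around a null point
  where \<open>hform r s v b = 1\<close> and \<open>conformal\<close> is positive.\<close>

definition rigid_ball ::
  "nat \<Rightarrow> nat \<Rightarrow> nat \<Rightarrow> complex^'n::{finite,linorder} \<Rightarrow> real
     \<Rightarrow> (complex^'n::{finite,linorder} \<Rightarrow> complex^'m::{finite,linorder}) \<Rightarrow> complex^'n::{finite,linorder} \<Rightarrow> bool" where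
  "rigid_ball r s s' b \<rho> G v \<longleftrightarrow> orthogonal_ball r s s' b \<rho> G
     \<and> (\<forall>y\<in>ball b \<rho>. 1/2 < Re (hform r s v y))
     \<and> (\<forall>p\<in>ball b \<rho>. \<forall>w\<in>ball b \<rho>. 0 < Re (conformal r s s' G v p w))"

lemma rigid_ballD:
  assumes "rigid_ball r s s' b \<rho> G v"
  shows "orthogonal_ball r s s' b \<rho> G"
    "\<And>y. y \<in> ball b \<rho> \<Longrightarrow> 1/2 < Re (hform r s v y)"
    "\<And>p w. p \<in> ball b \<rho> \<Longrightarrow> w \<in> ball b \<rho> \<Longrightarrow> 0 < Re (conformal r s s' G v p w)"
  using assms by (auto simp: rigid_ball_def)

lemma rigid_ball_v_nonzero:
  assumes "rigid_ball r s s' b \<rho> G v" "y \<in> ball b \<rho>"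
  shows "hform r s v y \<noteq> 0" "hform r s y v \<noteq> 0"
  using rigid_ballD(2)[OF assms] hform_swap_zero[of r s v y] by auto

lemma conformal_nonzero:
  "rigid_ball r s s' b \<rho> G v \<Longrightarrow> p \<in> ball b \<rho> \<Longrightarrow> w \<in> ball b \<rho> \<Longrightarrow> conformal r s s' G v p w \<noteq> 0"
  using rigid_ballD(3)[of r s s' b \<rho> G v p w] by auto

lemma cnj_conformal: "cnj (conformal r s s' G v p z) = hform r s' (G z) (cderiv G p v) / hform r s z v"
  by (simp add: conformal_def hform_cnj)

text \<open>Split off from \<open>G z\<close> and \<open>G w\<close> their parts along the
  derivative of \<open>G\<close> at \<open>p\<close>; these parts produce the right-hand side. The
  remainders \<open>N z\<close> and \<open>N w\<close> lie in a negative semidefinite space, and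
  \<open>N z\<close> is null when \<open>z\<close> is, hence orthogonal to \<open>N w\<close>.
  \<open>null_cone_identity\<close> then removes the assumption that \<open>z\<close> is
  null.\<close>

lemma null_point_rigidity:
  fixes b :: "complex^'n::{finite,linorder}" and G :: "complex^'n::{finite,linorder} \<Rightarrow> complex^'m::{finite,linorder}"
  assumes R: "rigid_ball r s s' b \<rho> G v" and dims: "2 \<le> r" "2 \<le> s" "r + s \<le> CARD('n)"
    and p: "p \<in> ball b \<rho>" "hform r s p p = 0"
    and z: "z \<in> ball b \<rho>" "hform r s z p = 0" and w: "w \<in> ball b \<rho>" "hform r s w p = 0"
  shows "hform r s' (G z) (G w) * conformal r s s' G v p p = cnj (conformal r s s' G v p z) * conformal r s s' G v p w * hform r s z w"
proof -
  note O = rigid_ballD(1)[OF R] and v = rigid_ballD(2)[OF R] and h_pos = rigid_ballD(3)[OF R]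
  note \<rho> = orthogonal_ballD(1)[OF O] and G = orthogonal_ballD(2)[OF O] and orth = orthogonal_ballD(3)[OF O]
  note v_nonzero = rigid_ball_v_nonzero[OF R]
  define T where "T = cderiv G p"
  define h where "h = conformal r s s' G v p p"
  define \<kappa> where "\<kappa> y = cnj (conformal r s s' G v p y)" for y
  have h: "0 < Re h" using h_pos[OF p(1) p(1)] by (simp add: h_def)
  then have h0: "h \<noteq> 0" by auto
  have f1: "hform r s' (G y) (T x) = \<kappa> y * hform r s y x" if "y \<in> ball b \<rho>" "hform r s y p = 0" for y x
  proof -
    have "hform r s p y = 0" using that hform_swap_zero by blast
    from cderiv_proportional'[OF O p(1) that(1) this, of x v] v_nonzero(2)[OF that(1)]
    show ?thesis by (simp add: \<kappa>_def cnj_conformal T_def field_simps)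
  qed
  have f1': "hform r s' (T x) (G y) = cnj (\<kappa> y) * hform r s x y" if "y \<in> ball b \<rho>" "hform r s y p = 0" for y x
    using arg_cong[OF f1[OF that, of x], of cnj] by (simp add: hform_cnj)
  have px: "hform r s p x = 0" if "hform r s x p = 0" for x using that hform_swap_zero by blast
  have f2: "hform r s' (G p) (T x) = 0" if "hform r s x p = 0" for x
    using f1[OF p, of x] px[OF that] by simp
  have h_cnj: "cnj h = \<kappa> p" by (simp add: h_def \<kappa>_def)
  have f3': "hform r s' (T y) (T x) = cnj h * hform r s y x" if "hform r s x p = 0" "hform r s y p = 0" for x y
  proof -
    have "hform r s' (T y) (T x) * hform r s p v = hform r s' (G p) (T v) * hform r s y x"
      unfolding T_def by (rule cderiv_cderiv[OF O p that])
    moreover have "hform r s' (G p) (T v) = cnj h * hform r s p v"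
      unfolding h_cnj by (rule f1[OF p])
    ultimately show ?thesis using v_nonzero(2)[OF p(1)] by simp
  qed
  obtain e where e: "hform r s e p = 0" "hform r s e e = 1"
    using null_point_frame[OF dims, of p] by metis
  \<comment> \<open>By \<open>f3'\<close> the number \<open>cnj h\<close> is the square of the
    vector \<open>T e\<close>, hence real.\<close>
  have h_real: "cnj h = h"
    using f3'[OF e(1) e(1)] e(2) hform_cnj[of r s' "T e" "T e"] by simp
  have f3: "hform r s' (T y) (T x) = h * hform r s y x" if "hform r s x p = 0" "hform r s y p = 0" for x y
    using f3'[OF that] h_real by simp
  have GpTv: "hform r s' (G p) (T v) \<noteq> 0"
    using f1[OF p, of v] h0 v_nonzero(2)[OF p(1)] by (simp add: h_cnj[symmetric])

  define S where "S = {y. hform r s' y (G p) = 0 \<and> (\<forall>x. hform r s x p = 0 \<longrightarrow> hform r s' y (T x) = 0)}"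
  have S_lin: "y' + c *s y \<in> S" if "y \<in> S" "y' \<in> S" for y y' c
    using that by (simp add: S_def hform_linear)
  \<comment> \<open>A positive \<open>y\<close> together with \<open>G p\<close> and the
    \<open>r - 1\<close> positive vectors \<open>T (x j)\<close> would give \<open>r + 1\<close>
    orthogonal vectors of nonnegative square. Only the null \<open>G p\<close> can carry a
    coefficient, so \<open>G p\<close> would be in the radical, against \<open>GpTv\<close>.\<close>
  have S_nonpos: "Re (hform r s' y y) \<le> 0" if y: "y \<in> S" for y
  proof (rule ccontr)
    assume pos: "\<not> Re (hform r s' y y) \<le> 0"
    have "r - 1 < r" "r \<le> CARD('n)" using dims by auto
    from ex_pos_orthonormal_family[OF this, of s p] obtain x :: "nat \<Rightarrow> complex^'n::{finite,linorder}" where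
      "\<forall>j<r - 1. (\<forall>i. \<not> idx i < r \<longrightarrow> x j $ i = 0) \<and> hform r s (x j) (x j) = 1 \<and> hform r s (x j) p = 0"
      and x2: "\<forall>i<r - 1. \<forall>j<r - 1. i \<noteq> j \<longrightarrow> hform r s (x i) (x j) = 0" by (elim exE conjE)
    then have x: "\<And>j. j < r - 1 \<Longrightarrow> hform r s (x j) (x j) = 1 \<and> hform r s (x j) p = 0"
        "\<And>i j. i < r - 1 \<Longrightarrow> j < r - 1 \<Longrightarrow> i \<noteq> j \<Longrightarrow> hform r s (x i) (x j) = 0" by simp_all
    \<comment> \<open>For \<open>j \<le> 1\<close> the truncated \<open>j - 2\<close> is 0, which is
      still below \<open>r - 1\<close>.\<close>
    define f where "f j = (if j = 0 then y else if j = 1 then G p else T (x (j - 2)))" for j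
    have GpGp: "hform r s' (G p) (G p) = 0" by (rule orth) (use p in auto)
    have Tx: "hform r s' (T (x i)) (T (x j)) = (if i = j then h else 0)" if "i < r - 1" "j < r - 1" for i j
      using f3[of "x j" "x i"] x(1)[OF that(1)] x(1)[OF that(2)] x(2)[OF that] by auto
    have yT: "hform r s' y (T (x i)) = 0" "hform r s' (T (x i)) y = 0"
      "hform r s' (G p) (T (x i)) = 0" "hform r s' (T (x i)) (G p) = 0" if "i < r - 1" for i
      using y x(1)[OF that] f2[of "x i"] hform_swap_zero[of r s' _ "T (x i)"] by (auto simp: S_def)
    have yG: "hform r s' y (G p) = 0" "hform r s' (G p) y = 0"
      using y hform_swap_zero[of r s' y] by (auto simp: S_def)
    have o: "hform r s' (f i) (f j) = 0" if "i \<le> r" "j \<le> r" "i \<noteq> j" for i j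
    proof -
      have "i - 2 < r - 1" "j - 2 < r - 1" using that dims by auto
      moreover have "i - 2 \<noteq> j - 2" if "i \<noteq> 0" "i \<noteq> 1" "j \<noteq> 0" "j \<noteq> 1" using that \<open>i \<noteq> j\<close> by auto
      ultimately show ?thesis using yT yG Tx[of "i - 2" "j - 2"] that(3) by (auto simp: f_def)
    qed
    have nn: "0 \<le> Re (hform r s' (f j) (f j))" if "j \<le> r" for j
    proof -
      have "j - 2 < r - 1" using that dims by auto
      then show ?thesis using Tx[of "j - 2" "j - 2"] GpGp h pos by (auto simp: f_def)
    qed
    have "\<exists>c. (\<exists>j\<le>r. c j \<noteq> 0) \<and> (\<forall>j\<le>r. c j \<noteq> 0 \<longrightarrow> hform r s' (f j) (f j) = 0)
        \<and> (\<forall>y. hform r s' (\<Sum>j\<le>r. c j *s f j) y = 0)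
        \<and> (\<forall>i. idx i < r + s' \<longrightarrow> (\<Sum>j\<le>r. c j *s f j) $ i = 0)"
      by (rule orthogonal_nonneg_family[of r s' f, OF o nn])
    then obtain c where c: "\<exists>j\<le>r. c j \<noteq> 0" "\<And>j. j \<le> r \<Longrightarrow> c j \<noteq> 0 \<Longrightarrow> hform r s' (f j) (f j) = 0"
        "\<And>y. hform r s' (\<Sum>j\<le>r. c j *s f j) y = 0" by blast
    have c0: "c j = 0" if "j \<le> r" "j \<noteq> 1" for j
    proof (rule ccontr)
      assume "c j \<noteq> 0"
      with c(2) that have "hform r s' (f j) (f j) = 0" by blast
      moreover have "j - 2 < r - 1" using that dims by auto
      ultimately show False using Tx[of "j - 2" "j - 2"] h0 pos that by (auto simp: f_def split: if_splits)
    qed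
    with c(1) have c1: "c 1 \<noteq> 0" by metis
    have "(\<Sum>j\<le>r. c j *s f j) = (\<Sum>j\<in>{1}. c j *s f j)"
      by (rule sum.mono_neutral_right) (use dims c0 in auto)
    then have "hform r s' (c 1 *s G p) (T v) = 0" using c(3)[of "T v"] by (simp add: f_def)
    then show False using c1 GpTv by (simp add: hform_scale_left)
  qed

  \<comment> \<open>By \<open>f1\<close> and \<open>f3\<close> the subtracted vector has the same
    pairings as \<open>G y\<close> with every \<open>T x\<close>, \<open>x\<close> orthogonal to
    \<open>p\<close>; so the difference falls into \<open>S\<close>.\<close>
  define N where "N y = G y - (\<kappa> y / h) *s T y" for y
  have NS: "N y \<in> S" if y: "y \<in> ball b \<rho>" "hform r s y p = 0" for y
  proof -
    have "hform r s' (G y) (G p) = 0" by (rule orth) (use y p in auto)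
    moreover have "hform r s' (T y) (G p) = 0" using f2[OF y(2)] hform_swap_zero by blast
    moreover have "hform r s' (N y) (T x) = 0" if x: "hform r s x p = 0" for x
      using f1[OF y, of x] f3[OF x y(2)] h0 x by (simp add: N_def hform_linear)
    ultimately show ?thesis by (simp add: S_def N_def hform_linear)
  qed
  have NN: "hform r s' (N y) (N y') = hform r s' (G y) (G y') - \<kappa> y * cnj (\<kappa> y') * hform r s y y' / h"
    if y: "y \<in> ball b \<rho>" "hform r s y p = 0" and y': "y' \<in> ball b \<rho>" "hform r s y' p = 0" for y y'
  proof -
    have "hform r s' (N y) (T y') = 0" using NS[OF y] y' by (simp add: S_def)
    then have "hform r s' (N y) (N y') = hform r s' (N y) (G y')"
      by (simp add: N_def[of y'] hform_linear)
    moreover have "hform r s' (N y) (G y') = hform r s' (G y) (G y') - \<kappa> y / h * hform r s' (T y) (G y')"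
      by (simp add: N_def hform_linear)
    ultimately show ?thesis using f1'[OF y', of y] by simp
  qed
  define f where "f y = hform r s' (G y) (G w) * h - \<kappa> y * cnj (\<kappa> w) * hform r s y w" for y
  have "f z = 0"
  proof (rule null_cone_identity[OF dims _ _ p z])
    fix a d
    define L where "L = {l. a + l *s d \<in> ball b \<rho>}"
    have "vhol L (\<lambda>l. a + l *s d)" by (rule vhol_line)
    moreover have "open L" unfolding L_def by (rule open_line_preimage) simp
    ultimately have "vhol L (\<lambda>l. G (a + l *s d))" by (rule vhol_comp[OF G]) (simp add: L_def)
    then have "(\<lambda>l. f (a + l *s d)) holomorphic_on L"
      unfolding f_def \<kappa>_def cnj_conformal
      by (intro holomorphic_intros holomorphic_hform_left vhol_line) (use v_nonzero in \<open>auto simp: L_def\<close>)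
    then show "(\<lambda>l. f (a + l *s d)) holomorphic_on {l. a + l *s d \<in> ball b \<rho>}" by (simp add: L_def)
  next
    fix y assume y: "y \<in> ball b \<rho>" "hform r s y p = 0" and yy: "hform r s y y = 0"
    have "hform r s' (G y) (G y) = 0" by (rule orth) (use y yy in auto)
    then have "hform r s' (N y) (N y) = 0" using NN[OF y y] yy by simp
    with nonpos_form_null_orthogonal[of r s' "N w" "N y"] S_nonpos[OF S_lin[OF NS[OF y] NS[OF w]]]
    have "hform r s' (N y) (N w) = 0" by blast
    then show "f y = 0" using NN[OF y w] h0 by (simp add: f_def field_simps)
  qed
  then show ?thesis by (simp add: f_def h_def \<kappa>_def)
qed

text \<open>Points of a null plane are null and mutually orthogonal, so here polarizing \<open>p\<close> to a pair
  \<open>p, q\<close> needs no correction as in \<open>polar_curve\<close>.\<close>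

lemma null_plane_rigidity:
  fixes b :: "complex^'n::{finite,linorder}" and G :: "complex^'n::{finite,linorder} \<Rightarrow> complex^'m::{finite,linorder}"
  assumes R: "rigid_ball r s s' b \<rho> G v" and dims: "2 \<le> r" "2 \<le> s" "r + s \<le> CARD('n)"
    and b: "hform r s b b = 0" "hform r s b x = 0" "hform r s x x = 0"
  obtains \<delta> where "0 < \<delta>" "\<And>c. norm c < \<delta> \<Longrightarrow> b + c *s x \<in> ball b \<rho>"
    "\<And>c c' z w. norm c < \<delta> \<Longrightarrow> norm c' < \<delta> \<Longrightarrow> z \<in> ball b (\<rho>/2) \<Longrightarrow> w \<in> ball b (\<rho>/2) \<Longrightarrow>
       hform r s z (b + c' *s x) = 0 \<Longrightarrow> hform r s w (b + c *s x) = 0 \<Longrightarrow>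
       hform r s' (G z) (G w) * conformal r s s' G v (b + c *s x) (b + c' *s x)
         = cnj (conformal r s s' G v (b + c' *s x) z) * conformal r s s' G v (b + c *s x) w * hform r s z w"
proof -
  note O = rigid_ballD(1)[OF R] and v = rigid_ballD(2)[OF R] and h_pos = rigid_ballD(3)[OF R]
  note \<rho> = orthogonal_ballD(1)[OF O] and G = orthogonal_ballD(2)[OF O] and orth = orthogonal_ballD(3)[OF O]
  note v_nonzero = rigid_ball_v_nonzero[OF R]
  have xb: "hform r s x b = 0" using b hform_swap_zero by blast
  \<comment> \<open>The first summand keeps the points \<open>P l\<close> of the null plane in the
    ball, the second the corrected points \<open>C y l\<close>, where a division by a number of norm
    at least 1/2 doubles the bound.\<close>
  define K where "K = 4 * norm x + 16 * ((norm b + \<rho>) * norm x * norm v) + 1"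
  have nn: "0 \<le> (norm b + \<rho>) * norm x * norm v" using \<rho> by (intro mult_nonneg_nonneg) auto
  then have K: "1 \<le> K" "4 * norm x \<le> K" "8 * ((norm b + \<rho>) * norm x * norm v) < K"
    using norm_ge_zero[of x] unfolding K_def by linarith+
  define \<delta> where "\<delta> = \<rho> / (2 * K)"
  have \<delta>: "0 < \<delta>" "\<delta> * K = \<rho> / 2" using \<rho> K by (auto simp: \<delta>_def)
  have \<delta>1: "4 * \<delta> * norm x < \<rho>" 
  proof -
    have "\<delta> * (4 * norm x) \<le> \<delta> * K" using \<delta>(1) K(2) by (intro mult_left_mono) auto
    then show ?thesis using \<delta>(2) \<rho> by simp
  qed
  have \<delta>2: "8 * \<delta> * (norm b + \<rho>) * norm x * norm v < \<rho> / 2"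
  proof -
    have "\<delta> * (8 * ((norm b + \<rho>) * norm x * norm v)) < \<delta> * K"
      using \<delta>(1) K(3) by (intro mult_strict_left_mono) auto
    moreover have "8 * \<delta> * (norm b + \<rho>) * norm x * norm v = \<delta> * (8 * ((norm b + \<rho>) * norm x * norm v))"
      by (simp only: mult_ac)
    ultimately show ?thesis using \<delta>(2) by linarith
  qed
  show ?thesis
  proof (rule that[OF \<delta>(1)])
    show in_ball: "b + c *s x \<in> ball b \<rho>" if "norm c < \<delta>" for c
    proof -
      have "norm (c *s x) \<le> 4 * \<delta> * norm x" unfolding norm_smult using that \<delta>(1) by (intro mult_right_mono) auto
      then show ?thesis using \<delta>1 by (simp add: dist_norm)
    qed
    fix c c' z w
    assume c: "norm c < \<delta>" "norm c' < \<delta>" and z: "z \<in> ball b (\<rho>/2)" and w: "w \<in> ball b (\<rho>/2)"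
      and zq: "hform r s z (b + c' *s x) = 0" and wp: "hform r s w (b + c *s x) = 0"
    \<comment> \<open>\<open>\<gamma> + l * \<kappa>\<close> is the affine function of
      \<open>l\<close> with value \<open>c\<close> at \<open>\<i>\<close> and \<open>c'\<close> at
      \<open>- \<i>\<close>.\<close>
    define \<gamma> where "\<gamma> = (c + c') / 2"
    define \<kappa> where "\<kappa> = (c - c') / (2 * \<i>)"
    have cc: "\<gamma> + \<i> * \<kappa> = c" "\<gamma> - \<i> * \<kappa> = c'" by (simp_all add: \<gamma>_def \<kappa>_def field_simps)
    have n\<gamma>: "norm \<gamma> < \<delta>" using norm_triangle_ineq[of c c'] c by (simp add: \<gamma>_def norm_divide)
    have n\<kappa>: "norm \<kappa> < \<delta>" using norm_triangle_ineq4[of c c'] c by (simp add: \<kappa>_def norm_divide norm_mult)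
    define m where "m l = \<gamma> + l * \<kappa>" for l
    have m: "norm (m l) < 3 * \<delta>" if "norm l < 2" for l
    proof -
      have "norm (m l) \<le> norm \<gamma> + norm l * norm \<kappa>"
        using norm_triangle_ineq[of \<gamma> "l * \<kappa>"] by (simp add: m_def norm_mult)
      also have "norm l * norm \<kappa> \<le> 2 * \<delta>" using that n\<kappa> by (intro mult_mono) auto
      finally show ?thesis using n\<gamma> by linarith
    qed
    define P where "P l = b + m l *s x" for l
    have PP: "hform r s (P l) (P l') = 0" for l l' using b xb by (simp add: P_def hform_linear)
    have Pi: "P \<i> = b + c *s x" "P (- \<i>) = b + c' *s x" by (simp_all add: P_def m_def cc)
    have PW: "P l \<in> ball b \<rho>" if "norm l < 2" for l
    proof -
      have "norm (m l *s x) \<le> 4 * \<delta> * norm x"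
        unfolding norm_smult using m[OF that] \<delta> by (intro mult_right_mono) auto
      then show ?thesis using \<delta>1 by (simp add: P_def dist_norm)
    qed
    \<comment> \<open>Moves \<open>y\<close> along \<open>v\<close> until it is orthogonal to
      \<open>P (cnj l)\<close>, as \<open>null_point_rigidity\<close> requires at real
      \<open>l\<close>. Nothing moves where orthogonality already holds: \<open>z\<close> at
      \<open>l = \<i>\<close> and \<open>w\<close> at \<open>l = - \<i>\<close>.\<close>
    define C where "C y l = y - (hform r s y (P (cnj l)) / hform r s v (P (cnj l))) *s v" for y l
    have CW: "C y l \<in> ball b \<rho>" if y: "y \<in> ball b (\<rho>/2)" "hform r s y (b + c0 *s x) = 0" "norm c0 < \<delta>" and l: "norm l < 2"
      for y l c0
    proof -
      have "hform r s y (P (cnj l)) = hform r s y (P (cnj l) - (b + c0 *s x))"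
        using y(2) by (simp add: hform_diff_right)
      also have "P (cnj l) - (b + c0 *s x) = (m (cnj l) - c0) *s x"
        by (simp add: P_def vec_eq_iff algebra_simps)
      finally have "hform r s y (P (cnj l)) = hform r s y ((m (cnj l) - c0) *s x)" .
      then have "norm (hform r s y (P (cnj l))) \<le> norm y * (norm (m (cnj l) - c0) * norm x)"
        by (simp only: norm_hform_le[of r s y "(m (cnj l) - c0) *s x", unfolded norm_smult])
      also have "\<dots> \<le> (norm b + \<rho>) * ((4 * \<delta>) * norm x)"
      proof (intro mult_mono)
        show "norm y \<le> norm b + \<rho>" using norm_triangle_ineq[of b "y - b"] y(1) \<rho>
          by (simp add: dist_norm norm_minus_commute)
        show "norm (m (cnj l) - c0) \<le> 4 * \<delta>" using norm_triangle_ineq4[of "m (cnj l)" c0] m[of "cnj l"] l y(3) by simp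
      qed (use \<rho> \<delta> in auto)
      finally have n1: "norm (hform r s y (P (cnj l))) \<le> (norm b + \<rho>) * ((4 * \<delta>) * norm x)" .
      have n2: "1/2 \<le> norm (hform r s v (P (cnj l)))"
        using v[OF PW[of "cnj l"]] l complex_Re_le_cmod[of "hform r s v (P (cnj l))"] by simp
      have "norm (hform r s y (P (cnj l)) / hform r s v (P (cnj l))) \<le> (norm b + \<rho>) * ((4 * \<delta>) * norm x) / (1/2)"
        unfolding norm_divide using n1 n2 order_trans[OF norm_ge_zero n1] by (intro frac_le) auto
      then have "norm ((hform r s y (P (cnj l)) / hform r s v (P (cnj l))) *s v)
          \<le> (norm b + \<rho>) * ((4 * \<delta>) * norm x) / (1/2) * norm v"
        unfolding norm_smult by (rule mult_right_mono) simp
      also have "\<dots> < \<rho> / 2" using \<delta>2 by (simp add: mult_ac)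
      finally have "norm (C y l - y) < \<rho> / 2" by (simp add: C_def)
      then show ?thesis using y(1) dist_triangle[of b "C y l" y] by (simp add: dist_norm norm_minus_commute)
    qed
    have CzW: "C z l \<in> ball b \<rho>" if "norm l < 2" for l by (rule CW[OF z zq c(2) that])
    have CwW: "C w l \<in> ball b \<rho>" if "norm l < 2" for l by (rule CW[OF w wp c(1) that])
    have PvW: "hform r s v (P l) \<noteq> 0" if "norm l < 2" for l using v_nonzero(1)[OF PW[OF that]] .
    have CP: "hform r s (C y l) (P (cnj l)) = 0" if "norm l < 2" for y l
      using PvW[of "cnj l"] that by (simp add: C_def hform_linear)
    let ?D = "ball (0::complex) 2"
    have D: "open ?D" "\<And>l. l \<in> ?D \<Longrightarrow> cnj l \<in> ?D" by auto
    have hP: "vhol ?D P" unfolding P_def m_def by (intro vhol_intros holomorphic_intros)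
    have hC: "vhol ?D (C y)" for y
      unfolding C_def
      by (intro vhol_intros holomorphic_intros holomorphic_hform_right hP D) (use PvW in auto)
    have hGP: "vhol ?D (\<lambda>l. G (P l))" by (rule vhol_comp[OF G hP]) (use PW in auto)
    have hTP: "vhol ?D (\<lambda>l. cderiv G (P l) v)" by (rule vhol_cderiv[OF G \<rho> hP]) (use PW in auto)
    have hGz: "vhol ?D (\<lambda>l. G (C z l))" by (rule vhol_comp[OF G hC]) (use CzW in auto)
    have hGw: "vhol ?D (\<lambda>l. G (C w l))" by (rule vhol_comp[OF G hC]) (use CwW in auto)
    \<comment> \<open>The difference of the two sides, with all second slots at
      \<open>cnj l\<close>, hence holomorphic in \<open>l\<close>.\<close>
    define F where "F l = hform r s' (G (C z l)) (G (C w (cnj l)))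
        * (hform r s' (cderiv G (P l) v) (G (P (cnj l))) / hform r s v (P (cnj l)))
      - hform r s' (G (C z l)) (cderiv G (P (cnj l)) v) / hform r s (C z l) v
        * (hform r s' (cderiv G (P l) v) (G (C w (cnj l))) / hform r s v (C w (cnj l)))
        * hform r s (C z l) (C w (cnj l))" for l
    have "F \<i> = 0"
    proof (rule holomorphic_zero_on_reals[of F ?D 0])
      show "F holomorphic_on ?D"
        unfolding F_def
        by (intro holomorphic_intros holomorphic_hform[OF hGz hGw D] holomorphic_hform[OF hTP hGP D]
            holomorphic_hform[OF hGz hTP D] holomorphic_hform[OF hTP hGw D] holomorphic_hform[OF hC hC D]
            holomorphic_hform_right[OF hP D] holomorphic_hform_right[OF hC D] holomorphic_hform_left[OF hC])
           (use PvW v_nonzero CzW CwW in auto)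
      fix t :: real assume t: "of_real t \<in> ?D"
      have "hform r s' (G (C z t)) (G (C w t)) * conformal r s s' G v (P t) (P t)
          = cnj (conformal r s s' G v (P t) (C z t)) * conformal r s s' G v (P t) (C w t) * hform r s (C z t) (C w t)"
        by (rule null_point_rigidity[OF R dims]) (use PW CzW CwW PP CP[of "of_real t"] t in auto)
      then show "F (of_real t) = 0" by (simp add: F_def conformal_def hform_cnj)
    qed auto
    moreover have "C z \<i> = z" "C w (- \<i>) = w" using zq wp by (simp_all add: C_def Pi)
    ultimately show "hform r s' (G z) (G w) * conformal r s s' G v (b + c *s x) (b + c' *s x)
         = cnj (conformal r s s' G v (b + c' *s x) z) * conformal r s s' G v (b + c *s x) w * hform r s z w"
      by (simp add: F_def Pi conformal_def hform_cnj)
  qed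
qed

text \<open>\<open>u z\<close> is the point of the null line through \<open>b\<close> in direction \<open>x'\<close> that is orthogonal to \<open>z\<close>;
  orthogonality of \<open>u z\<close> and \<open>u w\<close> is automatic, so the rank one property of \<open>conformal\<close> on the null
  plane propagates to an open set.\<close>

lemma rank_one:
  fixes b :: "complex^'n::{finite,linorder}" and G :: "complex^'n::{finite,linorder} \<Rightarrow> complex^'m::{finite,linorder}"
  assumes R: "rigid_ball r s s' b \<rho> G v" and dims: "2 \<le> r" "2 \<le> s" "r + s \<le> CARD('n)"
    and b: "hform r s b b = 0" and conf: "Im (conformal r s s' G v b b) = 0"
  obtains \<Omega> \<Psi> where "open \<Omega>" "\<Omega> \<noteq> {}" "\<Omega> \<subseteq> ball b \<rho>" "\<And>z. z \<in> \<Omega> \<Longrightarrow> \<Psi> z \<noteq> (0::complex)"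
    "\<And>z. z \<in> \<Omega> \<Longrightarrow> hform r s z b \<noteq> 0"
    "\<And>z w. z \<in> \<Omega> \<Longrightarrow> w \<in> \<Omega> \<Longrightarrow> hform r s' (G z) (G w) = \<Psi> z * cnj (\<Psi> w) * hform r s z w"
proof -
  note O = rigid_ballD(1)[OF R] and v = rigid_ballD(2)[OF R] and h_pos = rigid_ballD(3)[OF R]
  note \<rho> = orthogonal_ballD(1)[OF O] and G = orthogonal_ballD(2)[OF O] and orth = orthogonal_ballD(3)[OF O]
  note v_nonzero = rigid_ball_v_nonzero[OF R]
  obtain e f where e: "hform r s e b = 0" "hform r s f b = 0" "hform r s e e = 1"
    "hform r s f f = - 1" "hform r s e f = 0" using null_point_frame[OF dims, of b] by metis
  have e': "hform r s f e = 0" "hform r s b e = 0" "hform r s b f = 0" using e hform_swap_zero by blast+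
  define x where "x = e - f"
  define y where "y = e + f"
  have bx: "hform r s b x = 0" "hform r s x b = 0" "hform r s b y = 0" "hform r s y b = 0"
    using e e' by (simp_all add: x_def y_def hform_linear)
  have xx: "hform r s x x = 0" "hform r s x y = 2" "hform r s y x = 2"
    using e e' by (simp_all add: x_def y_def hform_linear)
  obtain \<delta> where \<delta>: "0 < \<delta>" and in_ball: "\<And>c. norm c < \<delta> \<Longrightarrow> b + c *s x \<in> ball b \<rho>"
    and rig: "\<And>c c' z w. norm c < \<delta> \<Longrightarrow> norm c' < \<delta> \<Longrightarrow> z \<in> ball b (\<rho>/2) \<Longrightarrow> w \<in> ball b (\<rho>/2) \<Longrightarrow>
       hform r s z (b + c' *s x) = 0 \<Longrightarrow> hform r s w (b + c *s x) = 0 \<Longrightarrow>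
       hform r s' (G z) (G w) * conformal r s s' G v (b + c *s x) (b + c' *s x)
         = cnj (conformal r s s' G v (b + c' *s x) z) * conformal r s s' G v (b + c *s x) w * hform r s z w"
    using null_plane_rigidity[OF R dims b bx(1) xx(1)] by blast
  define \<beta> where "\<beta> = Re (conformal r s s' G v b b)"
  have bW: "b \<in> ball b \<rho>" "b \<in> ball b (\<rho>/2)" using \<rho> by auto
  have \<beta>: "conformal r s s' G v b b = of_real \<beta>" "0 < \<beta>"
    using conf h_pos[OF bW(1) bW(1)] by (auto simp: \<beta>_def complex_eq_iff)
  \<comment> \<open>The norm inequality amounts to \<open>norm (k z) < \<delta>\<close>; a nonzero
    pairing with \<open>b\<close> provides a factor that is cancelled later.\<close>
  define \<Omega> where "\<Omega> = {z \<in> ball b (\<rho>/2). hform r s z b \<noteq> 0 \<and> norm (hform r s z b) < \<delta> * norm (hform r s z x)}"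
  define k where "k z = - cnj (hform r s z b) / cnj (hform r s z x)" for z
  define u where "u z = b + k z *s x" for z
  have k: "norm (k z) < \<delta>" "hform r s z (u z) = 0" if "z \<in> \<Omega>" for z
  proof -
    have z: "hform r s z x \<noteq> 0" using that \<delta> by (auto simp: \<Omega>_def)
    then show "norm (k z) < \<delta>" using that by (simp add: \<Omega>_def k_def norm_divide pos_divide_less_eq)
    show "hform r s z (u z) = 0" using z by (simp add: u_def k_def hform_linear)
  qed
  have \<Omega>: "\<Omega> \<subseteq> ball b (\<rho>/2)" "\<Omega> \<subseteq> ball b \<rho>" using \<rho> by (auto simp: \<Omega>_def)
  have uW: "u z \<in> ball b \<rho>" if "z \<in> \<Omega>" for z using in_ball[OF k(1)[OF that]] by (simp add: u_def)
  \<comment> \<open>For \<open>p = u w\<close> and \<open>q = u z\<close> the rules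
    \<open>h(z, w) h(p, q) = h(z, q) h(p, w)\<close> and
    \<open>h(p, q) h(b, b) = h(p, b) h(b, q)\<close> give \<open>h(z, w)\<close> as
    \<open>h(b, b)\<close> times \<open>h(z, q) / h(b, q)\<close> times
    \<open>h(p, w) / h(p, b)\<close>. The first quotient depends on \<open>z\<close> only, the
    second on \<open>w\<close> only.\<close>
  define \<Psi> where "\<Psi> z = sqrt \<beta> * cnj (conformal r s s' G v (u z) z / conformal r s s' G v (u z) b)" for z
  show ?thesis
  proof (rule that[of \<Omega> \<Psi>])
    have c: "continuous_on UNIV (\<lambda>z. hform r s z a)" for a
      unfolding hform_sgnc by (intro continuous_intros)
    have "\<Omega> = ball b (\<rho>/2) \<inter> {z. hform r s z b \<noteq> 0} \<inter> {z. norm (hform r s z b) < \<delta> * norm (hform r s z x)}"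
      by (auto simp: \<Omega>_def)
    also have "open \<dots>"
      by (intro open_Int open_ball open_Collect_less open_Collect_neq continuous_intros c)
    finally show "open \<Omega>" .
    show "\<Omega> \<subseteq> ball b \<rho>" by fact
    show "hform r s z b \<noteq> 0" if "z \<in> \<Omega>" for z using that by (simp add: \<Omega>_def)
    show "\<Psi> z \<noteq> 0" if "z \<in> \<Omega>" for z
      using \<beta> conformal_nonzero[OF R uW[OF that]] \<Omega> bW that by (auto simp: \<Psi>_def)
    show "\<Omega> \<noteq> {}"
    proof -
      \<comment> \<open>The test point will be \<open>b + \<eta> (t v + y)\<close>: its pairing with
        \<open>b\<close> has order \<open>\<eta> t\<close>, that with \<open>x\<close> is close to
        \<open>2 \<eta>\<close>, so a small \<open>t\<close> leads into
        \<open>\<Omega>\<close>.\<close>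
      define t where "t = \<delta> / (norm (hform r s v b) + \<delta> * norm (hform r s v x) + 1)"
      have den: "1 \<le> norm (hform r s v b) + \<delta> * norm (hform r s v x) + 1" using \<delta> by simp
      then have t: "0 < t" unfolding t_def using \<delta> by (intro divide_pos_pos) linarith+
      have t2: "t * norm (hform r s v b) + t * \<delta> * norm (hform r s v x) < 2 * \<delta>"
      proof -
        have "t * (norm (hform r s v b) + \<delta> * norm (hform r s v x) + 1) = \<delta>" using den by (simp add: t_def)
        then have "t * norm (hform r s v b) + t * \<delta> * norm (hform r s v x) = \<delta> - t" by (simp add: algebra_simps)
        then show ?thesis using t \<delta> by linarith
      qed
      define d where "d = of_real t *s v + y"
      define \<eta> where "\<eta> = (\<rho>/2) / (norm d + 1)"
      have nd: "0 < norm d + 1" using norm_ge_zero[of d] by linarith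
      have \<eta>: "0 < \<eta>" "\<eta> * norm d < \<rho> / 2"
      proof -
        show "0 < \<eta>" using \<rho> nd by (simp add: \<eta>_def)
        have "norm d + 1 \<noteq> 0" using nd by linarith
        from nonzero_eq_divide_eq[OF this, of \<eta> "\<rho>/2"] have "\<eta> * (norm d + 1) = \<rho> / 2"
          unfolding \<eta>_def by blast
        then show "\<eta> * norm d < \<rho> / 2" using \<open>0 < \<eta>\<close> by (simp add: algebra_simps)
      qed
      define z where "z = b + of_real \<eta> *s d"
      have zb: "hform r s z b = of_real (\<eta> * t) * hform r s v b"
        using b bx by (simp add: z_def d_def hform_linear algebra_simps)
      have zx: "hform r s z x = of_real \<eta> * (of_real t * hform r s v x + 2)"
        using bx xx by (simp add: z_def d_def hform_linear algebra_simps)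
      have "2 - t * norm (hform r s v x) \<le> norm (of_real t * hform r s v x + 2)"
        using norm_triangle_ineq4[of "of_real t * hform r s v x + 2" "of_real t * hform r s v x"] t by (simp add: norm_mult)
      then have "\<delta> * (2 - t * norm (hform r s v x)) \<le> \<delta> * norm (of_real t * hform r s v x + 2)"
        using \<delta> by (intro mult_left_mono) auto
      with t2 have "t * norm (hform r s v b) < \<delta> * norm (of_real t * hform r s v x + 2)"
        by (simp add: algebra_simps)
      then have "\<eta> * (t * norm (hform r s v b)) < \<eta> * (\<delta> * norm (of_real t * hform r s v x + 2))"
        using \<eta> by simp
      then have "norm (hform r s z b) < \<delta> * norm (hform r s z x)"
      proof -
        have "norm (hform r s z b) = \<eta> * (t * norm (hform r s v b))"
          using \<eta> t by (simp add: zb norm_mult)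
        moreover have "norm (hform r s z x) = \<eta> * norm (of_real t * hform r s v x + 2)"
          unfolding zx norm_mult using \<eta> by simp
        ultimately show ?thesis
          using \<open>\<eta> * (t * norm (hform r s v b)) < \<eta> * (\<delta> * norm (of_real t * hform r s v x + 2))\<close>
          by (simp only: mult.left_commute)
      qed
      moreover have "z \<in> ball b (\<rho>/2)" using \<eta> by (simp add: z_def dist_norm norm_smult)
      moreover have "hform r s z b \<noteq> 0" unfolding zb using \<eta> t v_nonzero[OF bW(1)] by simp
      ultimately show ?thesis by (auto simp: \<Omega>_def)
    qed
    fix z w assume z: "z \<in> \<Omega>" and w: "w \<in> \<Omega>"
    let ?p = "u w" and ?q = "u z"
    have zw: "z \<in> ball b (\<rho>/2)" "w \<in> ball b (\<rho>/2)" "w \<in> ball b \<rho>" using z w \<Omega> by auto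
    have bq: "hform r s b ?q = 0" "hform r s b b = 0" using b bx by (simp_all add: u_def hform_linear)
    have R1: "hform r s' (G z) (G w) * conformal r s s' G v ?p ?q = cnj (conformal r s s' G v ?q z) * conformal r s s' G v ?p w * hform r s z w"
      using rig[OF k(1)[OF w] k(1)[OF z] zw(1,2)] k(2)[OF z] k(2)[OF w] by (simp add: u_def)
    \<comment> \<open>\<open>R2\<close> and \<open>R3\<close> evaluate the pairing of
      \<open>G b\<close> with \<open>G w\<close> using the second null point \<open>u z\<close> and
      \<open>b\<close> respectively; their comparison yields \<open>pq\<close>.\<close>
    have R2: "hform r s' (G b) (G w) * conformal r s s' G v ?p ?q = cnj (conformal r s s' G v ?q b) * conformal r s s' G v ?p w * hform r s b w"
      using rig[OF k(1)[OF w] k(1)[OF z] bW(2) zw(2)] k(2)[OF w] bq by (simp add: u_def)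
    have R3: "hform r s' (G b) (G w) * conformal r s s' G v ?p b = cnj (conformal r s s' G v b b) * conformal r s s' G v ?p w * hform r s b w"
      using rig[OF k(1)[OF w] _ bW(2) zw(2), of 0] k(2)[OF w] bq \<delta> by (simp add: u_def)
    have nz: "conformal r s s' G v ?p w \<noteq> 0" "conformal r s s' G v ?p b \<noteq> 0" "conformal r s s' G v ?q b \<noteq> 0" "hform r s b w \<noteq> 0"
      using conformal_nonzero[OF R] uW z w zw bW hform_swap_zero[of r s b w] by (auto simp: \<Omega>_def)
    have "cnj (conformal r s s' G v b b) \<noteq> 0" using \<beta> by simp
    then have X: "hform r s' (G b) (G w) \<noteq> 0" using R3 nz by auto
    have "hform r s' (G b) (G w) * (conformal r s s' G v ?p ?q * cnj (conformal r s s' G v b b))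
        = hform r s' (G b) (G w) * (conformal r s s' G v ?p b * cnj (conformal r s s' G v ?q b))"
    proof -
      have "hform r s' (G b) (G w) * conformal r s s' G v ?p ?q * cnj (conformal r s s' G v b b)
          = cnj (conformal r s s' G v ?q b) * (cnj (conformal r s s' G v b b) * conformal r s s' G v ?p w * hform r s b w)"
        unfolding R2 by (simp only: mult_ac)
      then show ?thesis unfolding R3[symmetric] by (simp only: mult_ac)
    qed
    with X have pq: "conformal r s s' G v ?p ?q * of_real \<beta> = conformal r s s' G v ?p b * cnj (conformal r s s' G v ?q b)" by (simp add: \<beta>)
    have "hform r s' (G z) (G w) * (conformal r s s' G v ?p b * cnj (conformal r s s' G v ?q b))
        = of_real \<beta> * (cnj (conformal r s s' G v ?q z) * conformal r s s' G v ?p w) * hform r s z w"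
      using R1 unfolding pq[symmetric] by (simp add: mult_ac)
    moreover have "complex_of_real (sqrt \<beta>) * of_real (sqrt \<beta>) = of_real \<beta>"
      using \<beta> by (simp flip: of_real_mult)
    ultimately show "hform r s' (G z) (G w) = \<Psi> z * cnj (\<Psi> w) * hform r s z w"
      using nz by (simp add: \<Psi>_def field_simps)
  qed
qed

section \<open>A boundary point lemma\<close>

text \<open>For \<open>n \<ge> 2\<close> the directions \<open>\<theta>\<close> and
  \<open>\<theta> + pi / n\<close> can both point into the right half-plane although their
  \<open>n\<close>-th powers are opposite, so \<open>Re (c * u ^ n)\<close> would vanish on a whole
  sector.\<close>

lemma Re_power_pos_imp:
  fixes c :: complex
  assumes c: "c \<noteq> 0" and n: "0 < n" and pos: "\<And>u. 0 < Re u \<Longrightarrow> 0 \<le> Re (c * u ^ n)"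
  shows "n = 1" "Im c = 0" "0 < Re c"
proof -
  show n1: "n = 1"
  proof (rule ccontr)
    assume "n \<noteq> 1"
    with n have n2: "2 \<le> n" by simp
    have rot: "Re (c * cis \<theta> ^ n) = 0" if \<theta>: "- pi / 2 < \<theta>" "\<theta> < 0" for \<theta>
    proof -
      have "0 < pi / n" using n by simp
      moreover have "pi / n \<le> pi / 2" by (rule divide_left_mono) (use n2 in auto)
      ultimately have pn: "0 < pi / n" "pi / n \<le> pi / 2" .
      have "0 \<le> Re (c * cis \<theta> ^ n)" using \<theta> by (intro pos) (auto intro: cos_gt_zero_pi)
      moreover have "0 \<le> Re (c * cis (\<theta> + pi / n) ^ n)"
        using \<theta> pn by (intro pos) (auto intro!: cos_gt_zero_pi)
      moreover have "cis (\<theta> + pi / n) ^ n = - (cis \<theta> ^ n)"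
      proof -
        have eq: "real n * (\<theta> + pi / n) = real n * \<theta> + pi" using n by (simp add: field_simps)
        have "cis (\<theta> + pi / n) ^ n = cis (real n * \<theta>) * cis pi"
          using Complex.DeMoivre[of "\<theta> + pi / n" n] unfolding eq cis_mult .
        then show ?thesis by (simp add: Complex.DeMoivre)
      qed
      ultimately show ?thesis by simp
    qed
    \<comment> \<open>A second direction of the sector, turned by \<open>pi / (2 * n)\<close>, so
      that its \<open>n\<close>-th power differs from that of \<open>- pi / 8\<close> by
      \<open>- \<i>\<close>. Together they kill both the real and the imaginary part.\<close>
    define \<theta>2 where "\<theta>2 = - pi / 8 + - (pi / (2 * n))"
    have "pi / (2 * n) \<le> pi / 4" by (rule divide_left_mono) (use n2 in auto)
    moreover have "0 < pi / (2 * n)" using n by simp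
    ultimately have \<theta>2: "- pi / 2 < \<theta>2" "\<theta>2 < 0" using pi_gt_zero unfolding \<theta>2_def by linarith+
    have "real n * \<theta>2 = real n * (- pi / 8) + - (pi / 2)" using n by (simp add: \<theta>2_def field_simps)
    then have "cis \<theta>2 ^ n = cis (real n * (- pi / 8)) * cis (- (pi / 2))"
      by (simp only: Complex.DeMoivre cis_mult)
    then have "cis \<theta>2 ^ n = - \<i> * cis (- pi / 8) ^ n" by (simp add: Complex.DeMoivre complex_eq_iff)
    then have "Re (c * (- \<i> * cis (- pi / 8) ^ n)) = 0" using rot[OF \<theta>2] by simp
    moreover have "c * (- \<i> * cis (- pi / 8) ^ n) = - \<i> * (c * cis (- pi / 8) ^ n)" by simp
    ultimately have "Im (c * cis (- pi / 8) ^ n) = 0" by simp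
    moreover have "Re (c * cis (- pi / 8) ^ n) = 0" by (rule rot) auto
    ultimately have "c * cis (- pi / 8) ^ n = 0" by (simp only: complex_eq_iff) simp
    then show False using c by simp
  qed
  \<comment> \<open>Testing the points \<open>1 + m * \<i>\<close> for all real \<open>m\<close>
    excludes an imaginary part.\<close>
  have *: "0 \<le> Re c - m * Im c" for m using pos[of "Complex 1 m"] n1 by (simp add: mult.commute)
  show Im: "Im c = 0"
  proof (rule ccontr)
    assume "Im c \<noteq> 0"
    then show False using *[of "(Re c + 1) / Im c"] by simp
  qed
  show "0 < Re c" using *[of 0] Im c by (auto simp: complex_eq_iff less_le)
qed

text \<open>Near 0, \<open>f w = w ^ n * g w\<close> with \<open>g 0\<close> nonzero. Passing to the
  limit along rays in the half-plane gives \<open>0 \<le> Re (g 0 * u ^ n)\<close>, so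
  \<open>n = 1\<close> and the derivative \<open>g 0\<close> is a positive real.\<close>

lemma half_plane_hopf:
  assumes f: "f holomorphic_on ball 0 d" and d: "0 < d" and f0: "f 0 = 0"
    and pos: "\<And>t. t \<in> ball 0 d \<Longrightarrow> 0 < Re t \<Longrightarrow> 0 < Re (f t)"
    and der: "(f has_field_derivative f') (at 0)"
  shows "Im f' = 0" "0 < Re f'"
proof -
  have nc: "\<not> f constant_on ball 0 d"
  proof
    assume "f constant_on ball 0 d"
    then have "f (of_real (d/2)) = f 0" using d by (auto simp: constant_on_def)
    then show False using pos[of "of_real (d/2)"] d f0 by simp
  qed
  have in0: "0 \<in> ball 0 d" using d by simp
  obtain g e n where g: "0 < n" "0 < e" "ball (0::complex) e \<subseteq> ball 0 d" "g holomorphic_on ball 0 e"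
    "\<And>w. w \<in> ball 0 e \<Longrightarrow> f w = (w - 0) ^ n * g w" "\<And>w. w \<in> ball 0 e \<Longrightarrow> g w \<noteq> 0"
    by (rule holomorphic_factor_zero_nonconstant[OF f open_ball connected_ball in0 f0 nc], rule that)
  have gcont: "isCont g 0"
    using g(2,4) by (meson centre_in_ball continuous_on_eq_continuous_at holomorphic_on_imp_continuous_on open_ball)
  have nonneg: "0 \<le> Re (g 0 * u ^ n)" if u: "0 < Re u" for u
  proof -
    have u0: "u \<noteq> 0" using u by auto
    have "((\<lambda>t. g (of_real t * u) * u ^ n) \<longlongrightarrow> g (of_real 0 * u) * u ^ n) (at_right 0)"
    proof (intro tendsto_intros)
      show "((\<lambda>t. g (of_real t * u)) \<longlongrightarrow> g (of_real 0 * u)) (at_right 0)"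
        by (rule isCont_tendsto_compose) (auto intro!: tendsto_eq_intros gcont)
    qed
    then have "((\<lambda>t. g (of_real t * u) * u ^ n) \<longlongrightarrow> g 0 * u ^ n) (at_right 0)" by simp
    from tendsto_Re[OF this]
    have "((\<lambda>t. Re (g (of_real t * u) * u ^ n)) \<longlongrightarrow> Re (g 0 * u ^ n)) (at_right 0)" .
    moreover have "\<forall>\<^sub>F t in at_right 0. 0 \<le> Re (g (of_real t * u) * u ^ n)"
      unfolding eventually_at_right_field
    proof (intro exI[of _ "e / norm u"] conjI allI impI)
      show "0 < e / norm u" using g u0 by simp
      fix t assume t: "0 < t" "t < e / norm u"
      then have "norm (of_real t * u) < e" using u0 by (simp add: norm_mult pos_less_divide_eq)
      then have in_e: "of_real t * u \<in> ball 0 e" by simp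
      then have "0 < Re (f (of_real t * u))" using g(3) t u by (intro pos) auto
      moreover have "f (of_real t * u) = of_real (t ^ n) * (g (of_real t * u) * u ^ n)"
        using g(5)[OF in_e] by (simp add: power_mult_distrib mult_ac)
      ultimately have "0 < t ^ n * Re (g (of_real t * u) * u ^ n)"
        by (simp only: Re_complex_of_real Im_complex_of_real times_complex.sel mult_zero_left diff_zero)
      then show "0 \<le> Re (g (of_real t * u) * u ^ n)" using t by (simp add: zero_less_mult_iff)
    qed
    ultimately show ?thesis by (intro tendsto_lowerbound) auto
  qed
  have g0: "g 0 \<noteq> 0" using g by simp
  note n1 = Re_power_pos_imp[OF g0 g(1) nonneg]
  have "(g has_field_derivative deriv g 0) (at 0)"
    by (rule holomorphic_derivI[OF g(4)]) (use g in auto)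
  then have "((\<lambda>w. w * g w) has_field_derivative g 0) (at 0)"
    by (auto intro!: derivative_eq_intros)
  then have "(f has_field_derivative g 0) (at 0)"
    by (rule has_field_derivative_transform_within_open[of _ _ _ "ball 0 e"]) (use g n1 in auto)
  then have "f' = g 0" using der DERIV_unique by blast
  then show "Im f' = 0" "0 < Re f'" using n1 by auto
qed

lemma line_in_ball:
  fixes a :: "complex^'n::{finite,linorder}"
  assumes "a \<in> ball b \<rho>"
  obtains \<epsilon> :: real where "0 < \<epsilon>" "\<And>l. norm l \<le> \<epsilon> \<Longrightarrow> a + l *s d \<in> ball b \<rho>"
proof -
  have "0 \<in> {l. a + l *s d \<in> ball b \<rho>}" using assms by simp
  then obtain e where "0 < e" "ball 0 e \<subseteq> {l. a + l *s d \<in> ball b \<rho>}"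
    using open_line_preimage[OF open_ball, of a d b \<rho>] open_contains_ball by blast
  then show ?thesis by (intro that[of "e/2"]) (auto simp: subset_iff)
qed

text \<open>The images of \<open>r - 1\<close> positive points \<open>e j\<close> leave at most one
  positive direction in their complement, and the complex line \<open>Y\<close> is orthogonal to all
  \<open>e j\<close>. Its positive points form a half-plane. A reversed Cauchy-Schwarz argument in
  the complement makes a normalized pairing with \<open>G b1\<close> have positive real part there,
  and \<open>half_plane_hopf\<close> applies at the null point \<open>b1\<close> on the
  boundary.\<close>

lemma positive_conformal_point:
  fixes b :: "complex^'n::{finite,linorder}" and G :: "complex^'n::{finite,linorder} \<Rightarrow> complex^'m::{finite,linorder}"
  assumes O: "orthogonal_ball r s s' b \<rho> G" and dims: "2 \<le> r" "2 \<le> s" "r + s \<le> CARD('n)"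
    and b: "hform r s b b = 0" "hform r s b y0 \<noteq> 0"
    and pos: "\<And>z. z \<in> ball b \<rho> \<Longrightarrow> 0 < Re (hform r s z z) \<Longrightarrow> 0 < Re (hform r s' (G z) (G z))"
  obtains b1 v1 where "b1 \<in> ball b \<rho>" "hform r s b1 b1 = 0" "hform r s v1 b1 = 1"
    "0 < Re (hform r s' (cderiv G b1 v1) (G b1))" "Im (hform r s' (cderiv G b1 v1) (G b1)) = 0"
proof -
  note \<rho> = orthogonal_ballD(1)[OF O] and G = orthogonal_ballD(2)[OF O] and orth = orthogonal_ballD(3)[OF O]
  have bb: "b \<in> ball b \<rho>" using \<rho> by simp
  obtain v where v: "hform r s v b = 1" "hform r s v v = 0"
    "\<And>x. (\<forall>i. \<not> idx i < r \<longrightarrow> x$i = 0) \<or> (\<forall>i. idx i < r \<longrightarrow> x$i = 0) \<Longrightarrow> hform r s x b = 0 \<Longrightarrow> hform r s x v = 0"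
    using null_point_dual[OF b] by blast
  have "r - 1 < r" "r \<le> CARD('n)" using dims by auto
  from ex_pos_orthonormal_family[OF this, of s b] obtain x :: "nat \<Rightarrow> complex^'n::{finite,linorder}" where
      "\<forall>j<r - 1. (\<forall>i. \<not> idx i < r \<longrightarrow> x j $ i = 0) \<and> hform r s (x j) (x j) = 1 \<and> hform r s (x j) b = 0"
      and x2: "\<forall>i<r - 1. \<forall>j<r - 1. i \<noteq> j \<longrightarrow> hform r s (x i) (x j) = 0" by (elim exE conjE)
  then have x: "hform r s (x j) (x j) = 1" "hform r s (x j) b = 0" "hform r s (x j) v = 0" if "j < r - 1" for j
    using v(3)[of "x j"] that by auto
  have x': "hform r s b (x j) = 0" "hform r s v (x j) = 0" if "j < r - 1" for j
    using x[OF that] hform_swap_zero by blast+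
  have bv: "hform r s b v = 1" using arg_cong[OF v(1), of cnj] by (simp add: hform_cnj)
  have "\<exists>\<epsilon>>0. \<forall>j<k. b + of_real \<epsilon> *s x j \<in> ball b \<rho>" for k
  proof -
    define M where "M = (\<Sum>j<k. norm (x j)) + 1"
    have M: "1 \<le> M" unfolding M_def by (simp add: sum_nonneg)
    have "b + of_real (\<rho> / (2 * M)) *s x j \<in> ball b \<rho>" if "j < k" for j
    proof -
      have "norm (x j) \<le> M" unfolding M_def using member_le_sum[of j "{..<k}" "\<lambda>j. norm (x j)"] that by simp
      then have "norm (of_real (\<rho> / (2 * M)) *s x j) \<le> \<rho> / (2 * M) * M"
        unfolding norm_smult norm_of_real using \<rho> M by (intro mult_mono) auto
      also have "\<dots> < \<rho>" using M \<rho> by simp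
      finally show ?thesis by (simp add: dist_norm)
    qed
    moreover have "0 < \<rho> / (2 * M)" using M \<rho> by simp
    ultimately show ?thesis by blast
  qed
  then obtain \<epsilon> where \<epsilon>: "0 < \<epsilon>" "\<And>j. j < r - 1 \<Longrightarrow> b + of_real \<epsilon> *s x j \<in> ball b \<rho>" by meson
  define e where "e j = b + of_real \<epsilon> *s x j" for j
  define X where "X = (\<Sum>j<r - 1. x j)"
  have X: "hform r s X b = 0" "hform r s X v = 0" "hform r s b X = 0" "hform r s v X = 0"
    by (auto simp: X_def hform_sum_left hform_sum_right x x')
  have Xx: "hform r s X (x j) = 1" if "j < r - 1" for j
  proof -
    have "hform r s X (x j) = (\<Sum>i<r - 1. if i = j then 1 else 0)"
      unfolding X_def hform_sum_left by (rule sum.cong) (use x x2 that in auto)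
    then show ?thesis using that by simp
  qed
  \<comment> \<open>The multiple of \<open>X\<close> cancels the pairing of \<open>v\<close> with
    each \<open>e j\<close>. The multiple of \<open>b\<close> in \<open>v'\<close> then makes the
    vector null and keeps its pairings with \<open>b\<close> and \<open>e j\<close>.\<close>
  define w0 where "w0 = v - of_real (1 / \<epsilon>) *s X"
  define q where "q = hform r s w0 w0"
  define v' where "v' = w0 - (q / 2) *s b"
  have cq: "cnj q = q" by (simp add: q_def hform_cnj)
  have w0b: "hform r s w0 b = 1" "hform r s b w0 = 1" by (simp_all add: w0_def hform_linear v bv X)
  have v'v': "hform r s v' v' = 0"
    by (simp add: v'_def hform_linear w0b b cq flip: q_def)
  have v'b: "hform r s v' b = 1" "hform r s b v' = 1" by (simp_all add: v'_def hform_linear w0b b)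
  have be: "hform r s b (e j) = 0" "hform r s (e j) b = 0" if "j < r - 1" for j
    using x[OF that] x'[OF that] b by (simp_all add: e_def hform_linear)
  have v'e: "hform r s v' (e j) = 0" if "j < r - 1" for j
  proof -
    have "hform r s w0 (e j) = 0"
      using x'[OF that] Xx[OF that] X \<epsilon> v by (simp add: e_def w0_def hform_linear)
    then show ?thesis by (simp add: v'_def hform_linear be[OF that])
  qed
  have ee: "hform r s (e i) (e j) = (if i = j then of_real (\<epsilon>\<^sup>2) else 0)" if "i < r - 1" "j < r - 1" for i j
    using x x' x2 that b by (simp add: e_def hform_linear power2_eq_square)
  define Y where "Y l = b + l *s v'" for l
  have YY: "hform r s (Y l) (Y l) = of_real (2 * Re l)" for l
    by (simp add: Y_def hform_linear b v'v' v'b complex_eq_iff)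
  have Ye: "hform r s (Y l) (e j) = 0" if "j < r - 1" for l j
    by (simp add: Y_def hform_linear be[OF that] v'e[OF that])
  obtain c where c: "0 < c" "\<And>l. norm l \<le> c \<Longrightarrow> b + l *s v' \<in> ball b \<rho>" using line_in_ball[OF bb] by blast
  define e0 where "e0 = Y (of_real c)"
  have e0: "e0 \<in> ball b \<rho>" using c(2)[of "of_real c"] c(1) by (simp add: e0_def Y_def)
  \<comment> \<open>All entries from \<open>r - 1\<close> on are \<open>G e0\<close>; the first
    \<open>r\<close> entries are orthogonal and positive.\<close>
  define E where "E j = G (if j < r - 1 then e j else e0)" for j
  have E_in: "(if j < r - 1 then e j else e0) \<in> ball b \<rho>" for j using \<epsilon>(2) e0 by (auto simp: e_def)
  have E_orth: "hform r s' (E i) (E j) = 0" if "i < r" "j < r" "i \<noteq> j" for i j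
    unfolding E_def
  proof (rule orth[OF E_in E_in])
    have "\<not> (\<not> i < r - 1 \<and> \<not> j < r - 1)" using that by auto
    then show "hform r s (if i < r - 1 then e i else e0) (if j < r - 1 then e j else e0) = 0"
      using ee[of i j] that Ye[of j] Ye[of i, THEN hform_swap_zero[THEN iffD1]] by (auto simp: e0_def)
  qed
  have E_pos: "0 < Re (hform r s' (E j) (E j))" for j
    unfolding E_def
    by (rule pos[OF E_in]) (use ee[of j j] \<epsilon>(1) c(1) in \<open>auto simp: e0_def YY\<close>)
  have nonpos: "Re (hform r s' y y) \<le> 0" if "\<And>j. j < r - 1 \<Longrightarrow> hform r s' y (G (e j)) = 0" "hform r s' y (G e0) = 0" for y
    by (rule orthogonal_complement_nonpos(1)[of r s' E, OF E_orth E_pos]) (use that in \<open>auto simp: E_def\<close>)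
  have YE: "hform r s' (G (Y l)) (G (e j)) = 0" if "Y l \<in> ball b \<rho>" "j < r - 1" for l j
    by (rule orth[OF that(1) _ Ye[OF that(2)]]) (use E_in[of j] that in simp)
  \<comment> \<open>Otherwise the pairing with \<open>G e0\<close> would vanish at all null points
    of the line, its imaginary axis, and by the identity theorem also at \<open>e0\<close>, where
    the square is positive.\<close>
  have "\<exists>t::real. Y (\<i> * of_real t) \<in> ball b \<rho> \<and> hform r s' (G (Y (\<i> * of_real t))) (G e0) \<noteq> 0"
  proof (rule ccontr)
    assume neg: "\<not> ?thesis"
    define L where "L = {l. b + l *s (\<i> *s v') \<in> ball b \<rho>}"
    have Yi: "b + l *s (\<i> *s v') = Y (\<i> * l)" for l by (simp add: Y_def vec_eq_iff mult_ac)
    have "hform r s' (G (b + (of_real c / \<i>) *s (\<i> *s v'))) (G e0) = 0"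
    proof (rule holomorphic_zero_on_reals[of "\<lambda>l. hform r s' (G (b + l *s (\<i> *s v'))) (G e0)" L 0])
      show oL: "open L" unfolding L_def by (rule open_line_preimage) simp
      show "connected L" unfolding L_def by (intro convex_connected convex_line_preimage) simp
      show "(\<lambda>l. hform r s' (G (b + l *s (\<i> *s v'))) (G e0)) holomorphic_on L"
        by (rule holomorphic_hform_left, rule vhol_comp[OF G vhol_line oL]) (simp add: L_def)
      show "complex_of_real 0 \<in> L" using \<rho> by (simp add: L_def)
      show "of_real c / \<i> \<in> L" using e0 unfolding L_def mem_Collect_eq Yi e0_def by simp
      show "hform r s' (G (b + of_real t *s (\<i> *s v'))) (G e0) = 0" if "of_real t \<in> L" for t
        using neg that unfolding L_def mem_Collect_eq Yi by blast
    qed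
    then have "hform r s' (G e0) (G e0) = 0" unfolding Yi e0_def by simp
    moreover have "\<not> r < r - 1" by simp
    then have "E r = G e0" unfolding E_def by (simp only: if_False)
    ultimately show False using E_pos[of r] by simp
  qed
  then obtain t :: real where t: "Y (\<i> * of_real t) \<in> ball b \<rho>" "hform r s' (G (Y (\<i> * of_real t))) (G e0) \<noteq> 0"
    by blast
  define b1 where "b1 = Y (\<i> * of_real t)"
  define a1 where "a1 = hform r s' (G b1) (G e0)"
  have a1: "a1 \<noteq> 0" using t by (simp add: a1_def b1_def)
  have b1: "b1 \<in> ball b \<rho>" "hform r s b1 b1 = 0" "hform r s v' b1 = 1"
    using t by (simp_all add: b1_def YY) (simp add: Y_def hform_linear v'v' v'b)
  have b1Y: "b1 + l *s v' = Y (\<i> * of_real t + l)" for l by (simp add: b1_def Y_def vec_eq_iff algebra_simps)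
  define num where "num l = hform r s' (G (b1 + l *s v')) (G b1)" for l
  define den where "den l = hform r s' (G (b1 + l *s v')) (G e0)" for l
  define L where "L = {l. b1 + l *s v' \<in> ball b \<rho>}"
  have oL: "open L" unfolding L_def by (rule open_line_preimage) simp
  have hol: "num holomorphic_on L" "den holomorphic_on L"
    unfolding num_def[abs_def] den_def[abs_def]
    by (rule holomorphic_hform_left, rule vhol_comp[OF G vhol_line oL], simp add: L_def)+
  have "open (L \<inter> den -` (- {0}))"
    by (rule continuous_open_preimage[OF holomorphic_on_imp_continuous_on[OF hol(2)] oL]) auto
  moreover have "L \<inter> den -` (- {0}) = {l \<in> L. den l \<noteq> 0}" by auto
  ultimately have "open {l \<in> L. den l \<noteq> 0}" by simp
  moreover have "0 \<in> {l \<in> L. den l \<noteq> 0}" using b1 a1 by (simp add: L_def den_def a1_def)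
  ultimately obtain d where d: "0 < d" "ball 0 d \<subseteq> {l \<in> L. den l \<noteq> 0}" using open_contains_ball by blast
  \<comment> \<open>The denominators scale both vectors to pairing 1 with \<open>G e0\<close>, so
    that the difference \<open>A - B\<close> below is orthogonal to \<open>G e0\<close>.\<close>
  define f where "f l = num l / (den l * cnj a1)" for l
  have GG: "hform r s' (G b1) (G b1) = 0" by (rule orth) (use b1 in auto)
  have der: "(f has_field_derivative hform r s' (cderiv G b1 v') (G b1) / (a1 * cnj a1)) (at 0)"
  proof -
    have n': "(num has_field_derivative hform r s' (cderiv G b1 v') (G b1)) (at 0)"
      using hform_line_derivative[OF G, of b1 0 v' r s' "G b1"] b1 by (simp add: num_def[abs_def])
    have d': "(den has_field_derivative hform r s' (cderiv G b1 v') (G e0)) (at 0)"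
      using hform_line_derivative[OF G, of b1 0 v' r s' "G e0"] b1 by (simp add: den_def[abs_def])
    have 0: "num 0 = 0" "den 0 = a1" using GG by (simp_all add: num_def den_def a1_def)
    show ?thesis unfolding f_def
      by (rule derivative_eq_intros n' d' refl | use a1 0 in \<open>simp add: field_simps\<close>)+
  qed
  have f_pos: "0 < Re (f l)" if l: "l \<in> ball 0 d" "0 < Re l" for l
  proof -
    define z where "z = b1 + l *s v'"
    have z: "z \<in> ball b \<rho>" using l d by (auto simp: z_def L_def)
    have zY: "z = Y (\<i> * of_real t + l)" by (simp add: z_def b1Y)
    have "0 < Re (hform r s' (G z) (G z))" by (rule pos[OF z]) (use l in \<open>simp add: zY YY\<close>)
    moreover define a where "a = hform r s' (G z) (G e0)"
    have a: "a \<noteq> 0" using l d by (auto simp: a_def z_def den_def)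
    define A where "A = (1 / a) *s G z"
    define B where "B = (1 / a1) *s G b1"
    have ze: "hform r s' (G z) (G (e j)) = 0" if "j < r - 1" for j using YE z that by (simp add: zY)
    have be: "hform r s' (G b1) (G (e j)) = 0" if "j < r - 1" for j using YE b1(1) that by (simp add: b1_def)
    \<comment> \<open>As \<open>B\<close> is null, this bounds the positive square of
      \<open>A\<close> by twice the real part of its pairing with \<open>B\<close>, which is
      \<open>f l\<close>.\<close>
    have "Re (hform r s' (A - B) (A - B)) \<le> 0"
    proof (rule nonpos)
      show "hform r s' (A - B) (G (e j)) = 0" if "j < r - 1" for j
        using ze[OF that] be[OF that] by (simp add: A_def B_def hform_linear)
      show "hform r s' (A - B) (G e0) = 0" using a a1 by (simp add: A_def B_def hform_linear a_def a1_def)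
    qed
    moreover have "hform r s' (A - B) (A - B) = hform r s' A A - (hform r s' A B + cnj (hform r s' A B))"
      using GG by (simp add: B_def hform_linear hform_cnj)
    moreover have "hform r s' A A = hform r s' (G z) (G z) / (a * cnj a)"
      by (simp add: A_def hform_linear)
    then have "Re (hform r s' A A) = Re (hform r s' (G z) (G z)) / (norm a)\<^sup>2"
      unfolding complex_norm_square[symmetric] by (simp only: Re_divide_of_real)
    moreover have "0 < (norm a)\<^sup>2" using a by simp
    ultimately have "0 < Re (hform r s' A A)" "Re (hform r s' A A) \<le> 2 * Re (hform r s' A B)" by simp_all
    then have "0 < Re (hform r s' A B)" by linarith
    moreover have "hform r s' A B = f l"
      by (simp add: A_def B_def hform_linear f_def num_def den_def a_def z_def)
    ultimately show ?thesis by simp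
  qed
  have "f holomorphic_on ball 0 d"
    unfolding f_def
    by (intro holomorphic_intros holomorphic_on_subset[OF hol(1)] holomorphic_on_subset[OF hol(2)]) (use d a1 in auto)
  moreover have "f 0 = 0" using GG by (simp add: f_def num_def)
  ultimately have *: "Im (hform r s' (cderiv G b1 v') (G b1) / (a1 * cnj a1)) = 0"
    "0 < Re (hform r s' (cderiv G b1 v') (G b1) / (a1 * cnj a1))"
    using half_plane_hopf[OF _ d(1) _ f_pos der] by auto
  have "a1 * cnj a1 = of_real ((norm a1)\<^sup>2)" by (rule complex_norm_square[symmetric])
  then have "Im (hform r s' (cderiv G b1 v') (G b1)) = 0" "0 < Re (hform r s' (cderiv G b1 v') (G b1))"
    using * a1 unfolding \<open>a1 * cnj a1 = _\<close> Re_divide_of_real Im_divide_of_real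
    by (auto simp: zero_less_divide_iff)
  with b1 that show ?thesis by blast
qed

section \<open>Local isometry\<close>

lemma local_isometry:
  fixes U :: "(complex^'n::{finite,linorder}) set"
    and F :: "complex^'n::{finite,linorder} \<Rightarrow> complex^'m::{finite,linorder}"
  assumes dims: "2 \<le> r" "2 \<le> s" "r + s \<le> CARD('n)"
    and F: "local_proper_map r s r s' U F"
  obtains \<Omega> \<Phi> where "open \<Omega>" "\<Omega> \<noteq> {}" "\<Omega> \<subseteq> U"
    "\<And>z. z \<in> \<Omega> \<Longrightarrow> \<exists>c. c \<noteq> 0 \<and> F z = c *s \<Phi> z"
    "\<And>z w. z \<in> \<Omega> \<Longrightarrow> w \<in> \<Omega> \<Longrightarrow> hform r s' (\<Phi> z) (\<Phi> w) = hform r s z w"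
    "\<And>z. z \<in> \<Omega> \<Longrightarrow> \<exists>y. hform r s z y \<noteq> 0"
proof -
  from F obtain z0 where z0: "z0 \<in> U" "hform r s z0 z0 = 0" and hol: "holo_proj_map U F"
    and pos: "\<And>z. z \<in> U \<Longrightarrow> positive_pt r s z \<Longrightarrow> positive_pt r s' (F z)"
    and null: "\<And>z. z \<in> U \<Longrightarrow> null_pt r s z \<Longrightarrow> null_pt r s' (F z)" and U: "open U" "0 \<notin> U"
    by (auto simp: local_proper_map_def null_pt_def proj_open_cone_def)
  from hol have "\<forall>z0\<in>U. \<exists>W G. open W \<and> z0 \<in> W \<and> W \<subseteq> U \<and> holo_on W G \<and>
        (\<forall>z\<in>W. G z \<noteq> 0 \<and> (\<exists>c. c \<noteq> 0 \<and> F z = c *s G z))" unfolding holo_proj_map_def by (elim conjE)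
  from bspec[OF this z0(1)] obtain W G where W: "open W" "z0 \<in> W" "W \<subseteq> U" and GW: "holo_on W G"
    and FG: "\<And>z. z \<in> W \<Longrightarrow> G z \<noteq> 0 \<and> (\<exists>c. c \<noteq> 0 \<and> F z = c *s G z)"
    by (elim exE conjE) blast
  have Gpos: "0 < Re (hform r s' (G z) (G z))" if z: "z \<in> W" "0 < Re (hform r s z z)" for z
  proof -
    from FG[OF z(1)] obtain c where c: "c \<noteq> 0" "F z = c *s G z" by blast
    have "positive_pt r s z" using z by (auto simp: positive_pt_def)
    then have "0 < Re (hform r s' (F z) (F z))" using pos[of z] z W by (auto simp: positive_pt_def)
    moreover have "hform r s' (F z) (F z) = of_real ((norm c)\<^sup>2) * hform r s' (G z) (G z)"
      unfolding complex_norm_square c(2) by (simp add: hform_linear mult_ac)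
    ultimately show ?thesis using c(1) by (simp add: zero_less_mult_iff)
  qed
  have Gnull: "hform r s' (G z) (G z) = 0" if z: "z \<in> W" "hform r s z z = 0" for z
  proof -
    from FG[OF z(1)] obtain c where c: "c \<noteq> 0" "F z = c *s G z" by blast
    have "null_pt r s z" using z W U by (auto simp: null_pt_def)
    then have "hform r s' (F z) (F z) = 0" using null[of z] z W by (auto simp: null_pt_def)
    then show ?thesis using c by (simp add: hform_linear)
  qed
  \<comment> \<open>The given null point may lie in the radical, where no dual vector exists. Adding
    a small null vector \<open>e + f\<close> moves it out and keeps it null.\<close>
  have "\<exists>p y. p \<in> W \<and> hform r s p p = 0 \<and> hform r s p y \<noteq> 0"
  proof (cases "\<forall>y. hform r s z0 y = 0")
    case False
    then show ?thesis using z0 W by blast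
  next
    case True
    obtain e f where e: "hform r s e z0 = 0" "hform r s f z0 = 0" "hform r s e e = 1"
      "hform r s f f = - 1" "hform r s e f = 0" using null_point_frame[OF dims, of z0] by metis
    have e': "hform r s f e = 0" using e(5) hform_swap_zero by blast
    from W obtain \<rho> where "0 < \<rho>" "ball z0 \<rho> \<subseteq> W" using open_contains_ball by blast
    moreover from \<open>0 < \<rho>\<close> have "z0 \<in> ball z0 \<rho>" by simp
    then obtain \<epsilon> :: real where "0 < \<epsilon>" "\<And>l. norm l \<le> \<epsilon> \<Longrightarrow> z0 + l *s (e + f) \<in> ball z0 \<rho>"
      using line_in_ball by blast
    ultimately have \<epsilon>: "0 < \<epsilon>" "\<And>l. norm l \<le> \<epsilon> \<Longrightarrow> z0 + l *s (e + f) \<in> W" by blast+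
    let ?p = "z0 + of_real \<epsilon> *s (e + f)"
    have "?p \<in> W" using \<epsilon>(2)[of "of_real \<epsilon>"] \<epsilon>(1) by simp
    moreover have "hform r s ?p ?p = 0" using True e e' by (simp add: hform_linear)
    moreover have "hform r s ?p e \<noteq> 0" using True e e' \<epsilon>(1) by (simp add: hform_linear)
    ultimately show ?thesis by blast
  qed
  then obtain b y where b: "b \<in> W" "hform r s b b = 0" "hform r s b y \<noteq> 0" by blast
  obtain \<rho> where \<rho>: "0 < \<rho>" "ball b \<rho> \<subseteq> W" using W(1) b(1) open_contains_ball by blast
  obtain v where v: "hform r s v b = 1" "hform r s v v = 0" using null_point_dual[OF b(2,3)] by metis
  have holb: "holo_on (ball b \<rho>) G" using GW \<rho> by (auto simp: holo_on_def)
  have nullb: "hform r s' (G z) (G z) = 0" if "z \<in> ball b \<rho>" "hform r s z z = 0" for z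
    using Gnull that \<rho>(2) by blast
  obtain \<delta> where \<delta>: "\<delta> \<le> \<rho>" "orthogonal_ball r s s' b \<delta> G"
    using null_preserving_imp_orthogonal_ball[OF v b(2) \<rho>(1) holb nullb] by blast
  note B\<rho> = orthogonal_ballD(1)[OF \<delta>(2)] and BG = orthogonal_ballD(2)[OF \<delta>(2)] and Borth = orthogonal_ballD(3)[OF \<delta>(2)]
  have sub: "ball b \<delta> \<subseteq> W" using \<rho> \<delta> by (meson subset_ball subset_trans)
  have posb: "0 < Re (hform r s' (G z) (G z))" if "z \<in> ball b \<delta>" "0 < Re (hform r s z z)" for z
    using Gpos that sub by blast
  obtain b1 v1 where b1: "b1 \<in> ball b \<delta>" "hform r s b1 b1 = 0" "hform r s v1 b1 = 1"
    "0 < Re (hform r s' (cderiv G b1 v1) (G b1))" "Im (hform r s' (cderiv G b1 v1) (G b1)) = 0"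
    using positive_conformal_point[OF \<delta>(2) dims b(2,3) posb] by blast
  let ?B = "ball b \<delta>"
  have cv: "continuous_on UNIV (\<lambda>w. hform r s v1 w)"
    unfolding hform_sgnc by (intro continuous_intros)
  have "open {w. 1/2 < Re (hform r s v1 w)}"
    by (intro open_Collect_less continuous_intros cv)
  moreover have "b1 \<in> {w. 1/2 < Re (hform r s v1 w)}" using b1 by simp
  ultimately have oV: "open (?B \<inter> {w. 1/2 < Re (hform r s v1 w)})" "b1 \<in> ?B \<inter> {w. 1/2 < Re (hform r s v1 w)}"
    using b1 by auto
  define V where "V = ?B \<inter> {w. 1/2 < Re (hform r s v1 w)}"
  \<comment> \<open>The real part of \<open>conformal\<close> on pairs of points: positivity at
    \<open>(b1, b1)\<close> extends to a product neighbourhood by joint continuity.\<close>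
  define h where "h x = Re (hform r s' (cderiv G (fst x) v1) (G (snd x)) / hform r s v1 (snd x))" for x
  have ch: "continuous_on (V \<times> V) h"
  proof -
    have c1: "continuous_on (V \<times> V) (\<lambda>x. cderiv G (fst x) v1)"
      by (rule continuous_on_compose2[OF cderiv_continuous_on[OF BG B\<rho>]]) (auto simp: V_def intro: continuous_intros)
    have c2: "continuous_on (V \<times> V) (\<lambda>x. G (snd x))"
      by (rule continuous_on_compose2[OF holo_on_continuous_on[OF BG]]) (auto simp: V_def intro: continuous_intros)
    have c3: "continuous_on (V \<times> V) (\<lambda>x. hform r s v1 (snd x))"
      by (rule continuous_on_compose2[OF cv]) (auto intro: continuous_intros)
    have c4: "continuous_on (V \<times> V) (\<lambda>x. hform r s' (cderiv G (fst x) v1) (G (snd x)))"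
      unfolding hform_sgnc by (intro continuous_intros c1 c2)
    show ?thesis unfolding h_def
      by (intro continuous_intros c3 c4) (auto simp: V_def)
  qed
  have "open ((V \<times> V) \<inter> h -` {0<..})"
    using ch by (rule continuous_open_preimage) (use oV in \<open>auto simp: V_def open_Times\<close>)
  moreover have "(b1, b1) \<in> (V \<times> V) \<inter> h -` {0<..}" using b1 by (simp add: V_def h_def)
  ultimately obtain A B where AB: "open A" "open B" "(b1, b1) \<in> A \<times> B" "A \<times> B \<subseteq> (V \<times> V) \<inter> h -` {0<..}"
    by (rule open_prod_elim)
  then have "open (A \<inter> B)" "b1 \<in> A \<inter> B" by auto
  then obtain \<rho>1 where \<rho>1: "0 < \<rho>1" "ball b1 \<rho>1 \<subseteq> A \<inter> B" using open_contains_ball by blast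
  have sub1: "ball b1 \<rho>1 \<subseteq> V"
  proof
    fix x assume "x \<in> ball b1 \<rho>1"
    then have "(x, x) \<in> A \<times> B" using \<rho>1 by blast
    then show "x \<in> V" using AB(4) by blast
  qed
  have sub2: "x \<in> ball b \<delta>" "1/2 < Re (hform r s v1 x)" if "x \<in> ball b1 \<rho>1" for x
    using subsetD[OF sub1 that] by (simp_all add: V_def)
  have R: "rigid_ball r s s' b1 \<rho>1 G v1"
    unfolding rigid_ball_def orthogonal_ball_def
  proof (intro conjI ballI impI)
    show "0 < \<rho>1" by fact
    show "holo_on (ball b1 \<rho>1) G" using BG sub2 unfolding holo_on_def by blast
    show "hform r s' (G z) (G w) = 0" if "z \<in> ball b1 \<rho>1" "w \<in> ball b1 \<rho>1" "hform r s z w = 0" for z w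
      by (rule Borth[OF sub2(1) sub2(1)]) (use that in auto)
    show "1/2 < Re (hform r s v1 y)" if "y \<in> ball b1 \<rho>1" for y by (rule sub2(2)[OF that])
    show "0 < Re (conformal r s s' G v1 p w)" if "p \<in> ball b1 \<rho>1" "w \<in> ball b1 \<rho>1" for p w
    proof -
      have "(p, w) \<in> A \<times> B" using \<rho>1 that by blast
      then have "h (p, w) > 0" using AB(4) by blast
      then show ?thesis by (simp add: h_def conformal_def)
    qed
  qed
  have "Im (conformal r s s' G v1 b1 b1) = 0" using b1 by (simp add: conformal_def)
  from rank_one[OF R dims b1(2) this] obtain \<Omega> \<Psi> where \<Omega>: "open \<Omega>" "\<Omega> \<noteq> {}" "\<Omega> \<subseteq> ball b1 \<rho>1"
    and \<Psi>: "\<And>z. z \<in> \<Omega> \<Longrightarrow> \<Psi> z \<noteq> (0::complex)" "\<And>z. z \<in> \<Omega> \<Longrightarrow> hform r s z b1 \<noteq> 0"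
      "\<And>z w. z \<in> \<Omega> \<Longrightarrow> w \<in> \<Omega> \<Longrightarrow> hform r s' (G z) (G w) = \<Psi> z * cnj (\<Psi> w) * hform r s z w"
    by blast
  have \<Omega>W: "\<Omega> \<subseteq> W" using \<Omega>(3) sub2(1) sub by blast
  show ?thesis
  proof (rule that[of \<Omega> "\<lambda>z. (1 / \<Psi> z) *s G z"])
    show "\<Omega> \<subseteq> U" using \<Omega>W W by blast
    show "\<exists>c. c \<noteq> 0 \<and> F z = c *s ((1 / \<Psi> z) *s G z)" if "z \<in> \<Omega>" for z
    proof -
      from FG[of z] that \<Omega>W obtain c where "c \<noteq> 0" "F z = c *s G z" by blast
      then show ?thesis using \<Psi>(1)[OF that] by (intro exI[of _ "c * \<Psi> z"]) (simp add: vec_eq_iff)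
    qed
    show "hform r s' ((1 / \<Psi> z) *s G z) ((1 / \<Psi> w) *s G w) = hform r s z w" if "z \<in> \<Omega>" "w \<in> \<Omega>" for z w
      using \<Psi>(1)[OF that(1)] \<Psi>(1)[OF that(2)] \<Psi>(3)[OF that] by (simp add: hform_linear)
    show "\<exists>y. hform r s z y \<noteq> 0" if "z \<in> \<Omega>" for z using \<Psi>(2)[OF that] by blast
  qed (use \<Omega> in auto)
qed

section \<open>From local to global\<close>

text \<open>\<open>F\<close> has holomorphic representatives only locally, and they differ by scalar
  factors. A condition homogeneous in \<open>F z\<close> does not see these factors, so the identity
  theorem on balls makes its interior zero set relatively closed in \<open>U\<close>.
  \<open>\<Lambda>\<close> may depend on \<open>z\<close> so that \<open>F z\<close> can be compared
  with \<open>z\<close> itself.\<close>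

lemma lift_identity_principle:
  fixes U :: "(complex^'n::{finite,linorder}) set"
    and F :: "complex^'n::{finite,linorder} \<Rightarrow> complex^'m::{finite,linorder}"
  assumes U: "connected U" and F: "holo_proj_map U F"
    and scale: "\<And>z c y. \<Lambda> z (c *s y) = c * (\<Lambda> z y :: complex)"
    and hol: "\<And>S Z Y. vhol S Z \<Longrightarrow> vhol S Y \<Longrightarrow> (\<lambda>t. \<Lambda> (Z t) (Y t)) holomorphic_on S"
    and \<Omega>: "open \<Omega>" "\<Omega> \<noteq> {}" "\<Omega> \<subseteq> U" "\<And>z. z \<in> \<Omega> \<Longrightarrow> \<Lambda> z (F z) = 0"
    and z: "z \<in> U"
  shows "\<Lambda> z (F z) = 0"
proof -
  define S where "S = {z. \<exists>e>0. \<forall>y\<in>ball z e. \<Lambda> y (F y) = 0}"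
  have "open S"
    unfolding open_contains_ball
  proof
    fix z assume "z \<in> S"
    then obtain e where e: "0 < e" "\<forall>y\<in>ball z e. \<Lambda> y (F y) = 0" by (auto simp: S_def)
    have "ball z e \<subseteq> S"
    proof
      fix x assume "x \<in> ball z e"
      then obtain d where "0 < d" "ball x d \<subseteq> ball z e" using open_ball[unfolded open_contains_ball] by blast
      then show "x \<in> S" using e unfolding S_def by blast
    qed
    with e show "\<exists>e>0. ball z e \<subseteq> S" by blast
  qed
  have local: "\<exists>e>0. S \<inter> ball z e \<noteq> {} \<longrightarrow> ball z e \<subseteq> S" if "z \<in> U" for z
  proof -
    from F have "\<forall>z0\<in>U. \<exists>W G. open W \<and> z0 \<in> W \<and> W \<subseteq> U \<and> holo_on W G \<and>
        (\<forall>z\<in>W. G z \<noteq> 0 \<and> (\<exists>c. c \<noteq> 0 \<and> F z = c *s G z))" unfolding holo_proj_map_def by (elim conjE)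
    from bspec[OF this that] obtain W G where W: "open W" "z \<in> W" "W \<subseteq> U" and GW: "holo_on W G"
      and FG: "\<And>z. z \<in> W \<Longrightarrow> G z \<noteq> 0 \<and> (\<exists>c. c \<noteq> 0 \<and> F z = c *s G z)"
      by (elim exE conjE) blast
    have iff: "\<Lambda> y (F y) = 0 \<longleftrightarrow> \<Lambda> y (G y) = 0" if "y \<in> W" for y
      using FG[OF that] by (auto simp: scale)
    from W obtain e where e: "0 < e" "ball z e \<subseteq> W" using open_contains_ball by blast
    have "ball z e \<subseteq> S" if "S \<inter> ball z e \<noteq> {}"
    proof -
      from that obtain y where y: "y \<in> S" "y \<in> ball z e" by blast
      from y(1) obtain d where d: "0 < d" "\<forall>x\<in>ball y d. \<Lambda> x (F x) = 0" by (auto simp: S_def)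
      have zero: "\<Lambda> x (F x) = 0" if x: "x \<in> ball z e" for x
      proof -
        \<comment> \<open>Restricting to the complex line through \<open>y\<close> and
          \<open>x\<close> reduces the claim to one variable.\<close>
        define L where "L = {t. y + t *s (x - y) \<in> ball z e}"
        define M where "M = L \<inter> {t. y + t *s (x - y) \<in> ball y d}"
        have oL: "open L" unfolding L_def by (rule open_line_preimage) simp
        have "\<Lambda> (y + 1 *s (x - y)) (G (y + 1 *s (x - y))) = 0"
        proof (rule analytic_continuation_open[where s = M and s' = L and g = "\<lambda>_. 0" and z = 1
              and f = "\<lambda>t. \<Lambda> (y + t *s (x - y)) (G (y + t *s (x - y)))"])
          show "open M" unfolding M_def using oL open_line_preimage[OF open_ball, of y "x - y" y d] by (rule open_Int)
          have "0 \<in> M" using y d by (simp add: M_def L_def)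
          then show "M \<noteq> {}" by blast
          show "connected L" unfolding L_def by (intro convex_connected convex_line_preimage) simp
          show "M \<subseteq> L" by (auto simp: M_def)
          have "vhol L (\<lambda>t. G (y + t *s (x - y)))"
            by (rule vhol_comp[OF GW vhol_line oL]) (use e in \<open>auto simp: L_def\<close>)
          with vhol_line show "(\<lambda>t. \<Lambda> (y + t *s (x - y)) (G (y + t *s (x - y)))) holomorphic_on L" by (rule hol)
          show "1 \<in> L" using x by (simp add: L_def)
          show "\<Lambda> (y + t *s (x - y)) (G (y + t *s (x - y))) = 0" if "t \<in> M" for t
          proof -
            have "y + t *s (x - y) \<in> W" using that e by (auto simp: M_def L_def)
            moreover have "\<Lambda> (y + t *s (x - y)) (F (y + t *s (x - y))) = 0" using that d by (auto simp: M_def)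
            ultimately show ?thesis using iff by blast
          qed
        qed (use oL in auto)
        then have "\<Lambda> x (G x) = 0" by simp
        then show ?thesis using iff[of x] x e by blast
      qed
      show ?thesis
      proof
        fix x assume "x \<in> ball z e"
        then obtain d where "0 < d" "ball x d \<subseteq> ball z e" using open_ball[unfolded open_contains_ball] by blast
        then show "x \<in> S" using zero unfolding S_def by blast
      qed
    qed
    with e show ?thesis by blast
  qed
  define V' where "V' = \<Union>{ball z e |z e. S \<inter> ball z e = {}}"
  have "open V'" unfolding V'_def by auto
  have "U \<subseteq> S \<union> V'"
  proof
    fix x assume "x \<in> U"
    from local[OF this] obtain e where e: "e > 0" "S \<inter> ball x e \<noteq> {} \<longrightarrow> ball x e \<subseteq> S" by blast
    show "x \<in> S \<union> V'"
    proof (cases "S \<inter> ball x e = {}")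
      case True
      then have "ball x e \<subseteq> V'" unfolding V'_def by blast
      moreover have "x \<in> ball x e" using e by simp
      ultimately show ?thesis by blast
    next
      case False
      moreover have "x \<in> ball x e" using e by simp
      ultimately show ?thesis using e by blast
    qed
  qed
  moreover have "S \<inter> V' \<inter> U = {}" unfolding V'_def by blast
  ultimately have "S \<inter> U = {} \<or> V' \<inter> U = {}"
    using connectedD[OF U \<open>open S\<close> \<open>open V'\<close>] by blast
  moreover have "S \<inter> U \<noteq> {}"
  proof -
    from \<Omega>(2) obtain w where w: "w \<in> \<Omega>" by blast
    with \<Omega>(1) obtain e where "0 < e" "ball w e \<subseteq> \<Omega>" using open_contains_ball by blast
    then have "w \<in> S" using \<Omega>(4) unfolding S_def by blast
    then show ?thesis using w \<Omega>(3) by blast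
  qed
  ultimately have "z \<in> S" using z \<open>U \<subseteq> S \<union> V'\<close> by blast
  then show ?thesis by (auto simp: S_def)
qed

lemma proj_along_eq:
  assumes "csubspace A" "csubspace B" "A \<inter> B = {0}" "a \<in> A" "b \<in> B"
  shows "proj_along A B (a + b) = a" "proj_along B A (a + b) = b"
proof -
  have diff: "x - y \<in> X" if "csubspace X" "x \<in> X" "y \<in> X" for X and x y :: "complex^'m::{finite,linorder}"
  proof -
    have "x + (-1) *s y \<in> X" using that unfolding csubspace_def by blast
    then show ?thesis by simp
  qed
  have uniq: "a' = a \<and> b' = b" if "a' \<in> A" "b' \<in> B" "a + b = a' + b'" for a' b'
  proof -
    have "a - a' = b' - b" using that(3) by (simp add: algebra_simps)
    moreover have "a - a' \<in> A" "b' - b \<in> B" using diff assms that by blast+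
    ultimately have "a - a' \<in> A \<inter> B" by simp
    then have "a - a' = 0" using assms(3) by blast
    with that(3) show ?thesis by simp
  qed
  show "proj_along A B (a + b) = a"
    unfolding proj_along_def by (rule the_equality) (use assms uniq in blast)+
  have "a + b = b' + a' \<Longrightarrow> a' \<in> A \<Longrightarrow> b' \<in> B \<Longrightarrow> b' = b" for a' b' using uniq[of a' b'] by (simp add: add.commute)
  moreover have "\<exists>a'\<in>A. a + b = b + a'" using assms by (intro bexI[of _ a]) (auto simp: add.commute)
  ultimately show "proj_along B A (a + b) = b"
    unfolding proj_along_def by (intro the_equality) (use assms in blast)+
qed

theorem mainTheorem15:
  fixes U :: "(complex^'n::{finite,linorder}) set"
    and F :: "complex^'n::{finite,linorder} \<Rightarrow> complex^'m::{finite,linorder}"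
    and r s s' :: nat
  assumes "2 \<le> r" and "2 \<le> s"
    and "r + s \<le> CARD('n)" and "r + s' \<le> CARD('m)"
    and "local_proper_map r s r s' U F"
  shows "quasi_standard r s r s' U F \<and> (CARD('m) = r + s' \<longrightarrow> standard_map r s r s' U F)"
proof -
  have UF: "connected U" "holo_proj_map U F" and F0: "\<And>z. z \<in> U \<Longrightarrow> F z \<noteq> 0"
    using assms(5) by (auto simp: local_proper_map_def holo_proj_map_def)
  obtain \<Omega> \<Phi> where \<Omega>: "open \<Omega>" "\<Omega> \<noteq> {}" "\<Omega> \<subseteq> U"
    and F\<Phi>: "\<And>z. z \<in> \<Omega> \<Longrightarrow> \<exists>c. c \<noteq> 0 \<and> F z = c *s \<Phi> z"
    and \<Phi>: "\<And>z w. z \<in> \<Omega> \<Longrightarrow> w \<in> \<Omega> \<Longrightarrow> hform r s' (\<Phi> z) (\<Phi> w) = hform r s z w"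
    and nonrad: "\<And>z. z \<in> \<Omega> \<Longrightarrow> \<exists>y. hform r s z y \<noteq> 0"
    using local_isometry[OF assms(1-3,5)] by blast
  from \<Omega>(2) obtain a where a: "a \<in> \<Omega>" by blast
  with \<Omega>(1) obtain \<epsilon> where \<epsilon>: "0 < \<epsilon>" "ball a \<epsilon> \<subseteq> \<Omega>" using open_contains_ball by blast
  define \<eta> where "\<eta> = complex_of_real (\<epsilon> / 2)"
  define u :: "'n \<Rightarrow> complex^'n::{finite,linorder}" where "u i = axis i 1" for i
  have \<eta>: "\<eta> \<noteq> 0" "cnj \<eta> = \<eta>" using \<epsilon> by (auto simp: \<eta>_def)
  have a\<eta>: "a + \<eta> *s u i \<in> \<Omega>" for i
  proof -
    have "norm (\<eta> *s u i) = \<epsilon> / 2" unfolding norm_smult using \<epsilon> by (simp add: \<eta>_def u_def norm_axis_1 del: of_real_divide)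
    then have "a + \<eta> *s u i \<in> ball a \<epsilon>" using \<epsilon> by (simp add: dist_norm)
    then show ?thesis using \<epsilon> by blast
  qed
  have hu: "hform r s z (u i) = sgnc r s i * z $ i" for z :: "complex^'n::{finite,linorder}" and i
  proof -
    have "hform r s z (u i) = (\<Sum>j\<in>UNIV. if j = i then sgnc r s i * z $ i else 0)"
      unfolding hform_sgnc by (rule sum.cong) (auto simp: u_def axis_def)
    then show ?thesis by simp
  qed
  \<comment> \<open>\<open>\<Phi>\<close> need not be linear, but its difference quotients already carry the form.\<close>
  define E where "E i = (1 / \<eta>) *s (\<Phi> (a + \<eta> *s u i) - \<Phi> a)" for i
  have \<Phi>E: "hform r s' (\<Phi> z) (E i) = sgnc r s i * z $ i" if "z \<in> \<Omega>" for z i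
    using \<eta> by (simp add: E_def hform_linear \<Phi>[OF that a\<eta>] \<Phi>[OF that a] hu add_divide_distrib)
  have EE: "hform r s' (E i) (E j) = (if i = j then sgnc r s i else 0)" for i j
  proof -
    have "hform r s' (E i) (E j) = (1 / \<eta>) * (sgnc r s j * (a + \<eta> *s u i) $ j - sgnc r s j * a $ j)"
      unfolding E_def[of i] by (simp only: hform_scale_left hform_diff_left \<Phi>E[OF a\<eta>] \<Phi>E[OF a])
    then show ?thesis using \<eta> by (simp add: u_def axis_def algebra_simps)
  qed
  define J where "J = {i::'n. idx i < r + s}"
  \<comment> \<open>The radical coordinates are sent to 0, so only those \<open>E i\<close> occur
    that are orthogonal with squares 1 or -1.\<close>
  define L where "L z = (\<Sum>i\<in>J. z $ i *s E i)" for z :: "complex^'n::{finite,linorder}"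
  have sg: "sgnc r s i * sgnc r s i = 1" "sgnc r s i \<noteq> 0" if "i \<in> J" for i using that by (auto simp: J_def sgnc_def)
  have sg0: "sgnc r s i = 0" if "i \<notin> J" for i using that by (auto simp: J_def sgnc_def)
  have LE: "hform r s' (L z) (E i) = sgnc r s i * z $ i" for z i
  proof -
    have "hform r s' (L z) (E i) = (\<Sum>j\<in>J. if j = i then sgnc r s i * z $ i else 0)"
      unfolding L_def hform_sum_left hform_scale_left by (rule sum.cong) (auto simp: EE)
    then show ?thesis using sg0 by (simp add: J_def)
  qed
  have hJ: "(\<Sum>i\<in>J. cnj (w $ i) * (sgnc r s i * z $ i)) = hform r s z w" for z w :: "complex^'n::{finite,linorder}"
  proof -
    have "hform r s z w = (\<Sum>i\<in>J. sgnc r s i * z $ i * cnj (w $ i))"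
      unfolding hform_sgnc by (rule sum.mono_neutral_right) (use sg0 in auto)
    then show ?thesis by (simp add: mult_ac)
  qed
  have LL: "hform r s' (L z) (L w) = hform r s z w" for z w
    unfolding L_def[of w] hform_sum_right hform_scale_right LE by (rule hJ)
  have \<Phi>L: "hform r s' (\<Phi> z) (L w) = hform r s z w" if "z \<in> \<Omega>" for z w
    unfolding L_def hform_sum_right hform_scale_right \<Phi>E[OF that] by (rule hJ)
  have L_lin: "clinear_map L"
    by (simp add: clinear_map_def L_def sum.distrib vec_eq_iff sum_distrib_left algebra_simps)
  have L_iso: "isometry_map r s r s' L" using L_lin LL by (simp add: isometry_map_def)
  define A where "A = range L"
  \<comment> \<open>The orthogonal complement of \<open>A\<close>. The form is nondegenerate on
    \<open>A\<close>, so \<open>\<pi>\<close> below splits every vector even if the whole form is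
    degenerate.\<close>
  define B where "B = {y. \<forall>i\<in>J. hform r s' y (E i) = 0}"
  have AB: "csubspace A" "csubspace B" "A \<inter> B = {0}"
  proof -
    have L0: "L 0 = 0" by (simp add: L_def)
    show "csubspace A"
      unfolding csubspace_def A_def
    proof (intro conjI ballI allI)
      show "0 \<in> range L" using L0 by (metis rangeI)
      show "x + y \<in> range L" if xy: "x \<in> range L" "y \<in> range L" for x y
      proof -
        from xy obtain x' y' where "x = L x'" "y = L y'" by blast
        then have "x + y = L (x' + y')" using L_lin by (simp add: clinear_map_def)
        then show ?thesis by simp
      qed
      show "c *s x \<in> range L" if x: "x \<in> range L" for c x
      proof -
        from x obtain x' where "x = L x'" by blast
        then have "c *s x = L (c *s x')" using L_lin by (simp add: clinear_map_def)
        then show ?thesis by simp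
      qed
    qed
    show "csubspace B" by (simp add: csubspace_def B_def hform_linear)
    have "x = 0" if "x \<in> A" "x \<in> B" for x
    proof -
      from that obtain z where z: "x = L z" by (auto simp: A_def)
      have "z $ i = 0" if "i \<in> J" for i
      proof -
        have "hform r s' (L z) (E i) = 0" using \<open>x \<in> B\<close> \<open>i \<in> J\<close> by (simp add: B_def z)
        then show ?thesis using sg(2)[OF \<open>i \<in> J\<close>] by (simp add: LE)
      qed
      then show ?thesis by (simp add: z L_def)
    qed
    moreover have "0 \<in> A" using L0 unfolding A_def by (metis rangeI)
    moreover have "0 \<in> B" by (simp add: B_def)
    ultimately show "A \<inter> B = {0}" by blast
  qed
  define \<pi> where "\<pi> x = (\<Sum>i\<in>J. (sgnc r s i * hform r s' x (E i)) *s E i)" for x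
  have \<pi>A: "\<pi> x \<in> A" for x
  proof -
    have "\<pi> x = L (\<chi> i. sgnc r s i * hform r s' x (E i))" by (simp add: \<pi>_def L_def)
    then show ?thesis by (simp add: A_def)
  qed
  have \<pi>B: "x - \<pi> x \<in> B" for x
  proof -
    have "hform r s' (\<pi> x) (E i) = hform r s' x (E i)" if "i \<in> J" for i
    proof -
      have "hform r s' (\<pi> x) (E i) = (\<Sum>j\<in>J. if j = i then hform r s' x (E i) else 0)"
        unfolding \<pi>_def hform_sum_left hform_scale_left
        by (rule sum.cong) (use sg(1) in \<open>auto simp: EE mult_ac\<close>)
      then show ?thesis using that by (simp add: J_def)
    qed
    then show ?thesis by (simp add: B_def hform_diff_left)
  qed
  have projA: "proj_along A B x = \<pi> x" and projB: "proj_along B A x = x - \<pi> x" for x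
    using proj_along_eq[OF AB \<pi>A \<pi>B, of x x] by simp_all
  have orthAB: "hform r s' x y = 0" if "x \<in> A" "y \<in> B" for x y
  proof -
    have "hform r s' y x = 0" using that by (auto simp: A_def B_def L_def hform_sum_right hform_scale_right)
    then show ?thesis using hform_swap_zero by blast
  qed
  define R where "R z = \<Phi> z - L z" for z
  \<comment> \<open>The span of the values of \<open>R\<close> as a double annihilator, so that membership is a holomorphic condition.\<close>
  define H where "H = {y :: complex^'m::{finite,linorder}. \<forall>c. (\<forall>z\<in>\<Omega>. (\<Sum>i\<in>UNIV. c i * R z $ i) = 0) \<longrightarrow> (\<Sum>i\<in>UNIV. c i * y $ i) = 0}"
  \<comment> \<open>For fixed \<open>w\<close> the form is a linear functional of its first
    argument, so it is one of the functionals tested in \<open>H\<close>.\<close>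
  have H_functional: "hform r s' y w = 0" if "y \<in> H" "\<And>z. z \<in> \<Omega> \<Longrightarrow> hform r s' (R z) w = 0" for y w
  proof -
    have eq: "hform r s' x w = (\<Sum>i\<in>UNIV. (sgnc r s' i * cnj (w $ i)) * x $ i)" for x
      unfolding hform_sgnc by (rule sum.cong) (auto simp: mult_ac)
    show ?thesis using that unfolding H_def eq by simp
  qed
  have RE: "hform r s' (R z) (E i) = 0" if "z \<in> \<Omega>" for z i
    by (simp add: R_def hform_diff_left \<Phi>E[OF that] LE)
  have RR: "hform r s' (R z) (R w) = 0" if "z \<in> \<Omega>" "w \<in> \<Omega>" for z w
  proof -
    have "hform r s' (L z) (\<Phi> w) = hform r s z w"
      using arg_cong[OF \<Phi>L[OF that(2), of z], of cnj] by (simp add: hform_cnj)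
    then show ?thesis by (simp add: R_def hform_linear \<Phi>[OF that] \<Phi>L[OF that(1)] LL)
  qed
  have HB: "H \<subseteq> B" using H_functional RE by (auto simp: B_def)
  have H_null: "null_space r s' H"
  proof -
    have "hform r s' y y' = 0" if "y \<in> H" "y' \<in> H" for y y'
    proof (rule H_functional[OF that(1)])
      fix z assume z: "z \<in> \<Omega>"
      have "hform r s' y' (R z) = 0" by (rule H_functional[OF that(2)]) (rule RR[OF _ z])
      then show "hform r s' (R z) y' = 0" using hform_swap_zero by blast
    qed
    moreover have "csubspace H"
    proof -
      have "(\<Sum>i\<in>UNIV. c i * (k *s x) $ i) = k * (\<Sum>i\<in>UNIV. c i * x $ i)" for c k and x :: "complex^'m::{finite,linorder}"
        by (simp add: sum_distrib_left mult_ac)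
      then show ?thesis by (simp add: csubspace_def H_def distrib_left sum.distrib del: vector_smult_component)
    qed
    ultimately show ?thesis by (simp add: null_space_def)
  qed
  have \<pi>_scale: "\<pi> (c *s x) = c *s \<pi> x" for c x
    by (simp add: \<pi>_def hform_scale_left vec_eq_iff sum_distrib_left mult_ac)
  have \<pi>_hol: "vhol S (\<lambda>t. \<pi> (Y t))" if Y: "vhol S Y" for S Y
    unfolding vhol_def
  proof
    fix i
    show "(\<lambda>t. \<pi> (Y t) $ i) holomorphic_on S"
      unfolding \<pi>_def sum_component vector_smult_component
      by (intro holomorphic_intros holomorphic_hform_left Y)
  qed
  have \<pi>\<Phi>: "\<pi> (\<Phi> z) = L z" if "z \<in> \<Omega>" for z
    unfolding \<pi>_def L_def by (rule sum.cong) (use sg(1) in \<open>auto simp: \<Phi>E[OF that] mult.assoc[symmetric]\<close>)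
  have F_H: "F z - \<pi> (F z) \<in> H" if z: "z \<in> U" for z
    unfolding H_def
  proof (intro CollectI allI impI)
    fix c assume c: "\<forall>z\<in>\<Omega>. (\<Sum>i\<in>UNIV. c i * R z $ i) = 0"
    \<comment> \<open>Each functional that annihilates \<open>R\<close> becomes a scale-invariant
      condition on \<open>F z\<close>, and so continues from \<open>\<Omega>\<close> to
      \<open>U\<close>.\<close>
    define \<Lambda> where "\<Lambda> y = (\<Sum>i\<in>UNIV. c i * (y - \<pi> y) $ i)" for y
    have \<Lambda>_scale: "\<Lambda> (k *s y) = k * \<Lambda> y" for k y
      by (simp add: \<Lambda>_def \<pi>_scale sum_distrib_left algebra_simps)
    have "\<Lambda> (F z) = 0"
    proof (rule lift_identity_principle[where \<Lambda> = "\<lambda>_. \<Lambda>", OF UF \<Lambda>_scale _ \<Omega> _ z])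
      fix S and Y :: "complex \<Rightarrow> complex^'m::{finite,linorder}" assume "vhol S Y"
      then show "(\<lambda>t. \<Lambda> (Y t)) holomorphic_on S"
        unfolding \<Lambda>_def using \<pi>_hol[of S Y] by (auto simp: vhol_def intro!: holomorphic_intros)
    next
      fix w assume w: "w \<in> \<Omega>"
      from F\<Phi>[OF w] obtain k where "F w = k *s \<Phi> w" by blast
      moreover have "\<Lambda> (\<Phi> w) = 0" using c w by (simp add: \<Lambda>_def \<pi>\<Phi>[OF w] flip: R_def)
      ultimately show "\<Lambda> (F w) = 0" by (simp add: \<Lambda>_scale)
    qed
    then show "(\<Sum>i\<in>UNIV. c i * (F z - \<pi> (F z)) $ i) = 0" by (simp add: \<Lambda>_def)
  qed
  \<comment> \<open>On \<open>\<Omega>\<close> the coefficients of \<open>\<pi> (F z)\<close> with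
    respect to the \<open>E i\<close> are proportional to the coordinates of \<open>z\<close>.
    Vanishing 2 by 2 minors express this linearly in \<open>F z\<close>.\<close>
  have cross: "(sgnc r s i * hform r s' (F z) (E i)) * z $ j = (sgnc r s j * hform r s' (F z) (E j)) * z $ i"
    if ij: "i \<in> J" "j \<in> J" and z: "z \<in> U" for i j z
  proof -
    define \<Lambda> where "\<Lambda> z y = (sgnc r s i * hform r s' y (E i)) * z $ j - (sgnc r s j * hform r s' y (E j)) * z $ i"
      for z :: "complex^'n::{finite,linorder}" and y
    have \<Lambda>_scale: "\<Lambda> z (k *s y) = k * \<Lambda> z y" for z k y by (simp add: \<Lambda>_def hform_scale_left algebra_simps)
    have "\<Lambda> z (F z) = 0"
    proof (rule lift_identity_principle[where \<Lambda> = \<Lambda>, OF UF \<Lambda>_scale _ \<Omega> _ z])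
      fix S and Z :: "complex \<Rightarrow> complex^'n::{finite,linorder}" and Y :: "complex \<Rightarrow> complex^'m::{finite,linorder}"
      assume "vhol S Z" "vhol S Y"
      then show "(\<lambda>t. \<Lambda> (Z t) (Y t)) holomorphic_on S"
        unfolding \<Lambda>_def by (intro holomorphic_intros holomorphic_hform_left) (auto simp: vhol_def)
    next
      fix w assume w: "w \<in> \<Omega>"
      from F\<Phi>[OF w] obtain k where "F w = k *s \<Phi> w" by blast
      moreover have "\<Lambda> w (\<Phi> w) = 0"
        using sg(1)[OF ij(1)] sg(1)[OF ij(2)] by (simp add: \<Lambda>_def \<Phi>E[OF w] mult.assoc[symmetric])
      ultimately show "\<Lambda> w (F w) = 0" by (simp add: \<Lambda>_scale)
    qed
    then show ?thesis by (simp add: \<Lambda>_def)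
  qed
  have "card J = r + s" using card_idx_range[where 'n='n, of "r + s" 0] assms(3) by (simp add: J_def)
  then have J2: "\<exists>i\<in>J. i \<noteq> j" for j
  proof -
    have "\<not> J \<subseteq> {j}" using \<open>card J = r + s\<close> assms(1,2) card_mono[of "{j}" J] by auto
    then show ?thesis by blast
  qed
  have \<pi>F: "L z \<noteq> 0 \<and> (\<exists>c. c \<noteq> 0 \<and> \<pi> (F z) = c *s L z)" if z: "z \<in> U" and nz: "\<pi> (F z) \<noteq> 0" for z
  proof -
    \<comment> \<open>If all these coordinates vanish, the minors say nothing at \<open>z\<close>.
      Moving along \<open>u i\<close> with \<open>i \<noteq> j\<close> makes coordinate
      \<open>i\<close> nonzero and leaves coordinate \<open>j\<close> at 0, so coefficient
      \<open>j\<close> vanishes nearby and, by continuity of a local lift, at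
      \<open>z\<close>.\<close>
    have "\<exists>i\<in>J. z $ i \<noteq> 0"
    proof (rule ccontr)
      assume "\<not> ?thesis"
      then have z0: "z $ i = 0" if "i \<in> J" for i using that by blast
      from UF(2) have "\<forall>z0\<in>U. \<exists>W G. open W \<and> z0 \<in> W \<and> W \<subseteq> U \<and> holo_on W G \<and>
          (\<forall>z\<in>W. G z \<noteq> 0 \<and> (\<exists>c. c \<noteq> 0 \<and> F z = c *s G z))" unfolding holo_proj_map_def by (elim conjE)
      from bspec[OF this z] obtain W G where W: "open W" "z \<in> W" "W \<subseteq> U" and GW: "holo_on W G"
        and FG: "\<And>z. z \<in> W \<Longrightarrow> G z \<noteq> 0 \<and> (\<exists>c. c \<noteq> 0 \<and> F z = c *s G z)"
        by (elim exE conjE) blast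
      have "hform r s' (F z) (E j) = 0" if j: "j \<in> J" for j
      proof -
        from J2[of j] obtain i where i: "i \<in> J" "i \<noteq> j" by blast
        define S where "S = {t. z + t *s u i \<in> W}"
        have oS: "open S" "0 \<in> S" using W open_line_preimage[OF W(1), of z "u i"] by (auto simp: S_def)
        define f where "f t = hform r s' (G (z + t *s u i)) (E j)" for t
        have "f t = 0" if t: "t \<in> S" "t \<noteq> 0" for t
        proof -
          define y where "y = z + t *s u i"
          have y: "y \<in> W" "y \<in> U" "y $ j = 0" "y $ i = t"
            using t i j W(3) z0 by (auto simp: y_def S_def u_def axis_def)
          from cross[OF i(1) j y(2)] have "hform r s' (F y) (E j) = 0" using y t sg(2)[OF j] by simp
          moreover from FG[OF y(1)] obtain k where "k \<noteq> 0" "F y = k *s G y" by blast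
          ultimately show ?thesis by (simp add: f_def hform_scale_left flip: y_def)
        qed
        moreover have "isCont f 0"
        proof -
          have "f holomorphic_on S" unfolding f_def
            by (rule holomorphic_hform_left, rule vhol_comp[OF GW vhol_line oS(1)]) (simp add: S_def)
          then show ?thesis using oS holomorphic_on_imp_continuous_on continuous_on_eq_continuous_at by blast
        qed
        then have "(f \<longlongrightarrow> f 0) (at 0)" by (simp add: isCont_def)
        moreover have "\<forall>\<^sub>F t in at 0. t \<in> S" using oS by (rule eventually_at_in_open')
        then have "\<forall>\<^sub>F t in at 0. f t = 0"
          using eventually_neq_at_within[of 0 0 UNIV] by eventually_elim (use calculation(1) in blast)
        then have "(f \<longlongrightarrow> 0) (at 0)" by (rule tendsto_eventually)
        ultimately have "f 0 = 0" using tendsto_unique[OF at_neq_bot] by blast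
        moreover from FG[OF W(2)] obtain k where "F z = k *s G z" by blast
        ultimately show ?thesis by (simp add: f_def hform_scale_left)
      qed
      then have "\<pi> (F z) = 0" by (simp add: \<pi>_def)
      with nz show False by simp
    qed
    then obtain i where i: "i \<in> J" "z $ i \<noteq> 0" by blast
    define c where "c = sgnc r s i * hform r s' (F z) (E i) / z $ i"
    have "sgnc r s j * hform r s' (F z) (E j) = c * z $ j" if "j \<in> J" for j
      using cross[OF i(1) that z] i(2) by (simp add: c_def field_simps)
    then have "\<pi> (F z) = c *s L z"
      by (simp add: \<pi>_def L_def vec_eq_iff sum_distrib_left mult.assoc)
    moreover from this nz have "c \<noteq> 0" "L z \<noteq> 0" by auto
    ultimately show ?thesis by blast
  qed
  have standard: "standard_map r s r s' U F" if "\<And>z. z \<in> U \<Longrightarrow> F z - \<pi> (F z) = 0"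
    unfolding standard_map_def
  proof (intro exI[of _ L] conjI ballI L_iso)
    fix z assume z: "z \<in> U"
    have "F z = \<pi> (F z)" using that[OF z] by simp
    with \<pi>F[OF z] F0[OF z] show "L z \<noteq> 0" "\<exists>c. c \<noteq> 0 \<and> F z = c *s L z" by auto
  qed
  have La: "L a \<noteq> 0"
  proof
    assume "L a = 0"
    then have "hform r s a y = 0" for y using LL[of a y] by simp
    then show False using nonrad[OF a] by blast
  qed
  have "quasi_standard r s r s' U F"
  \<comment> \<open>The decomposition demands a nonzero \<open>B\<close>; for \<open>B = {0}\<close>
    there is no null component and the map is standard.\<close>
  proof (cases "B = {0}")
    case True
    then have "F z - \<pi> (F z) = 0" if "z \<in> U" for z using F_H[OF that] HB by blast
    then show ?thesis using standard by (simp add: quasi_standard_def)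
  next
    case False
    have "\<exists>c. c \<noteq> 0 \<and> F a = c *s \<Phi> a" by (rule F\<Phi>[OF a])
    then have "\<pi> (F a) \<noteq> 0" using La by (auto simp: \<pi>_scale \<pi>\<Phi>[OF a])
    have "\<exists>A B. csubspace A \<and> csubspace B \<and> A \<noteq> {0} \<and> B \<noteq> {0}
        \<and> (\<forall>x. \<exists>a\<in>A. \<exists>b\<in>B. x = a + b) \<and> A \<inter> B = {0}
        \<and> (\<forall>a\<in>A. \<forall>b\<in>B. hform r s' a b = 0)
        \<and> (\<exists>L. isometry_map r s r s' L \<and> range L \<subseteq> A
               \<and> (\<exists>z\<in>U. proj_along A B (F z) \<noteq> 0)
               \<and> (\<forall>z\<in>U. proj_along A B (F z) \<noteq> 0 \<longrightarrow>
                    L z \<noteq> 0 \<and> (\<exists>c. c \<noteq> 0 \<and> proj_along A B (F z) = c *s L z)))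
        \<and> (\<exists>H. null_space r s' H \<and> H \<subseteq> B \<and> (\<forall>z\<in>U. proj_along B A (F z) \<in> H))"
    proof (rule exI[of _ A], rule exI[of _ B], intro conjI)
      show "A \<noteq> {0}" using La by (auto simp: A_def)
      show "\<forall>x. \<exists>a\<in>A. \<exists>b\<in>B. x = a + b"
      proof
        fix x
        show "\<exists>a\<in>A. \<exists>b\<in>B. x = a + b" by (rule bexI[OF _ \<pi>A[of x]], rule bexI[OF _ \<pi>B[of x]]) simp
      qed
      show "\<exists>L. isometry_map r s r s' L \<and> range L \<subseteq> A
               \<and> (\<exists>z\<in>U. proj_along A B (F z) \<noteq> 0)
               \<and> (\<forall>z\<in>U. proj_along A B (F z) \<noteq> 0 \<longrightarrow>
                    L z \<noteq> 0 \<and> (\<exists>c. c \<noteq> 0 \<and> proj_along A B (F z) = c *s L z))"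
        unfolding projA
      proof (intro exI[of _ L] conjI)
        show "range L \<subseteq> A" by (simp add: A_def)
        show "\<exists>z\<in>U. \<pi> (F z) \<noteq> 0" using \<open>\<pi> (F a) \<noteq> 0\<close> a \<Omega>(3) by blast
        show "\<forall>z\<in>U. \<pi> (F z) \<noteq> 0 \<longrightarrow> L z \<noteq> 0 \<and> (\<exists>c. c \<noteq> 0 \<and> \<pi> (F z) = c *s L z)" using \<pi>F by blast
      qed (rule L_iso)
      show "\<exists>H. null_space r s' H \<and> H \<subseteq> B \<and> (\<forall>z\<in>U. proj_along B A (F z) \<in> H)"
        unfolding projB using H_null HB F_H by blast
    qed (use AB False orthAB in auto)
    then show ?thesis unfolding quasi_standard_def by blast
  qed
  moreover have "standard_map r s r s' U F" if m: "CARD('m) = r + s'"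
  proof (rule standard)
    fix z assume z: "z \<in> U"
    define y where "y = F z - \<pi> (F z)"
    have yH: "y \<in> H" using F_H[OF z] by (simp add: y_def)
    \<comment> \<open>The \<open>E i\<close> of positive sign are \<open>r\<close> orthogonal
      positive vectors orthogonal to \<open>y\<close>. As \<open>y\<close> is null, its first
      \<open>r + s'\<close> coordinates vanish, and here these are all of them.\<close>
    define e where "e k = E (inv idx k)" for k
    have idx_inv: "idx (inv idx k :: 'n) = k" if "k < r" for k
    proof (rule f_inv_into_f)
      show "k \<in> range (idx :: 'n \<Rightarrow> nat)" unfolding idx_image using that assms(3) by simp
    qed
    have e_orth: "hform r s' (e i) (e j) = 0" if "i < r" "j < r" "i \<noteq> j" for i j
      using idx_inv[OF that(1)] idx_inv[OF that(2)] that(3) by (auto simp: e_def EE)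
    have e_pos: "0 < Re (hform r s' (e j) (e j))" if "j < r" for j
      using idx_inv[OF that] that by (simp add: e_def EE sgnc_def)
    have ye: "hform r s' y (e j) = 0" if "j < r" for j
    proof -
      have "inv idx j \<in> J" using idx_inv[OF that] that by (simp add: J_def)
      then show ?thesis using yH HB by (auto simp: B_def e_def)
    qed
    have "hform r s' y y = 0" using H_null yH by (auto simp: null_space_def)
    then have "y $ i = 0" for i
    proof -
      have "idx i \<in> range (idx :: 'm \<Rightarrow> nat)" by simp
      then have "idx i < r + s'" unfolding idx_image m by simp
      then show ?thesis
        using orthogonal_complement_nonpos(2)[of r s' e y i, OF e_orth e_pos ye] \<open>hform r s' y y = 0\<close> by simp
    qed
    then show "F z - \<pi> (F z) = 0" by (simp add: y_def vec_eq_iff)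
  qed
  ultimately show ?thesis by blast
qed

thm_deps mainTheorem15

end
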